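(* Let $F\subseteq[0,1]^2$ be the attractor of an IFS $\{S_i\}_{i\in\mathcal I}$ of the form $S_i(x,y)=(\beta x,\alpha y)+\underline t_i$ with $0<\alpha<\beta<1$ fixed, mapping $X=[0,1]^2$ into itself, such that the interiors of the rectangles $S_i(X)$ are pairwise disjoint. Let $m=|\mathcal I|$, and let $\pi$, $s$ and $H$ be as defined in the context. Then $$\max\left\{\dim_{\mathrm B}\pi F+\frac{\log (m\beta^s)}{-\log\alpha},\ \ \dim_{\mathrm A}\pi F+\frac{H}{-\log\alpha}\right\}\ \le\ \dim_{\mathrm A}F\ \le\ \dim_{\mathrm A}\pi F+\frac{\log (m\beta^s)}{-\log\alpha}.$$
   Context: Setting: $X=[0,1]^2$; $\mathcal I$ is a finite index set, $m=|\mathcal I|$; $\alpha,\beta\in(0,1)$ with $\alpha<\beta$ are fixed constants; for each $i\in\mathcal I$, $S_i(x,y)=(\beta x,\alpha y)+\underline t_i$ with translation vector $\underline t_i\in[0,1-\beta]\times[0,1-\alpha]$. The rectangular open set condition is assumed: the interiors of the rectangles $S_i(X)$, $i\in\mathcal I$, are pairwise disjoint. $F$ is the attractor, i.e. the unique non-empty compact set with $F=\bigcup_{i\in\mathcal I}S_i(F)$. No grid structure is assumed. For a word $\mathbf i=(i_1,\dots,i_k)\in\mathcal I^k$, $S_{\mathbf i}=S_{i_1}\circ\cdots\circ S_{i_k}$ and $|\mathbf i|=k$; $\mathcal I^*=\bigcup_{k\ge1}\mathcal I^k$. $\mu$ is the Borel probability measure on $F$ with $\mu(S_{\mathbf i}(X))=m^{-k}$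 for all $\mathbf i\in\mathcal I^k$; precisely, it is the push-forward of the uniform Bernoulli measure on $\mathcal I^{\mathbb N}$ under the natural coding map. $\pi$ is orthogonal projection onto the first coordinate and $\pi\mu=\mu\circ\pi^{-1}$. Define $$s=\sup\{t:\exists C>0\text{ with }\pi\mu(I)\le C|I|^t\text{ for all subintervals }I\subseteq[0,1]\},$$ where $|I|$ is the length of $I$. Define an equivalence relation on $\mathcal I^*$ by $\mathbf i\sim\mathbf j$ if and only if $\pi S_{\mathbf i}(X)=\pi S_{\mathbf j}(X)$, let $[\mathbf i]$ be the equivalence class of $\mathbf i$, $|[\mathbf i]|$ its cardinality, and $$H=\sup_{\mathbf i\in\mathcal I^*}\frac{\log|[\mathbf i]|}{|\mathbf i|}.$$ $\dim_{\mathrm B}$ is box-counting dimension (it exists for the self-similar set $\pi F$). $\dim_{\mathrm A}$ is Assouad dimension: $\dim_{\mathrm A}E=\inf\{u:\exists C>0\ \forall\,0<r<R\ \forall x\in E,\ N_r(B(x,R)\cap E)\le C(R/r)^u\}$, where $N_r(\cdot)$ is the smallest number of open sets of diameter at most $r$ needed to cover the set. *)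

theory Defs
  imports "HOL-Probability.Probability"
begin

text \<open>Boundedness is required explicitly because \<^const>\<open>diameter\<close> is a real-valued supremum,
  hence meaningless for unbounded sets.\<close>

definition covering_number :: "real \<Rightarrow> 'a::metric_space set \<Rightarrow> nat" where
  "covering_number r E =
    (LEAST n. \<exists>\<U>. finite \<U> \<and> card \<U> = n \<and> E \<subseteq> \<Union>\<U> \<and>
      (\<forall>U\<in>\<U>. open U \<and> bounded U \<and> diameter U \<le> r))"

text \<open>This is the box dimension whenever the limit exists; otherwise
  the value is unspecified.\<close>

definition box_dim :: "'a::euclidean_space set \<Rightarrow> real" where
  "box_dim E = Lim (at_right 0) (\<lambda>r. ln (real (covering_number r E)) / (- ln r))"

definition assouad_dim :: "'a::euclidean_space set \<Rightarrow> real" where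
  "assouad_dim E =
    Inf {u::real. \<exists>C>0. \<forall>r R. 0 < r \<and> r < R \<longrightarrow>
      (\<forall>x\<in>E. real (covering_number r (ball x R \<inter> E)) \<le> C * (R / r) powr u)}"

definition unit_square :: "(real \<times> real) set" where
  "unit_square = {0..1} \<times> {0..1}"

definition ifs_map :: "real \<Rightarrow> real \<Rightarrow> ('i \<Rightarrow> real \<times> real) \<Rightarrow> 'i \<Rightarrow> real \<times> real \<Rightarrow> real \<times> real" where
  "ifs_map \<alpha> \<beta> t i = (\<lambda>(x, y). (\<beta> * x, \<alpha> * y) + t i)"

definition is_attractor :: "'i set \<Rightarrow> ('i \<Rightarrow> 'a \<Rightarrow> 'a::topological_space) \<Rightarrow> 'a set \<Rightarrow> bool" where
  "is_attractor I S F \<longleftrightarrow> F \<noteq> {} \<and> compact F \<and> F = (\<Union>i\<in>I. S i ` F)"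

definition word_map :: "('i \<Rightarrow> 'a \<Rightarrow> 'a) \<Rightarrow> 'i list \<Rightarrow> 'a \<Rightarrow> 'a" where
  "word_map S w = foldr (\<circ>) (map S w) id"

definition nonempty_words :: "'i set \<Rightarrow> 'i list set" where
  "nonempty_words I = {w \<in> lists I. w \<noteq> []}"

definition uniform_bernoulli :: "'i set \<Rightarrow> (nat \<Rightarrow> 'i) measure" where
  "uniform_bernoulli I = Pi\<^sub>M UNIV (\<lambda>_. uniform_count_measure I)"

text \<open>For contractions the limit does not depend on the base point \<open>(0, 0)\<close>.\<close>

definition coding_map :: "('i \<Rightarrow> real \<times> real \<Rightarrow> real \<times> real) \<Rightarrow> (nat \<Rightarrow> 'i) \<Rightarrow> real \<times> real" where
  "coding_map S \<omega> = lim (\<lambda>n. word_map S (map \<omega> [0..<n]) (0, 0))"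

definition ifs_measure ::
    "'i set \<Rightarrow> ('i \<Rightarrow> real \<times> real \<Rightarrow> real \<times> real) \<Rightarrow> (real \<times> real) measure" where
  "ifs_measure I S = distr (uniform_bernoulli I) borel (coding_map S)"

text \<open>Only nondegenerate intervals are considered: since \<^prop>\<open>0 powr 0 = (0::real)\<close>, admitting
  single points would wrongly exclude the exponent \<open>0\<close> for measures with atoms.\<close>

definition interval_exponent :: "real measure \<Rightarrow> real" where
  "interval_exponent \<nu> =
    Sup {t::real. \<exists>C>0. \<forall>J. is_interval J \<and> J \<subseteq> {0..1} \<and> 0 < measure lborel J \<longrightarrow>
      measure \<nu> J \<le> C * measure lborel J powr t}"

definition same_projection ::
    "'i set \<Rightarrow> ('i \<Rightarrow> real \<times> real \<Rightarrow> real \<times> real) \<Rightarrow> ('i list \<times> 'i list) set" where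
  "same_projection I S =
    {(v, w). v \<in> nonempty_words I \<and> w \<in> nonempty_words I \<and>
      fst ` word_map S v ` unit_square = fst ` word_map S w ` unit_square}"

definition overlap_entropy :: "'i set \<Rightarrow> ('i \<Rightarrow> real \<times> real \<Rightarrow> real \<times> real) \<Rightarrow> real" where
  "overlap_entropy I S =
    (SUP w\<in>nonempty_words I. ln (real (card (same_projection I S `` {w}))) / real (length w))"

end

theory Submission
  imports Defs
begin

text \<open>Covering numbers are replaced by grid counts, i.e. numbers of cells \<open>\<lfloor>x / r\<rfloor>\<close> meeting a set. A
  cylinder of level \<open>k\<close> has height \<open>\<alpha> ^ k\<close> and width \<open>\<beta> ^ k\<close>, and by disjointness of the rectangles a ball
  of radius comparable to \<open>\<alpha> ^ k\<close> meets boundedly many of them. Inside one of them, the cylinders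
  of level \<open>k + n\<close> meeting the ball correspond to words of length \<open>n\<close> whose projected intervals
  meet an interval of length about \<open>\<alpha> ^ k / \<beta> ^ k\<close>; the projected measure controls their number,
  and each of them contributes a grid count of a piece of the projection of \<open>F\<close>. This gives the upper bound.

  For the lower bounds one exhibits many cylinders of level \<open>k + n\<close> in one ball of radius about
  \<open>\<alpha> ^ k\<close>. Either the words are those meeting an interval whose measure violates the Hoelder
  bound with an exponent beyond the Frostman exponent of the projected measure and every cylinder
  contributes a grid count of the whole projection, or the words are concatenations of words from one
  class of coinciding projections and every cylinder contributes the same extremal piece of the projection.\<close>

section \<open>Grid counts and covering numbers\<close>

text \<open>Infimum and supremum in the Assouad dimension and in \<open>s\<close> need not be
  attained. All estimates are therefore made for single exponents, and the extremal values are taken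
  only at the end. For the lower bounds the level k is tied to n: (\<alpha>/\<beta>)^k is comparable
  to \<beta>^n, up to the radius of the projected ball where one is given, so that \<alpha>^k is
  comparable to the width \<beta>^(k+n). An arbitrary common prefix of length k then squeezes the
  heights of all chosen cylinders into one ball, and only their projections have to be close. The
  upper estimate has two regimes. Once the ball is wider than a cylinder of level k+n, more words
  occur, but each shows no more than the whole projection. The extra words are harmless because a
  Hoelder exponent of the projected measure never exceeds an Assouad exponent of the projection. As
  \<open>box_dim\<close> is a \<open>Lim\<close>, the limit has to be shown to exist.
  Supermultiplicativity of the counts at scales \<beta>^n, up to a constant, yields this and the
  uniform lower count needed for the first lower bound.\<close>

definition grid_count :: "real \<Rightarrow> real set \<Rightarrow> nat" where
  "grid_count r E = card ((\<lambda>x. \<lfloor>x / r\<rfloor>) ` E)"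

definition plane_cell :: "real \<Rightarrow> real \<times> real \<Rightarrow> int \<times> int" where
  "plane_cell r p = (\<lfloor>fst p / r\<rfloor>, \<lfloor>snd p / r\<rfloor>)"

definition plane_grid_count :: "real \<Rightarrow> (real \<times> real) set \<Rightarrow> nat" where
  "plane_grid_count r E = card (plane_cell r ` E)"

text \<open>The device behind all comparisons of counts: both counts are images of one index set, so
  it suffices to bound the values of \<open>f\<close> on a fibre of \<open>g\<close>. Finiteness is
  carried along because \<open>card\<close> of an infinite set is 0.\<close>

lemma card_image_le_fibres:
  assumes "finite (g ` X)"
    and "\<And>z. z \<in> g ` X \<Longrightarrow> finite (f ` {x \<in> X. g x = z}) \<and> card (f ` {x \<in> X. g x = z}) \<le> M"
  shows "finite (f ` X) \<and> card (f ` X) \<le> M * card (g ` X)"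
proof -
  have eq: "f ` X = (\<Union>z\<in>g ` X. f ` {x \<in> X. g x = z})" by auto
  have "card (\<Union>z\<in>g ` X. f ` {x \<in> X. g x = z}) \<le> (\<Sum>z\<in>g ` X. card (f ` {x \<in> X. g x = z}))"
    by (rule card_UN_le[OF assms(1)])
  also have "\<dots> \<le> (\<Sum>z\<in>g ` X. M)"
    by (intro sum_mono) (use assms(2) in blast)
  finally have "card (f ` X) \<le> M * card (g ` X)" using eq by (simp add: mult.commute)
  moreover have "finite (f ` X)" unfolding eq using assms by blast
  ultimately show ?thesis by blast
qed

text \<open>Exchanging a and b makes the one-sided hypothesis two-sided. A crude interval of length
  2c around any element gives finiteness first; only then does \<open>Min A\<close> exist and give
  the sharp count.\<close>

lemma card_int_set_le:
  fixes A :: "int set"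
  assumes "\<And>a b. a \<in> A \<Longrightarrow> b \<in> A \<Longrightarrow> a - b \<le> int c"
  shows "finite A \<and> card A \<le> c + 1"
proof (cases "A = {}")
  case False
  then obtain a0 where a0: "a0 \<in> A" by blast
  have "A \<subseteq> {a0 - int c..a0 + int c}"
  proof
    fix a assume "a \<in> A"
    then show "a \<in> {a0 - int c..a0 + int c}" using assms[of a a0] assms[of a0 a] a0 by auto
  qed
  then have fin: "finite A" using finite_subset by blast
  have "A \<subseteq> {Min A..Min A + int c}"
  proof
    fix a assume "a \<in> A"
    then show "a \<in> {Min A..Min A + int c}" using assms[of a "Min A"] fin Min_in[OF fin False] by auto
  qed
  then have "card A \<le> card {Min A..Min A + int c}" by (intro card_mono) auto
  then show ?thesis using fin by simp
qed simp

lemma floor_diff_le: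
  assumes "x - y \<le> real c * r" "r > 0"
  shows "\<lfloor>x / r\<rfloor> - \<lfloor>y / r\<rfloor> \<le> int c"
proof -
  have "x / r \<le> y / r + real_of_int (int c)" using assms by (simp add: field_simps)
  then have "\<lfloor>x / r\<rfloor> \<le> \<lfloor>y / r + real_of_int (int c)\<rfloor>" by (rule floor_mono)
  then show ?thesis by simp
qed

lemma floor_eq_imp_close:
  assumes "\<lfloor>x / r\<rfloor> = \<lfloor>y / r\<rfloor>" "r > 0"
  shows "x - y < (r::real)"
proof -
  have "x / r < y / r + 1" using assms(1) by linarith
  then show ?thesis using assms(2) by (simp add: field_simps)
qed

lemma card_floor_image_le:
  assumes "\<And>x y. x \<in> E \<Longrightarrow> y \<in> E \<Longrightarrow> f x - f y \<le> real c * r" "r > 0"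
  shows "finite ((\<lambda>x. \<lfloor>f x / r\<rfloor>) ` E) \<and> card ((\<lambda>x. \<lfloor>f x / r\<rfloor>) ` E) \<le> c + 1"
  by (rule card_int_set_le) (use assms floor_diff_le in blast)

lemma card_plane_cell_image_le:
  assumes "\<And>x y. x \<in> E \<Longrightarrow> y \<in> E \<Longrightarrow> fst (f x) - fst (f y) \<le> real c * r"
    and "\<And>x y. x \<in> E \<Longrightarrow> y \<in> E \<Longrightarrow> snd (f x) - snd (f y) \<le> real d * r" and "r > 0"
  shows "finite ((\<lambda>x. plane_cell r (f x)) ` E)
    \<and> card ((\<lambda>x. plane_cell r (f x)) ` E) \<le> (c + 1) * (d + 1)"
proof -
  let ?A = "(\<lambda>x. \<lfloor>fst (f x) / r\<rfloor>) ` E" and ?B = "(\<lambda>x. \<lfloor>snd (f x) / r\<rfloor>) ` E"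
  have A: "finite ?A \<and> card ?A \<le> c + 1" by (rule card_floor_image_le[OF assms(1) assms(3)])
  have B: "finite ?B \<and> card ?B \<le> d + 1" by (rule card_floor_image_le[OF assms(2) assms(3)])
  have sub: "(\<lambda>x. plane_cell r (f x)) ` E \<subseteq> ?A \<times> ?B" by (auto simp: plane_cell_def)
  have fin: "finite (?A \<times> ?B)" using A B by blast
  have "card ((\<lambda>x. plane_cell r (f x)) ` E) \<le> card (?A \<times> ?B)" by (rule card_mono[OF fin sub])
  also have "\<dots> \<le> (c + 1) * (d + 1)"
    unfolding card_cartesian_product using A B by (intro mult_mono) auto
  finally show ?thesis using finite_subset[OF sub fin] by blast
qed

lemma fst_diff_le_dist: "fst p - fst q \<le> dist p (q :: real \<times> real)"
  using dist_fst_le[of p q] by (auto simp: dist_real_def)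

lemma snd_diff_le_dist: "snd p - snd q \<le> dist p (q :: real \<times> real)"
  using dist_snd_le[of p q] by (auto simp: dist_real_def)

lemma dist_plane_le: "dist p q \<le> \<bar>fst p - fst q\<bar> + \<bar>snd p - snd (q :: real \<times> real)\<bar>"
  unfolding dist_prod_def by (rule order_trans[OF sqrt_sum_squares_le_sum_abs]) (simp add: dist_real_def)

lemma bounded_imp_nat_mult:
  fixes E :: "'a::metric_space set"
  assumes "bounded E" "r > 0"
  obtains c where "\<And>x y. x \<in> E \<Longrightarrow> y \<in> E \<Longrightarrow> dist x y \<le> real c * r"
proof -
  have "dist x y \<le> real (nat \<lceil>diameter E / r\<rceil>) * r" if "x \<in> E" "y \<in> E" for x y
  proof -
    have "dist x y \<le> diameter E" using diameter_bounded_bound[OF assms(1) that] .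
    also have "\<dots> \<le> real (nat \<lceil>diameter E / r\<rceil>) * r"
      using assms(2) real_nat_ceiling_ge[of "diameter E / r"] by (simp add: pos_divide_le_eq)
    finally show ?thesis .
  qed
  then show thesis by (rule that)
qed

lemma finite_grid:
  assumes "bounded E" "r > 0"
  shows "finite ((\<lambda>x::real. \<lfloor>x / r\<rfloor>) ` E)"
proof -
  obtain c where "\<And>x y. x \<in> E \<Longrightarrow> y \<in> E \<Longrightarrow> dist x y \<le> real c * r"
    using bounded_imp_nat_mult[OF assms] by blast
  then have "\<And>x y. x \<in> E \<Longrightarrow> y \<in> E \<Longrightarrow> x - y \<le> real c * r"
    by (fastforce simp: dist_real_def)
  then show ?thesis using card_floor_image_le[of E "\<lambda>x. x" c r] assms(2) by blast
qed

lemma finite_plane_grid: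
  assumes "bounded E" "r > 0"
  shows "finite (plane_cell r ` E)"
proof -
  obtain c where c: "\<And>x y. x \<in> E \<Longrightarrow> y \<in> E \<Longrightarrow> dist x y \<le> real c * r"
    using bounded_imp_nat_mult[OF assms] by blast
  have "finite ((\<lambda>x. plane_cell r x) ` E) \<and> card ((\<lambda>x. plane_cell r x) ` E) \<le> (c + 1) * (c + 1)"
    by (rule card_plane_cell_image_le)
      (use c fst_diff_le_dist snd_diff_le_dist order_trans assms(2) in blast)+
  then show ?thesis by blast
qed

lemma grid_count_mono:
  assumes "E \<subseteq> E'" "bounded E'" "r > 0"
  shows "grid_count r E \<le> grid_count r E'"
  unfolding grid_count_def using assms by (intro card_mono finite_grid) auto

lemma grid_count_ge_1:
  assumes "E \<noteq> {}" "bounded E" "r > 0"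
  shows "grid_count r E \<ge> 1"
  unfolding grid_count_def using finite_grid[OF assms(2,3)] assms(1)
  by (simp add: Suc_le_eq card_gt_0_iff)

lemma plane_grid_count_ge_1:
  assumes "E \<noteq> {}" "bounded E" "r > 0"
  shows "plane_grid_count r E \<ge> 1"
  unfolding plane_grid_count_def using finite_plane_grid[OF assms(2,3)] assms(1)
  by (simp add: Suc_le_eq card_gt_0_iff)

text \<open>A cell of side r meets at most c + 1 cells of side q. This serves both directions:
  coarsening with c = 1, and refining by a bounded factor with larger c.\<close>

lemma grid_count_rescale:
  assumes "bounded E" "r > 0" "q > 0" "r \<le> real c * q"
  shows "grid_count q E \<le> (c + 1) * grid_count r E"
proof -
  have "finite ((\<lambda>x. \<lfloor>x / q\<rfloor>) ` E) \<and>
      card ((\<lambda>x. \<lfloor>x / q\<rfloor>) ` E) \<le> (c + 1) * card ((\<lambda>x. \<lfloor>x / r\<rfloor>) ` E)"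
  proof (rule card_image_le_fibres[OF finite_grid[OF assms(1,2)]])
    fix z
    have "x - y \<le> real c * q" if "\<lfloor>x / r\<rfloor> = z" "\<lfloor>y / r\<rfloor> = z" for x y
      using floor_eq_imp_close[of x r y] that assms(2,4) by simp
    then show "finite ((\<lambda>x. \<lfloor>x / q\<rfloor>) ` {x \<in> E. \<lfloor>x / r\<rfloor> = z}) \<and>
        card ((\<lambda>x. \<lfloor>x / q\<rfloor>) ` {x \<in> E. \<lfloor>x / r\<rfloor> = z}) \<le> c + 1"
      by (intro card_floor_image_le assms(3)) auto
  qed
  then show ?thesis by (simp add: grid_count_def)
qed

lemma plane_grid_count_rescale:
  assumes "bounded E" "r > 0" "q > 0" "r \<le> real c * q"
  shows "plane_grid_count q E \<le> (c + 1)\<^sup>2 * plane_grid_count r E"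
proof -
  have "finite (plane_cell q ` E) \<and> card (plane_cell q ` E) \<le> (c + 1)\<^sup>2 * card (plane_cell r ` E)"
  proof (rule card_image_le_fibres[OF finite_plane_grid[OF assms(1,2)]])
    fix z
    have "fst x - fst y \<le> real c * q \<and> snd x - snd y \<le> real c * q"
      if "plane_cell r x = z" "plane_cell r y = z" for x y
      using floor_eq_imp_close[of "fst x" r "fst y"] floor_eq_imp_close[of "snd x" r "snd y"]
        that assms(2,4) by (auto simp: plane_cell_def)
    then have "finite ((\<lambda>x. plane_cell q x) ` {x \<in> E. plane_cell r x = z}) \<and>
        card ((\<lambda>x. plane_cell q x) ` {x \<in> E. plane_cell r x = z}) \<le> (c + 1) * (c + 1)"
      by (intro card_plane_cell_image_le assms(3)) auto
    then show "finite (plane_cell q ` {x \<in> E. plane_cell r x = z}) \<and>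
        card (plane_cell q ` {x \<in> E. plane_cell r x = z}) \<le> (c + 1)\<^sup>2"
      by (simp add: power2_eq_square)
  qed
  then show ?thesis by (simp add: plane_grid_count_def)
qed

section \<open>Comparison of covering numbers with grid counts\<close>

lemma covering_number_le:
  assumes "finite \<U>" "E \<subseteq> \<Union>\<U>" "\<And>U. U \<in> \<U> \<Longrightarrow> open U \<and> bounded U \<and> diameter U \<le> r"
  shows "covering_number r E \<le> card \<U>"
  unfolding covering_number_def using assms by (intro Least_le) blast

text \<open>\<open>LEAST\<close> says nothing when no witness exists, so a minimal cover can be
  extracted only after some admissible cover has been exhibited.\<close>

lemma covering_number_attained:
  assumes "finite \<U>" "E \<subseteq> \<Union>\<U>" "\<And>U. U \<in> \<U> \<Longrightarrow> open U \<and> bounded U \<and> diameter U \<le> r"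
  obtains \<V> where "finite \<V>" "card \<V> = covering_number r E" "E \<subseteq> \<Union>\<V>"
    "\<And>U. U \<in> \<V> \<Longrightarrow> bounded U \<and> diameter U \<le> r"
proof -
  let ?P = "\<lambda>n. \<exists>\<U>. finite \<U> \<and> card \<U> = n \<and> E \<subseteq> \<Union>\<U> \<and>
      (\<forall>U\<in>\<U>. open U \<and> bounded U \<and> diameter U \<le> r)"
  have "?P (card \<U>)" using assms by blast
  then have "?P (covering_number r E)" unfolding covering_number_def by (rule LeastI)
  then show thesis using that by blast
qed

lemma covering_number_by_cells:
  fixes E :: "'a::euclidean_space set"
  assumes "finite (f ` E)" "r > 0" "\<And>x. x \<in> E \<Longrightarrow> dist (c (f x)) x < r / 2"
  shows "covering_number r E \<le> card (f ` E)"
    and "\<exists>\<U>. finite \<U> \<and> E \<subseteq> \<Union>\<U> \<and> (\<forall>U\<in>\<U>. open U \<and> bounded U \<and> diameter U \<le> r)"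
proof -
  let ?\<U> = "(\<lambda>z. ball (c z) (r / 2)) ` (f ` E)"
  have U: "finite ?\<U>" "E \<subseteq> \<Union>?\<U>" "\<And>U. U \<in> ?\<U> \<Longrightarrow> open U \<and> bounded U \<and> diameter U \<le> r"
    using assms by auto
  have "covering_number r E \<le> card ?\<U>" by (rule covering_number_le[OF U])
  also have "\<dots> \<le> card (f ` E)" by (rule card_image_le[OF assms(1)])
  finally show "covering_number r E \<le> card (f ` E)" .
  show "\<exists>\<U>. finite \<U> \<and> E \<subseteq> \<Union>\<U> \<and> (\<forall>U\<in>\<U>. open U \<and> bounded U \<and> diameter U \<le> r)"
    using U by blast
qed

lemma card_image_le_covering_number:
  fixes E :: "'a::euclidean_space set"
  assumes "\<exists>\<U>. finite \<U> \<and> E \<subseteq> \<Union>\<U> \<and> (\<forall>U\<in>\<U>. open U \<and> bounded U \<and> diameter U \<le> r)"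
    and "\<And>U. bounded U \<Longrightarrow> diameter U \<le> r \<Longrightarrow> finite (f ` U) \<and> card (f ` U) \<le> M"
  shows "card (f ` E) \<le> M * covering_number r E"
proof -
  obtain \<V> where V: "finite \<V>" "card \<V> = covering_number r E" "E \<subseteq> \<Union>\<V>"
    "\<And>U. U \<in> \<V> \<Longrightarrow> bounded U \<and> diameter U \<le> r"
    using assms(1) covering_number_attained[of _ E r] by metis
  have fin: "finite (\<Union>U\<in>\<V>. f ` U)" using V assms(2) by blast
  have "card (f ` E) \<le> card (\<Union>U\<in>\<V>. f ` U)" by (rule card_mono[OF fin]) (use V(3) in blast)
  also have "\<dots> \<le> (\<Sum>U\<in>\<V>. card (f ` U))" by (rule card_UN_le[OF V(1)])
  also have "\<dots> \<le> (\<Sum>U\<in>\<V>. M)" by (intro sum_mono) (use assms(2) V(4) in blast)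
  finally show ?thesis using V(2) by (simp add: mult.commute)
qed

lemma floor_cell_close:
  assumes "r > 0"
  shows "\<bar>real_of_int \<lfloor>x / r\<rfloor> * r - x\<bar> < r"
proof -
  have "of_int \<lfloor>x / r\<rfloor> \<le> x / r" "x / r < of_int \<lfloor>x / r\<rfloor> + 1" by linarith+
  then have "of_int \<lfloor>x / r\<rfloor> * r \<le> x" "x < (of_int \<lfloor>x / r\<rfloor> + 1) * r"
    using assms by (simp_all only: pos_le_divide_eq pos_divide_less_eq)
  then show ?thesis by (simp add: algebra_simps abs_if)
qed

text \<open>Cells of side r / 2 lie strictly within r / 2 of their left end, so open balls of
  diameter r cover them; returning to side r costs the factor 3. Conversely a set of diameter at
  most r meets at most 2 cells.\<close>

lemma covering_number_grid_count:
  fixes E :: "real set"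
  assumes "bounded E" "r > 0"
  shows "covering_number r E \<le> 3 * grid_count r E" "grid_count r E \<le> 2 * covering_number r E"
proof -
  let ?f = "\<lambda>x. \<lfloor>x / (r / 2)\<rfloor>"
  have fin: "finite (?f ` E)" using finite_grid[of E "r / 2"] assms by simp
  have close: "dist (real_of_int (?f x) * (r / 2)) x < r / 2" for x
    using floor_cell_close[of "r / 2" x] assms(2) by (simp add: dist_real_def)
  note C = covering_number_by_cells[OF fin assms(2), where c = "\<lambda>z. real_of_int z * (r / 2)", OF close]
  have "covering_number r E \<le> grid_count (r / 2) E" unfolding grid_count_def by (rule C(1))
  also have "\<dots> \<le> (2 + 1) * grid_count r E" by (rule grid_count_rescale) (use assms in auto)
  finally show "covering_number r E \<le> 3 * grid_count r E" by simp
  show "grid_count r E \<le> 2 * covering_number r E"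
    unfolding grid_count_def
  proof (rule card_image_le_covering_number[OF C(2)])
    fix U :: "real set" assume "bounded U" "diameter U \<le> r"
    then have "x - y \<le> real 1 * r" if "x \<in> U" "y \<in> U" for x y
      using diameter_bounded_bound[OF _ that] by (simp add: dist_real_def)
    from card_floor_image_le[of U "\<lambda>x. x", OF this assms(2)]
    show "finite ((\<lambda>x. \<lfloor>x / r\<rfloor>) ` U) \<and> card ((\<lambda>x. \<lfloor>x / r\<rfloor>) ` U) \<le> 2" by simp
  qed
qed

text \<open>Side r / 4 is used because the distance to the corner of a cell is estimated by the sum
  of the two coordinate distances. The constants are 25 = (4 + 1)^2 from rescaling and 4 = 2 * 2
  cells met by a set of diameter at most r.\<close>

lemma covering_number_plane_grid_count:
  fixes E :: "(real \<times> real) set"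
  assumes "bounded E" "r > 0"
  shows "covering_number r E \<le> 25 * plane_grid_count r E"
    "plane_grid_count r E \<le> 4 * covering_number r E"
proof -
  let ?f = "plane_cell (r / 4)"
  have fin: "finite (?f ` E)" using finite_plane_grid[of E "r / 4"] assms by simp
  let ?c = "\<lambda>z. (real_of_int (fst z) * (r / 4), real_of_int (snd z) * (r / 4))"
  have close: "dist (?c (?f x)) x < r / 2" for x
  proof -
    have "dist (?c (?f x)) x \<le> \<bar>fst (?c (?f x)) - fst x\<bar> + \<bar>snd (?c (?f x)) - snd x\<bar>"
      by (rule dist_plane_le)
    then show ?thesis
      using floor_cell_close[of "r / 4" "fst x"] floor_cell_close[of "r / 4" "snd x"] assms(2)
      by (simp add: plane_cell_def)
  qed
  note C = covering_number_by_cells[OF fin assms(2), where c = ?c, OF close]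
  have "covering_number r E \<le> plane_grid_count (r / 4) E" unfolding plane_grid_count_def by (rule C(1))
  also have "\<dots> \<le> (4 + 1)\<^sup>2 * plane_grid_count r E"
    by (rule plane_grid_count_rescale) (use assms in auto)
  finally show "covering_number r E \<le> 25 * plane_grid_count r E" by simp
  show "plane_grid_count r E \<le> 4 * covering_number r E"
    unfolding plane_grid_count_def
  proof (rule card_image_le_covering_number[OF C(2)])
    fix U :: "(real \<times> real) set" assume U: "bounded U" "diameter U \<le> r"
    have d: "dist x y \<le> real 1 * r" if "x \<in> U" "y \<in> U" for x y
      using diameter_bounded_bound[OF U(1) that] U(2) by simp
    have "finite ((\<lambda>x. plane_cell r x) ` U) \<and> card ((\<lambda>x. plane_cell r x) ` U) \<le> (1 + 1) * (1 + 1)"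
      by (rule card_plane_cell_image_le)
        (use d fst_diff_le_dist snd_diff_le_dist order_trans assms(2) in blast)+
    then show "finite (plane_cell r ` U) \<and> card (plane_cell r ` U) \<le> 4" by simp
  qed
qed

section \<open>Assouad exponents\<close>

text \<open>The set whose infimum is \<open>assouad_dim\<close>, with the counting function left
  open so that comparable counts can be exchanged.\<close>

definition assouad_exponents :: "(real \<Rightarrow> 'a set \<Rightarrow> nat) \<Rightarrow> 'a::metric_space set \<Rightarrow> real set" where
  "assouad_exponents N E =
    {u. \<exists>C>0. \<forall>r R. 0 < r \<and> r < R \<longrightarrow> (\<forall>x\<in>E. real (N r (ball x R \<inter> E)) \<le> C * (R / r) powr u)}"

lemma assouad_exponents_mono:
  assumes "\<And>r E. bounded E \<Longrightarrow> r > 0 \<Longrightarrow> N' r E \<le> c * N r E"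
  shows "assouad_exponents N E \<subseteq> assouad_exponents N' E"
proof
  fix u assume "u \<in> assouad_exponents N E"
  then obtain C where C: "C > 0" "\<And>r R x. 0 < r \<Longrightarrow> r < R \<Longrightarrow> x \<in> E \<Longrightarrow>
      real (N r (ball x R \<inter> E)) \<le> C * (R / r) powr u"
    unfolding assouad_exponents_def by blast
  \<comment> \<open>The factor c + 1 rather than c keeps the new constant positive even when c =
    0.\<close>
  have "real (N' r (ball x R \<inter> E)) \<le> (real (c + 1) * C) * (R / r) powr u"
    if "0 < r" "r < R" "x \<in> E" for r R x
  proof -
    have "real (N' r (ball x R \<inter> E)) \<le> real (c * N r (ball x R \<inter> E))"
      using assms[of "ball x R \<inter> E" r] that(1) by (simp add: bounded_Int flip: of_nat_mult)
    also have "\<dots> \<le> real (c + 1) * real (N r (ball x R \<inter> E))" by (simp add: mult_right_mono)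
    also have "\<dots> \<le> real (c + 1) * (C * (R / r) powr u)"
      by (intro mult_left_mono C(2) that) auto
    finally show ?thesis by (simp add: mult.assoc)
  qed
  moreover have "real (c + 1) * C > 0" using C(1) by simp
  ultimately show "u \<in> assouad_exponents N' E" unfolding assouad_exponents_def by blast
qed

lemma assouad_dim_eq:
  "assouad_dim E = Inf (assouad_exponents grid_count E)"
  "assouad_dim E' = Inf (assouad_exponents plane_grid_count E')"
proof -
  have "assouad_exponents covering_number E = assouad_exponents grid_count E"
    using covering_number_grid_count by (intro antisym assouad_exponents_mono)
  then show "assouad_dim E = Inf (assouad_exponents grid_count E)"
    by (simp add: assouad_dim_def assouad_exponents_def)
  have "assouad_exponents covering_number E' = assouad_exponents plane_grid_count E'"
    using covering_number_plane_grid_count by (intro antisym assouad_exponents_mono)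
  then show "assouad_dim E' = Inf (assouad_exponents plane_grid_count E')"
    by (simp add: assouad_dim_def assouad_exponents_def)
qed

text \<open>If u were positive, the right-hand side would tend to 0. Estimates along a geometric
  sequence of scales become inequalities between exponents through this lemma.\<close>

lemma powr_lower_bound_imp_nonpos:
  assumes "\<And>n::nat. c \<le> C * (q ^ n) powr u" "c > 0" "0 < q" "q < (1::real)"
  shows "u \<le> 0"
proof (rule ccontr)
  assume "\<not> u \<le> 0"
  then have u: "u > 0" by simp
  have p: "(q ^ n) powr u = (q powr u) ^ n" for n
    using assms by (simp add: powr_powr mult.commute flip: powr_realpow)
  have "(\<lambda>n. C * (q powr u) ^ n) \<longlonglongrightarrow> C * 0"
    using assms u powr_less_mono2[of u q 1]
    by (intro tendsto_mult tendsto_const LIMSEQ_power_zero) auto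
  then have "c \<le> C * 0"
    using assms(1) p by (intro LIMSEQ_le_const) auto
  then show False using assms(2) by simp
qed

text \<open>With R = 2 and r = 2^(-n) the ratio R / r is unbounded while the count stays at least 1.
  This bounds the exponent sets below, so that their infima are meaningful.\<close>

lemma assouad_exponents_nonneg:
  assumes "u \<in> assouad_exponents N E" "x \<in> E"
    and "\<And>r E. bounded E \<Longrightarrow> r > 0 \<Longrightarrow> E \<noteq> {} \<Longrightarrow> N r E \<ge> 1"
  shows "u \<ge> 0"
proof -
  obtain C where C: "C > 0" "\<And>r R x. 0 < r \<Longrightarrow> r < R \<Longrightarrow> x \<in> E \<Longrightarrow>
      real (N r (ball x R \<inter> E)) \<le> C * (R / r) powr u"
    using assms(1) unfolding assouad_exponents_def by blast
  have "1 \<le> (C * 2 powr u) * ((1 / 2) ^ n) powr (- u)" for n :: nat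
  proof -
    have "1 \<le> real (N ((1 / 2) ^ n) (ball x 2 \<inter> E))"
      using assms(3)[of "ball x 2 \<inter> E" "(1 / 2) ^ n"] assms(2) by (force simp: bounded_Int)
    also have "\<dots> \<le> C * (2 / (1 / 2) ^ n) powr u"
      using le_less_trans[OF power_le_one[of "1 / 2 :: real" n]] by (intro C(2) assms(2)) auto
    also have "\<dots> = (C * 2 powr u) * ((1 / 2) ^ n) powr (- u)"
      by (simp add: powr_divide powr_minus powr_mult field_simps)
    finally show ?thesis .
  qed
  then show ?thesis using powr_lower_bound_imp_nonpos[of 1 "C * 2 powr u" "1 / 2" "- u"] by simp
qed

text \<open>Only radii up to D need checking, since a larger ball about a point of E contains all of
  E. Enlarging R must not decrease the bound, so u has to be nonnegative; this is derived from the
  hypothesis at R = D with r tending to 0.\<close>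

lemma assouad_exponentsI:
  fixes E :: "'a::metric_space set"
  assumes E: "bounded E" "E \<noteq> {}" "\<And>x. x \<in> E \<Longrightarrow> E \<subseteq> ball x D" and D: "D > 0"
    and ge: "\<And>r E. bounded E \<Longrightarrow> r > 0 \<Longrightarrow> E \<noteq> {} \<Longrightarrow> N r E \<ge> 1"
    and anti: "\<And>r q E. bounded E \<Longrightarrow> 0 < r \<Longrightarrow> r \<le> q \<Longrightarrow> N q E \<le> c * N r E"
    and C: "C > 0" "\<And>r R x. 0 < r \<Longrightarrow> r < R \<Longrightarrow> R \<le> D \<Longrightarrow> x \<in> E \<Longrightarrow>
      real (N r (ball x R \<inter> E)) \<le> C * (R / r) powr u"
  shows "u \<in> assouad_exponents N E"
proof -
  obtain x0 where x0: "x0 \<in> E" using E(2) by blast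
  have whole: "ball x R \<inter> E = E" if "x \<in> E" "R \<ge> D" for x R
    using E(3)[OF that(1)] that(2) by auto
  have "1 \<le> (C * 2 powr u) * ((1 / 2) ^ n) powr (- u)" for n :: nat
  proof -
    have r: "0 < D * (1 / 2) ^ n / 2" "D * (1 / 2) ^ n / 2 < D"
      using D le_less_trans[OF power_le_one[of "1 / 2 :: real" n], of 2] by auto
    have "1 \<le> real (N (D * (1 / 2) ^ n / 2) (ball x0 D \<inter> E))"
      using ge[OF E(1) r(1) E(2)] whole[OF x0] by simp
    also have "\<dots> \<le> C * (D / (D * (1 / 2) ^ n / 2)) powr u"
      by (intro C(2) r x0) auto
    also have "D / (D * (1 / 2) ^ n / 2) = 2 / (1 / 2) ^ n" using D by simp
    also have "C * (2 / (1 / 2) ^ n) powr u = (C * 2 powr u) * ((1 / 2) ^ n) powr (- u)"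
      by (simp add: powr_divide powr_minus powr_mult field_simps)
    finally show ?thesis .
  qed
  then have u: "u \<ge> 0" using powr_lower_bound_imp_nonpos[of 1 "C * 2 powr u" "1 / 2" "- u"] by simp
  \<comment> \<open>The constant also absorbs the case r \<ge> D: there the count is at most c times
    the count at D / 2, and the radii D and D / 2 have ratio 2.\<close>
  let ?M = "real (c + 1) * C * 2 powr u"
  have CM: "C \<le> ?M"
  proof -
    have "1 * 1 \<le> real (c + 1) * 2 powr u" using u ge_one_powr_ge_zero[of 2 u] by (intro mult_mono) auto
    then show ?thesis using C(1) by simp
  qed
  have "real (N r (ball x R \<inter> E)) \<le> ?M * (R / r) powr u" if r: "0 < r" "r < R" and x: "x \<in> E" for r R x
  proof (cases "R \<le> D")
    case True
    then show ?thesis using C(2)[OF r True x] CM mult_right_mono[OF CM, of "(R / r) powr u"] by simp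
  next
    case R: False
    show ?thesis
    proof (cases "r < D")
      case True
      have "real (N r (ball x R \<inter> E)) = real (N r (ball x D \<inter> E))" using whole[OF x] R by simp
      also have "\<dots> \<le> C * (D / r) powr u" using C(2)[OF r(1) True _ x] by simp
      also have "\<dots> \<le> ?M * (R / r) powr u"
        using CM C(1) R r D u by (intro mult_mono powr_mono2) (auto simp: divide_right_mono)
      finally show ?thesis .
    next
      case False
      have "real (N r (ball x R \<inter> E)) = real (N r E)" using whole[OF x] R by simp
      also have "\<dots> \<le> real (c * N (D / 2) E)" using anti[OF E(1), of "D / 2" r] D False by (simp flip: of_nat_mult)
      also have "\<dots> \<le> real (c + 1) * real (N (D / 2) (ball x D \<inter> E))"
        using whole[OF x, of D] by (simp add: mult_right_mono)
      also have "\<dots> \<le> real (c + 1) * (C * (D / (D / 2)) powr u)"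
        using D by (intro mult_left_mono C(2) x) auto
      also have "\<dots> = ?M * 1" using D by simp
      also have "\<dots> \<le> ?M * (R / r) powr u"
        using r u C(1) by (intro mult_left_mono ge_one_powr_ge_zero) auto
      finally show ?thesis .
    qed
  qed
  moreover have "?M > 0" using C(1) by simp
  ultimately show ?thesis unfolding assouad_exponents_def by blast
qed

text \<open>The least suitable n works. The hypothesis x \<le> 1 gives the upper estimate when this
  n is 0.\<close>

lemma power_scale_exists:
  assumes "0 < x" "x \<le> 1" "0 < q" "q < (1::real)"
  obtains n :: nat where "q ^ n \<le> x" "x \<le> q ^ n / q"
proof -
  obtain n where n: "q ^ n < x" using real_arch_pow_inv assms by blast
  define k where "k = (LEAST n. q ^ n \<le> x)"
  have k: "q ^ k \<le> x" unfolding k_def by (rule LeastI[of _ n]) (use n in simp)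
  have "x \<le> q ^ k / q"
  proof (cases k)
    case 0
    then have "x \<le> 1 / 1" using assms by simp
    also have "\<dots> \<le> 1 / q" using assms by (intro divide_left_mono) auto
    finally show ?thesis using 0 by simp
  next
    case (Suc j)
    then have "\<not> q ^ j \<le> x" using not_less_Least[of j "\<lambda>n. q ^ n \<le> x"] k_def by simp
    then show ?thesis using Suc assms by simp
  qed
  then show thesis using that k by blast
qed

section \<open>Packing of disjoint boxes\<close>

lemma half_lattice_point:
  assumes "h > 0" "h \<le> y - (x::real)"
  obtains z :: int where "x < real_of_int z * (h / 2)" "real_of_int z * (h / 2) < y"
proof -
  define k where "k = h / 2"
  have k: "k > 0" "2 * k \<le> y - x" using assms by (auto simp: k_def)
  define z where "z = \<lfloor>x / k\<rfloor> + 1"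
  have z: "x / k < of_int z" "of_int z \<le> x / k + 1" unfolding z_def by linarith+
  have "x < of_int z * k" using z(1) k(1) by (simp add: pos_divide_less_eq)
  moreover have "of_int z * k \<le> (x / k + 1) * k" using z(2) k(1) by (intro mult_right_mono) auto
  then have "of_int z * k \<le> x + k" using k(1) by (simp add: distrib_right)
  ultimately show thesis using that[of z] k by (simp add: k_def)
qed

lemma interval_lattice_point:
  assumes "h > 0" "h \<le> p" "a \<le> x + real L * h" "x - real L * h \<le> a + p"
  shows "\<exists>z\<in>{- (2 * int L + 1)..2 * int L + 1}. a < x + real_of_int z * (h / 2) \<and>
    x + real_of_int z * (h / 2) < a + p"
proof -
  define K where "K = real L * h"
  have K: "K \<ge> 0" "a \<le> x + K" "x - K \<le> a + p" using assms by (auto simp: K_def)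
  \<comment> \<open>The open interval from a to a + p is cut down to the neighbourhood of x of
    radius K + h. The remaining length is still at least h, and the cut bounds the index of the
    lattice point.\<close>
  have "h \<le> min (a + p - x) (K + h) - max (a - x) (- K - h)"
    using assms(1,2) K by (auto simp: min_def max_def)
  then obtain z :: int where z: "max (a - x) (- K - h) < real_of_int z * (h / 2)"
      "real_of_int z * (h / 2) < min (a + p - x) (K + h)"
    using half_lattice_point[OF assms(1)] by blast
  then have "- K - h < real_of_int z * (h / 2)" "real_of_int z * (h / 2) < K + h" by linarith+
  then have "- (2 * real L + 2) * (h / 2) < real_of_int z * (h / 2)"
      "real_of_int z * (h / 2) < (2 * real L + 2) * (h / 2)"
    by (auto simp: K_def algebra_simps)
  then have "- (2 * real L + 2) < real_of_int z" "real_of_int z < 2 * real L + 2"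
    using assms(1) by (simp_all only: mult_less_cancel_right)
  then have "z \<in> {- (2 * int L + 1)..2 * int L + 1}" by auto
  moreover have "a < x + real_of_int z * (h / 2)" "x + real_of_int z * (h / 2) < a + p"
    using z by linarith+
  ultimately show ?thesis by blast
qed

text \<open>An area argument would fail, since the boxes may be far longer than the neighbourhood
  that they meet. Instead each box contains a point of a lattice of mesh h / 2 about (x, y) with
  both indices in {-(2L+1)..2L+1}, and disjointness makes the choice injective.\<close>

lemma card_disjoint_boxes_le:
  fixes a b :: "'w \<Rightarrow> real"
  assumes h: "h > 0" "h \<le> p" "h \<le> q"
    and disj: "\<And>v w. v \<in> A \<Longrightarrow> w \<in> A \<Longrightarrow> v \<noteq> w \<Longrightarrow>
      ({a v<..<a v + p} \<times> {b v<..<b v + q}) \<inter> ({a w<..<a w + p} \<times> {b w<..<b w + q}) = {}"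
    and meet: "\<And>w. w \<in> A \<Longrightarrow> a w \<le> x + real L * h \<and> x - real L * h \<le> a w + p \<and>
      b w \<le> y + real L * h \<and> y - real L * h \<le> b w + q"
  shows "finite A \<and> card A \<le> (4 * L + 3)\<^sup>2"
proof -
  let ?Z = "{- (2 * int L + 1)..2 * int L + 1}"
  have "\<exists>z. z \<in> ?Z \<times> ?Z \<and> x + real_of_int (fst z) * (h / 2) \<in> {a w<..<a w + p} \<and>
      y + real_of_int (snd z) * (h / 2) \<in> {b w<..<b w + q}" if "w \<in> A" for w
    using interval_lattice_point[OF h(1,2), of "a w" x L] interval_lattice_point[OF h(1,3), of "b w" y L]
      meet[OF that] by fastforce
  then obtain f where f: "\<And>w. w \<in> A \<Longrightarrow> f w \<in> ?Z \<times> ?Z \<and>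
      x + real_of_int (fst (f w)) * (h / 2) \<in> {a w<..<a w + p} \<and>
      y + real_of_int (snd (f w)) * (h / 2) \<in> {b w<..<b w + q}"
    by metis
  have inj: "inj_on f A"
  proof (rule inj_onI, rule ccontr)
    fix v w assume vw: "v \<in> A" "w \<in> A" "f v = f w" "v \<noteq> w"
    then have "(x + real_of_int (fst (f w)) * (h / 2), y + real_of_int (snd (f w)) * (h / 2)) \<in>
      ({a v<..<a v + p} \<times> {b v<..<b v + q}) \<inter> ({a w<..<a w + p} \<times> {b w<..<b w + q})"
      using f[of v] f[of w] by simp
    then show False using disj[OF vw(1,2,4)] by blast
  qed
  have sub: "f ` A \<subseteq> ?Z \<times> ?Z" using f by blast
  have "card A = card (f ` A)" using inj by (simp add: card_image)
  also have "\<dots> \<le> card (?Z \<times> ?Z)" by (rule card_mono[OF _ sub]) simp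
  also have "\<dots> = (4 * L + 3)\<^sup>2"
  proof -
    have "card ?Z = 4 * L + 3" unfolding card_atLeastAtMost_int by linarith
    then show ?thesis by (simp only: card_cartesian_product power2_eq_square)
  qed
  finally show ?thesis using inj sub finite_subset[OF sub] by (simp add: finite_image_iff)
qed

section \<open>Words, offsets and the projected measure\<close>

lemma word_map_Nil [simp]: "word_map S [] = id"
  and word_map_Cons [simp]: "word_map S (i # w) = S i \<circ> word_map S w"
  by (simp_all add: word_map_def)

lemma word_map_append: "word_map S (v @ w) = word_map S v \<circ> word_map S w"
  by (induction v) auto

locale self_affine_carpet =
  fixes I :: "'i set" and t :: "'i \<Rightarrow> real \<times> real" and \<alpha> \<beta> :: real and F :: "(real \<times> real) set"
  assumes finite_I: "finite I"
    and \<alpha>_pos: "0 < \<alpha>" and \<alpha>_less_\<beta>: "\<alpha> < \<beta>" and \<beta>_less_1: "\<beta> < 1"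
    and t_in: "\<And>i. i \<in> I \<Longrightarrow> t i \<in> {0..1 - \<beta>} \<times> {0..1 - \<alpha>}"
    and disjoint: "disjoint_family_on (\<lambda>i. interior (ifs_map \<alpha> \<beta> t i ` unit_square)) I"
    and attractor: "is_attractor I (ifs_map \<alpha> \<beta> t) F"
begin

abbreviation S :: "'i \<Rightarrow> real \<times> real \<Rightarrow> real \<times> real" where "S \<equiv> ifs_map \<alpha> \<beta> t"

abbreviation proj_F :: "real set" where "proj_F \<equiv> fst ` F"

definition words :: "nat \<Rightarrow> 'i list set" where "words n = {w. set w \<subseteq> I \<and> length w = n}"

text \<open>With \<open>yoff\<close>, the lower left corner of the rectangle of the cylinder
  \<open>w\<close>. Corner and length determine the map.\<close>

definition xoff :: "'i list \<Rightarrow> real" where "xoff w = fst (word_map S w (0, 0))"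

definition yoff :: "'i list \<Rightarrow> real" where "yoff w = snd (word_map S w (0, 0))"

lemma \<beta>_pos: "0 < \<beta>" and \<alpha>_less_1: "\<alpha> < 1"
  using \<alpha>_pos \<alpha>_less_\<beta> \<beta>_less_1 by auto

lemma \<alpha>_power_le_\<beta>_power: "\<alpha> ^ n \<le> \<beta> ^ n"
  using \<alpha>_pos \<alpha>_less_\<beta> by (intro power_mono) auto

lemma S_eq: "S i p = (\<beta> * fst p + fst (t i), \<alpha> * snd p + snd (t i))"
  by (simp add: ifs_map_def case_prod_beta prod_eq_iff)

lemma off_Nil [simp]: "xoff [] = 0" "yoff [] = 0"
  by (simp_all add: xoff_def yoff_def)

lemma off_Cons [simp]:
  "xoff (i # w) = \<beta> * xoff w + fst (t i)" "yoff (i # w) = \<alpha> * yoff w + snd (t i)"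
  by (simp_all add: xoff_def yoff_def S_eq)

lemma word_map_eq:
  "word_map S w p = (\<beta> ^ length w * fst p + xoff w, \<alpha> ^ length w * snd p + yoff w)"
  by (induction w) (simp_all add: S_eq algebra_simps)

lemma off_append:
  "xoff (v @ w) = \<beta> ^ length v * xoff w + xoff v" "yoff (v @ w) = \<alpha> ^ length v * yoff w + yoff v"
  by (induction v) (simp_all add: algebra_simps)

lemma t_bounds:
  assumes "i \<in> I"
  shows "0 \<le> fst (t i)" "fst (t i) \<le> 1 - \<beta>" "0 \<le> snd (t i)" "snd (t i) \<le> 1 - \<alpha>"
  using t_in[OF assms] by (auto simp: mem_Times_iff)

lemma off_bounds:
  assumes "set w \<subseteq> I"
  shows "0 \<le> xoff w \<and> xoff w + \<beta> ^ length w \<le> 1 \<and> 0 \<le> yoff w \<and> yoff w + \<alpha> ^ length w \<le> 1"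
  using assms
proof (induction w)
  case (Cons i w)
  then have w: "0 \<le> xoff w" "xoff w + \<beta> ^ length w \<le> 1" "0 \<le> yoff w" "yoff w + \<alpha> ^ length w \<le> 1"
    and i: "i \<in> I" by auto
  have "\<beta> * (xoff w + \<beta> ^ length w) \<le> \<beta> * 1" "\<alpha> * (yoff w + \<alpha> ^ length w) \<le> \<alpha> * 1"
    using w \<alpha>_pos \<beta>_pos by (auto intro: mult_left_mono)
  then show ?case using w t_bounds[OF i] \<alpha>_pos \<beta>_pos by (auto simp: distrib_left)
qed simp

lemma finite_words [simp]: "finite (words n)"
  using finite_lists_length_eq[OF finite_I] by (simp add: words_def)

lemma card_words: "card (words n) = card I ^ n"
  using card_lists_length_eq[OF finite_I] by (simp add: words_def)

lemma words_append: "v \<in> words n \<Longrightarrow> w \<in> words k \<Longrightarrow> v @ w \<in> words (n + k)"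
  by (auto simp: words_def)

lemma words_length: "w \<in> words n \<Longrightarrow> length w = n"
  by (simp add: words_def)

lemma F_nonempty: "F \<noteq> {}" and F_compact: "compact F" and F_eq: "F = (\<Union>i\<in>I. S i ` F)"
  using attractor by (auto simp: is_attractor_def)

lemma I_nonempty: "I \<noteq> {}"
  using F_nonempty F_eq by auto

lemma words_nonempty: "words n \<noteq> {}"
proof -
  obtain i where "i \<in> I" using I_nonempty by blast
  then have "replicate n i \<in> words n" by (auto simp: words_def)
  then show ?thesis by blast
qed

lemma word_map_F:
  assumes "w \<in> words n" "p \<in> F"
  shows "word_map S w p \<in> F"
proof -
  have "set w \<subseteq> I \<Longrightarrow> word_map S w p \<in> F"
  proof (induction w)
    case (Cons i w)
    then show ?case using F_eq by auto
  qed (use assms in simp)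
  then show ?thesis using assms by (simp add: words_def)
qed

lemma F_covered:
  assumes "p \<in> F"
  obtains w q where "w \<in> words n" "q \<in> F" "p = word_map S w q"
proof -
  have "\<exists>w\<in>words n. \<exists>q\<in>F. p = word_map S w q"
    using assms
  proof (induction n arbitrary: p)
    case 0
    then show ?case by (auto simp: words_def)
  next
    case (Suc n)
    obtain i p' where i: "i \<in> I" "p' \<in> F" "p = S i p'" using Suc.prems F_eq by blast
    obtain w q where w: "w \<in> words n" "q \<in> F" "p' = word_map S w q" using Suc.IH[OF i(2)] by blast
    then show ?case using i by (intro bexI[of _ "i # w"] bexI[of _ q]) (auto simp: words_def)
  qed
  then show thesis using that by blast
qed

text \<open>An attractor is only a compact invariant set, so this needs proof: a point of F is an
  image under a word of any length n, and the image of the bounded set F lies within a multiple of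
  \<beta>^n, respectively \<alpha>^n, of the unit square in each coordinate.\<close>

lemma F_in_unit_square:
  assumes "p \<in> F"
  shows "0 \<le> fst p \<and> fst p \<le> 1 \<and> 0 \<le> snd p \<and> snd p \<le> 1"
proof -
  obtain B where B: "\<And>q. q \<in> F \<Longrightarrow> norm q \<le> B"
    using compact_imp_bounded[OF F_compact] bounded_iff by blast
  have *: "fst p \<ge> - (B * \<beta> ^ n) \<and> fst p \<le> 1 + B * \<beta> ^ n \<and>
      snd p \<ge> - (B * \<alpha> ^ n) \<and> snd p \<le> 1 + B * \<alpha> ^ n" for n
  proof -
    obtain w q where w: "w \<in> words n" "q \<in> F" "p = word_map S w q" using F_covered[OF assms] by blast
    have "\<bar>fst q\<bar> \<le> B" "\<bar>snd q\<bar> \<le> B"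
      using B[OF w(2)] dist_fst_le[of q 0] dist_snd_le[of q 0] by (simp_all add: dist_norm)
    then have "\<bar>\<beta> ^ n * fst q\<bar> \<le> B * \<beta> ^ n" "\<bar>\<alpha> ^ n * snd q\<bar> \<le> B * \<alpha> ^ n"
      using \<alpha>_pos \<beta>_pos by (auto simp: abs_mult mult.commute intro: mult_left_mono)
    moreover have "\<beta> ^ n > 0" "\<alpha> ^ n > 0" using \<alpha>_pos \<beta>_pos by auto
    ultimately show ?thesis using off_bounds[of w] w
      by (simp add: word_map_eq words_def) linarith
  qed
  have lim: "(\<lambda>n. B * \<beta> ^ n) \<longlonglongrightarrow> 0" "(\<lambda>n. B * \<alpha> ^ n) \<longlonglongrightarrow> 0"
    using \<alpha>_pos \<beta>_pos \<alpha>_less_1 \<beta>_less_1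
    by (intro tendsto_mult_right_zero LIMSEQ_power_zero; simp)+
  have limit: "c \<le> d" if "\<And>n. c \<le> d + e n" "e \<longlonglongrightarrow> 0" for c d :: real and e
    using LIMSEQ_le_const[OF tendsto_add[OF tendsto_const that(2)], of c d] that(1) by auto
  have "0 \<le> fst p" by (rule limit[OF _ lim(1)]) (use *[of n for n] in \<open>smt (verit)\<close>)
  moreover have "fst p \<le> 1" by (rule limit[OF _ lim(1)]) (use * in blast)
  moreover have "0 \<le> snd p" by (rule limit[OF _ lim(2)]) (use *[of n for n] in \<open>smt (verit)\<close>)
  moreover have "snd p \<le> 1" by (rule limit[OF _ lim(2)]) (use * in blast)
  ultimately show ?thesis by simp
qed

lemma proj_F_in_unit: "x \<in> proj_F \<Longrightarrow> 0 \<le> x \<and> x \<le> 1"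
  using F_in_unit_square by auto

lemma bounded_F: "bounded F"
  by (rule compact_imp_bounded[OF F_compact])

lemma bounded_proj_F: "bounded proj_F"
  by (rule bounded_subset[OF bounded_closed_interval[of 0 1]]) (use F_in_unit_square in auto)

lemma proj_F_nonempty: "proj_F \<noteq> {}"
  using F_nonempty by simp

section \<open>Disjointness of cylinders of one level\<close>

definition open_box :: "'i list \<Rightarrow> (real \<times> real) set" where
  "open_box w = {xoff w<..<xoff w + \<beta> ^ length w} \<times> {yoff w<..<yoff w + \<alpha> ^ length w}"

lemma open_box_Cons:
  assumes "z \<in> open_box (i # w)"
  shows "((fst z - fst (t i)) / \<beta>, (snd z - snd (t i)) / \<alpha>) \<in> open_box w"
  using assms \<alpha>_pos \<beta>_pos
  by (auto simp: open_box_def mem_Times_iff field_simps)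

lemma open_box_subset_interior:
  assumes "set w \<subseteq> I" "i \<in> I"
  shows "open_box (i # w) \<subseteq> interior (S i ` unit_square)"
proof (rule interior_maximal)
  show "open (open_box (i # w))" unfolding open_box_def by (intro open_Times) auto
  show "open_box (i # w) \<subseteq> S i ` unit_square"
  proof
    fix z assume "z \<in> open_box (i # w)"
    from open_box_Cons[OF this] have "((fst z - fst (t i)) / \<beta>, (snd z - snd (t i)) / \<alpha>) \<in> unit_square"
      using off_bounds[OF assms(1)] by (auto simp: open_box_def unit_square_def)
    moreover have "z = S i ((fst z - fst (t i)) / \<beta>, (snd z - snd (t i)) / \<alpha>)"
      using \<alpha>_pos \<beta>_pos by (simp add: S_eq)
    ultimately show "z \<in> S i ` unit_square" by blast
  qed
qed

text \<open>Different first letters are separated by the open set condition. Equal first letters are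
  undone by the inverse map, which leaves two distinct words of smaller length.\<close>

lemma open_box_disjoint:
  assumes "v \<in> words n" "w \<in> words n" "v \<noteq> w"
  shows "open_box v \<inter> open_box w = {}"
  using assms
proof (induction n arbitrary: v w)
  case 0
  then show ?case by (simp add: words_def)
next
  case (Suc n)
  obtain i v' where v: "v = i # v'" "i \<in> I" "v' \<in> words n"
    using Suc.prems(1) by (cases v) (auto simp: words_def)
  obtain j w' where w: "w = j # w'" "j \<in> I" "w' \<in> words n"
    using Suc.prems(2) by (cases w) (auto simp: words_def)
  show ?case
  proof (cases "i = j")
    case True
    then have "open_box v' \<inter> open_box w' = {}" using Suc v w by simp
    then show ?thesis using open_box_Cons[of _ i v'] open_box_Cons[of _ i w'] v w True by blast
  next
    case False
    then have "interior (S i ` unit_square) \<inter> interior (S j ` unit_square) = {}"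
      using disjoint v w unfolding disjoint_family_on_def by simp
    moreover have "open_box v \<subseteq> interior (S i ` unit_square)" "open_box w \<subseteq> interior (S j ` unit_square)"
      using open_box_subset_interior v w by (auto simp: words_def)
    ultimately show ?thesis by blast
  qed
qed

text \<open>The packing bound is applied with h the shorter side \<alpha>^n. The long sides
  \<beta>^n do not matter, so the bound depends on L alone.\<close>

lemma card_words_near_point:
  assumes "A \<subseteq> words n"
    and "\<And>w. w \<in> A \<Longrightarrow> xoff w \<le> x + real L * \<alpha> ^ n \<and> x - real L * \<alpha> ^ n \<le> xoff w + \<beta> ^ n \<and>
      yoff w \<le> y + real L * \<alpha> ^ n \<and> y - real L * \<alpha> ^ n \<le> yoff w + \<alpha> ^ n"
  shows "card A \<le> (4 * L + 3)\<^sup>2"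
proof -
  have "finite A \<and> card A \<le> (4 * L + 3)\<^sup>2"
  proof (rule card_disjoint_boxes_le[where p = "\<beta> ^ n" and q = "\<alpha> ^ n" and h = "\<alpha> ^ n"])
    fix v w assume "v \<in> A" "w \<in> A" "v \<noteq> w"
    then show "({xoff v<..<xoff v + \<beta> ^ n} \<times> {yoff v<..<yoff v + \<alpha> ^ n}) \<inter>
        ({xoff w<..<xoff w + \<beta> ^ n} \<times> {yoff w<..<yoff w + \<alpha> ^ n}) = {}"
      using open_box_disjoint[of v n w] assms(1) words_length[of v n] words_length[of w n]
      unfolding open_box_def by auto
  qed (use assms(2) \<alpha>_pos \<alpha>_power_le_\<beta>_power in auto)
  then show ?thesis by blast
qed

section \<open>The coding map, the Bernoulli measure and its projection\<close>

definition prefix_word :: "(nat \<Rightarrow> 'i) \<Rightarrow> nat \<Rightarrow> 'i list" where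
  "prefix_word \<omega> n = map \<omega> [0..<n]"

lemma prefix_word_Suc: "prefix_word \<omega> (Suc n) = prefix_word \<omega> n @ [\<omega> n]"
  by (simp add: prefix_word_def)

lemma prefix_word_in_words: "(\<And>k. \<omega> k \<in> I) \<Longrightarrow> prefix_word \<omega> n \<in> words n"
  by (auto simp: prefix_word_def words_def)

lemma off_prefix_word_Suc:
  "xoff (prefix_word \<omega> (Suc n)) = xoff (prefix_word \<omega> n) + \<beta> ^ n * fst (t (\<omega> n))"
  "yoff (prefix_word \<omega> (Suc n)) = yoff (prefix_word \<omega> n) + \<alpha> ^ n * snd (t (\<omega> n))"
  by (simp_all add: prefix_word_Suc off_append) (simp_all add: prefix_word_def)

lemma coding_map_eq:
  "coding_map S \<omega> = lim (\<lambda>n. (xoff (prefix_word \<omega> n), yoff (prefix_word \<omega> n)))"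
  by (simp add: coding_map_def prefix_word_def xoff_def yoff_def)

text \<open>Along the prefixes of \<omega> the left ends of the projected intervals increase and the
  right ends decrease, so the limit of the left ends lies in all of these intervals.\<close>

lemma fst_coding_map_in_interval:
  assumes \<omega>: "\<And>k. \<omega> k \<in> I"
  shows "fst (coding_map S \<omega>) \<in> {xoff (prefix_word \<omega> n)..xoff (prefix_word \<omega> n) + \<beta> ^ n}"
proof -
  let ?X = "\<lambda>n. xoff (prefix_word \<omega> n)" and ?Y = "\<lambda>n. yoff (prefix_word \<omega> n)"
  have inc: "incseq ?X" "incseq ?Y"
    using \<alpha>_pos \<beta>_pos t_bounds[OF \<omega>] by (auto intro!: incseq_SucI simp: off_prefix_word_Suc)
  have bd: "0 \<le> ?X n \<and> ?X n + \<beta> ^ n \<le> 1 \<and> 0 \<le> ?Y n \<and> ?Y n + \<alpha> ^ n \<le> 1" for n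
    using off_bounds[of "prefix_word \<omega> n"] prefix_word_in_words[of \<omega> n, OF \<omega>] by (simp add: words_def)
  have "?X n \<le> 1" "?Y n \<le> 1" for n
    using bd[of n] \<alpha>_pos \<beta>_pos zero_less_power[of \<alpha> n] zero_less_power[of \<beta> n] by linarith+
  then have bd1: "\<forall>n. ?X n \<le> 1" "\<forall>n. ?Y n \<le> 1" by simp_all
  obtain x where x: "?X \<longlonglongrightarrow> x" "\<forall>n. ?X n \<le> x"
    by (rule incseq_convergent[OF inc(1) bd1(1)])
  \<comment> \<open>Convergence of the second coordinate is required because the \<open>lim\<close>
    in the coding map is that of the pair.\<close>
  obtain y where y: "?Y \<longlonglongrightarrow> y"
    by (rule incseq_convergent[OF inc(2) bd1(2)])
  have "fst (coding_map S \<omega>) = x"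
    unfolding coding_map_eq using limI[OF tendsto_Pair[OF x(1) y]] by simp
  have dec: "?X (Suc n) + \<beta> ^ Suc n \<le> ?X n + \<beta> ^ n" for n
    using mult_left_mono[OF t_bounds(2)[OF \<omega>[of n]], of "\<beta> ^ n"] \<beta>_pos
    by (simp add: off_prefix_word_Suc algebra_simps)
  have "x \<le> ?X n + \<beta> ^ n"
  proof (rule LIMSEQ_le_const2[OF x(1)], intro exI allI impI)
    fix k assume "n \<le> k"
    then have "?X k + \<beta> ^ k \<le> ?X n + \<beta> ^ n"
      using lift_Suc_antimono_le[of "\<lambda>n. ?X n + \<beta> ^ n" n k] dec by blast
    then show "?X k \<le> ?X n + \<beta> ^ n" using zero_less_power[OF \<beta>_pos, of k] by linarith
  qed
  then show ?thesis using x(2) \<open>fst (coding_map S \<omega>) = x\<close> by simp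
qed

abbreviation coding_measure :: "(nat \<Rightarrow> 'i) measure" where
  "coding_measure \<equiv> uniform_bernoulli I"

sublocale bernoulli: product_prob_space "\<lambda>_. uniform_count_measure I" "UNIV :: nat set"
  by (rule product_prob_spaceI) (rule prob_space_uniform_count_measure[OF finite_I I_nonempty])

lemma space_coding: "\<omega> \<in> space coding_measure \<longleftrightarrow> (\<forall>k. \<omega> k \<in> I)"
  by (auto simp: uniform_bernoulli_def space_PiM space_uniform_count_measure PiE_iff)

text \<open>Every function of a single letter is measurable, the letters forming a finite discrete
  space. The corners of the prefixes are finite sums of such functions, and the coding map is their
  limit.\<close>

lemma measurable_coding_map: "coding_map S \<in> borel_measurable coding_measure"
proof -
  have m: "(\<lambda>\<omega>. f (\<omega> k)) \<in> borel_measurable coding_measure" for f :: "'i \<Rightarrow> real" and k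
    unfolding uniform_bernoulli_def
    by (rule measurable_compose[OF measurable_component_singleton])
      (auto simp: uniform_count_measure_def measurable_point_measure_eq1)
  have "(\<lambda>\<omega>. xoff (prefix_word \<omega> n)) \<in> borel_measurable coding_measure \<and>
      (\<lambda>\<omega>. yoff (prefix_word \<omega> n)) \<in> borel_measurable coding_measure" for n
  proof (induction n)
    case 0
    then show ?case by (simp add: prefix_word_def)
  next
    case (Suc n)
    then show ?case unfolding off_prefix_word_Suc
      by (intro conjI borel_measurable_add borel_measurable_times borel_measurable_const m) auto
  qed
  then have "(\<lambda>\<omega>. (xoff (prefix_word \<omega> n), yoff (prefix_word \<omega> n))) \<in> borel_measurable coding_measure" for n
    by (intro borel_measurable_Pair) auto
  then have "(\<lambda>\<omega>. lim (\<lambda>n. (xoff (prefix_word \<omega> n), yoff (prefix_word \<omega> n)))) \<in> borel_measurable coding_measure"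
    by (rule borel_measurable_lim_metric)
  then show ?thesis by (simp add: coding_map_eq[abs_def])
qed

lemma finite_measure_coding: "finite_measure coding_measure"
  unfolding uniform_bernoulli_def by (rule bernoulli.P.finite_measure_axioms)

lemma measure_cylinder:
  assumes "w \<in> words n"
  shows "{\<omega> \<in> space coding_measure. prefix_word \<omega> n = w} \<in> sets coding_measure"
    and "measure coding_measure {\<omega> \<in> space coding_measure. prefix_word \<omega> n = w} = 1 / real (card I) ^ n"
proof -
  have w: "\<And>k. k < n \<Longrightarrow> w ! k \<in> I" "length w = n" using assms by (auto simp: words_def subset_iff)
  let ?E = "prod_emb UNIV (\<lambda>_. uniform_count_measure I) {..<n} (\<Pi>\<^sub>E k\<in>{..<n}. {w ! k})"
  have eq: "{\<omega> \<in> space coding_measure. prefix_word \<omega> n = w} = ?E"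
    using w(2) by (auto simp: space_coding prod_emb_def PiE_iff extensional_def prefix_word_def
        list_eq_iff_nth_eq space_uniform_count_measure)
  have s: "\<And>k. k \<in> {..<n} \<Longrightarrow> {w ! k} \<in> sets (uniform_count_measure I)"
    using w(1) by (auto simp: sets_uniform_count_measure)
  show "{\<omega> \<in> space coding_measure. prefix_word \<omega> n = w} \<in> sets coding_measure"
    unfolding eq unfolding uniform_bernoulli_def by (rule sets_PiM_I) (use s in auto)
  have "measure (Pi\<^sub>M UNIV (\<lambda>_. uniform_count_measure I)) ?E = (\<Prod>k<n. measure (uniform_count_measure I) {w ! k})"
    by (rule bernoulli.measure_PiM_emb) (use s in auto)
  also have "\<dots> = (\<Prod>k<n. 1 / real (card I))"
    by (intro prod.cong) (use w(1) finite_I in \<open>auto simp: measure_uniform_count_measure\<close>)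
  finally show "measure coding_measure {\<omega> \<in> space coding_measure. prefix_word \<omega> n = w} = 1 / real (card I) ^ n"
    unfolding eq by (simp add: uniform_bernoulli_def power_one_over)
qed

lemma measure_cylinders:
  assumes "V \<subseteq> words n"
  shows "{\<omega> \<in> space coding_measure. prefix_word \<omega> n \<in> V} \<in> sets coding_measure"
    and "measure coding_measure {\<omega> \<in> space coding_measure. prefix_word \<omega> n \<in> V} = real (card V) / real (card I) ^ n"
proof -
  let ?c = "\<lambda>w. {\<omega> \<in> space coding_measure. prefix_word \<omega> n = w}"
  have eq: "{\<omega> \<in> space coding_measure. prefix_word \<omega> n \<in> V} = (\<Union>w\<in>V. ?c w)" by auto
  have fin: "finite V" using assms finite_subset finite_words by blast
  show "{\<omega> \<in> space coding_measure. prefix_word \<omega> n \<in> V} \<in> sets coding_measure"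
    unfolding eq using fin assms measure_cylinder(1) by (intro sets.finite_UN) auto
  have "measure coding_measure (\<Union>w\<in>V. ?c w) = (\<Sum>w\<in>V. measure coding_measure (?c w))"
    by (rule finite_measure.finite_measure_finite_Union[OF finite_measure_coding fin])
      (use measure_cylinder(1) assms in \<open>auto simp: disjoint_family_on_def\<close>)
  also have "\<dots> = (\<Sum>w\<in>V. 1 / real (card I) ^ n)"
    by (intro sum.cong) (use measure_cylinder(2) assms in auto)
  finally show "measure coding_measure {\<omega> \<in> space coding_measure. prefix_word \<omega> n \<in> V} = real (card V) / real (card I) ^ n"
    unfolding eq by simp
qed

definition proj_measure :: "real measure" where
  "proj_measure = distr (ifs_measure I S) borel fst"

lemma measure_proj_measure:
  assumes "J \<in> sets borel"
  shows "measure proj_measure J = measure coding_measure {\<omega> \<in> space coding_measure. fst (coding_map S \<omega>) \<in> J}"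
    and "{\<omega> \<in> space coding_measure. fst (coding_map S \<omega>) \<in> J} \<in> sets coding_measure"
proof -
  have f: "(\<lambda>\<omega>. fst (coding_map S \<omega>)) \<in> borel_measurable coding_measure"
    using measurable_compose[OF measurable_coding_map, of fst borel] by (simp add: borel_prod[symmetric])
  have "proj_measure = distr coding_measure borel (fst \<circ> coding_map S)"
    unfolding proj_measure_def ifs_measure_def
    by (rule distr_distr[OF _ measurable_coding_map]) (simp add: borel_prod[symmetric])
  then show "measure proj_measure J = measure coding_measure {\<omega> \<in> space coding_measure. fst (coding_map S \<omega>) \<in> J}"
    using measure_distr[OF f assms] by (simp add: comp_def vimage_def Int_def conj_commute)
  show "{\<omega> \<in> space coding_measure. fst (coding_map S \<omega>) \<in> J} \<in> sets coding_measure"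
    using measurable_sets[OF f assms] by (simp add: vimage_def Int_def conj_commute)
qed

text \<open>The coded point of \<omega> projects into the interval of each prefix of \<omega>, so
  each cylinder whose interval lies in J contributes its full mass m^(-n).\<close>

lemma proj_measure_ge:
  assumes "V \<subseteq> words n" "\<And>w. w \<in> V \<Longrightarrow> {xoff w..xoff w + \<beta> ^ n} \<subseteq> J" "J \<in> sets borel"
  shows "real (card V) / real (card I) ^ n \<le> measure proj_measure J"
proof -
  have "{\<omega> \<in> space coding_measure. prefix_word \<omega> n \<in> V} \<subseteq> {\<omega> \<in> space coding_measure. fst (coding_map S \<omega>) \<in> J}"
  proof safe
    fix \<omega> assume "\<omega> \<in> space coding_measure" "prefix_word \<omega> n \<in> V"
    then show "fst (coding_map S \<omega>) \<in> J"
      using assms(2)[of "prefix_word \<omega> n"] fst_coding_map_in_interval[of \<omega> n] unfolding space_coding by blast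
  qed
  then show ?thesis
    unfolding measure_proj_measure(1)[OF assms(3)] measure_cylinders(2)[OF assms(1), symmetric]
    by (rule finite_measure.finite_measure_mono[OF finite_measure_coding _ measure_proj_measure(2)[OF assms(3)]])
qed

lemma proj_measure_le:
  assumes "J \<in> sets borel" "V \<subseteq> words n"
    and "\<And>w. w \<in> words n \<Longrightarrow> {xoff w..xoff w + \<beta> ^ n} \<inter> J \<noteq> {} \<Longrightarrow> w \<in> V"
  shows "measure proj_measure J \<le> real (card V) / real (card I) ^ n"
proof -
  have "{\<omega> \<in> space coding_measure. fst (coding_map S \<omega>) \<in> J} \<subseteq> {\<omega> \<in> space coding_measure. prefix_word \<omega> n \<in> V}"
  proof safe
    fix \<omega> assume "\<omega> \<in> space coding_measure" "fst (coding_map S \<omega>) \<in> J"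
    then show "prefix_word \<omega> n \<in> V"
      using assms(3)[OF prefix_word_in_words] fst_coding_map_in_interval[of \<omega> n] unfolding space_coding by blast
  qed
  then show ?thesis
    unfolding measure_proj_measure(1)[OF assms(1)] measure_cylinders(2)[OF assms(2), symmetric]
    by (rule finite_measure.finite_measure_mono[OF finite_measure_coding _ measure_cylinders(1)[OF assms(2)]])
qed

end

section \<open>The upper bound\<close>

definition interval_exponents :: "real measure \<Rightarrow> real set" where
  "interval_exponents \<nu> =
    {t. \<exists>C>0. \<forall>J. is_interval J \<and> J \<subseteq> {0..1} \<and> 0 < measure lborel J \<longrightarrow>
      measure \<nu> J \<le> C * measure lborel J powr t}"

context self_affine_carpet
begin

lemma card_I_pos: "card I > 0"
  using finite_I I_nonempty by (simp add: card_gt_0_iff)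

text \<open>Turns the Hoelder bound into a count. Since \<beta>^n \<le> l, the intervals of the
  words counted lie in the interval three times as long with the same centre, and each word carries
  mass m^(-n).\<close>

lemma card_words_meeting_interval:
  assumes "\<tau> \<in> interval_exponents proj_measure" "\<tau> \<ge> 0"
  obtains C where "C > 0" "\<And>n c l. \<beta> ^ n \<le> l \<Longrightarrow>
    real (card {w \<in> words n. xoff w \<le> c + l \<and> c \<le> xoff w + \<beta> ^ n}) \<le> C * real (card I) ^ n * l powr \<tau>"
proof -
  obtain C where C: "C > 0" "\<And>J. is_interval J \<Longrightarrow> J \<subseteq> {0..1} \<Longrightarrow> 0 < measure lborel J \<Longrightarrow>
      measure proj_measure J \<le> C * measure lborel J powr \<tau>"
    using assms(1) unfolding interval_exponents_def by blast
  have "real (card {w \<in> words n. xoff w \<le> c + l \<and> c \<le> xoff w + \<beta> ^ n}) \<le>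
      (C * 3 powr \<tau>) * real (card I) ^ n * l powr \<tau>"
    if l: "\<beta> ^ n \<le> l" for n c l
  proof -
    let ?V = "{w \<in> words n. xoff w \<le> c + l \<and> c \<le> xoff w + \<beta> ^ n}"
    \<comment> \<open>The enlarged interval is clipped because the Hoelder bound concerns
      subintervals of the unit interval only. As \<tau> \<ge> 0, clipping only decreases the
      bound.\<close>
    let ?a = "max 0 (c - l)" and ?b = "min 1 (c + 2 * l)"
    have l0: "l > 0" using l zero_less_power[OF \<beta>_pos, of n] by linarith
    have sub: "{xoff w..xoff w + \<beta> ^ n} \<subseteq> {?a..?b}" if "w \<in> ?V" for w
      using that l off_bounds[of w] by (auto simp: words_def)
    show ?thesis
    proof (cases "?V = {}")
      case True
      show ?thesis unfolding True using C(1) by simp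
    next
      case False
      then obtain w where "w \<in> ?V" by blast
      then have ab: "?a < ?b" using sub[of w] zero_less_power[OF \<beta>_pos, of n] by auto
      have "real (card ?V) / real (card I) ^ n \<le> measure proj_measure {?a..?b}"
        by (rule proj_measure_ge) (use sub in auto)
      also have "\<dots> \<le> C * measure lborel {?a..?b} powr \<tau>"
        using ab by (intro C(2)) auto
      also have "measure lborel {?a..?b} = ?b - ?a" using ab by simp
      also have "C * (?b - ?a) powr \<tau> \<le> C * (3 * l) powr \<tau>"
        using C(1) ab assms(2) by (intro mult_left_mono powr_mono2) auto
      also have "\<dots> = C * 3 powr \<tau> * l powr \<tau>" using l0 by (simp add: powr_mult)
      finally show ?thesis using card_I_pos by (simp add: pos_divide_le_eq mult_ac)
    qed
  qed
  moreover have "C * 3 powr \<tau> > 0" using C(1) by simp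
  ultimately show thesis using that by blast
qed

lemma grid_count_interval_le:
  assumes "u \<in> assouad_exponents grid_count proj_F"
  obtains C where "C > 0" "\<And>\<delta> c \<rho>. 0 < \<delta> \<Longrightarrow> \<delta> \<le> \<rho> \<Longrightarrow>
    real (grid_count \<delta> (proj_F \<inter> {c..c + \<rho>})) \<le> C * (\<rho> / \<delta>) powr u"
proof -
  obtain C where C: "C > 0" "\<And>r R x. 0 < r \<Longrightarrow> r < R \<Longrightarrow> x \<in> proj_F \<Longrightarrow>
      real (grid_count r (ball x R \<inter> proj_F)) \<le> C * (R / r) powr u"
    using assms unfolding assouad_exponents_def by blast
  have "real (grid_count \<delta> (proj_F \<inter> {c..c + \<rho>})) \<le> (C * 2 powr u) * (\<rho> / \<delta>) powr u"
    if "0 < \<delta>" "\<delta> \<le> \<rho>" for \<delta> c \<rho>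
  proof (cases "proj_F \<inter> {c..c + \<rho>} = {}")
    case True
    then show ?thesis using C(1) by (simp add: grid_count_def)
  next
    case False
    then obtain x where x: "x \<in> proj_F" "x \<in> {c..c + \<rho>}" by blast
    have "real (grid_count \<delta> (proj_F \<inter> {c..c + \<rho>})) \<le> real (grid_count \<delta> (ball x (2 * \<rho>) \<inter> proj_F))"
      using that x by (intro of_nat_mono grid_count_mono) (auto simp: dist_real_def bounded_Int)
    also have "\<dots> \<le> C * (2 * \<rho> / \<delta>) powr u" using that x by (intro C(2)) auto
    also have "\<dots> = C * 2 powr u * (\<rho> / \<delta>) powr u"
      using that by (simp add: powr_mult[symmetric])
    finally show ?thesis .
  qed
  moreover have "C * 2 powr u > 0" using C(1) by simp
  ultimately show thesis using that by blast
qed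

text \<open>A mass distribution argument: all m^n words of length n meet the cells of side \<beta>^n
  that cover the projection. There are at most a constant times \<beta>^(-nu) such cells, and each
  is met by at most a constant times m^n \<beta>^(n\<tau>) words.\<close>

lemma interval_exponent_le_assouad_exponent:
  assumes "\<tau> \<in> interval_exponents proj_measure" "\<tau> \<ge> 0" "u \<in> assouad_exponents grid_count proj_F"
  shows "\<tau> \<le> u"
proof -
  obtain C1 where C1: "C1 > 0" "\<And>n c l. \<beta> ^ n \<le> l \<Longrightarrow>
    real (card {w \<in> words n. xoff w \<le> c + l \<and> c \<le> xoff w + \<beta> ^ n}) \<le> C1 * real (card I) ^ n * l powr \<tau>"
    using card_words_meeting_interval[OF assms(1,2)] by blast
  obtain C2 where C2: "C2 > 0" "\<And>\<delta> c \<rho>. 0 < \<delta> \<Longrightarrow> \<delta> \<le> \<rho> \<Longrightarrow>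
    real (grid_count \<delta> (proj_F \<inter> {c..c + \<rho>})) \<le> C2 * (\<rho> / \<delta>) powr u"
    using grid_count_interval_le[OF assms(3)] by blast
  obtain p0 where p0: "p0 \<in> F" using F_nonempty by blast
  have "1 \<le> (C1 * C2) * (\<beta> ^ n) powr (\<tau> - u)" for n
  proof -
    let ?d = "\<beta> ^ n" and ?cells = "(\<lambda>x. \<lfloor>x / \<beta> ^ n\<rfloor>) ` proj_F"
    let ?V = "\<lambda>z. {w \<in> words n. xoff w \<le> real_of_int z * ?d + ?d \<and> real_of_int z * ?d \<le> xoff w + ?d}"
    have d: "?d > 0" "?d \<le> 1" using \<beta>_pos \<beta>_less_1 by (auto simp: power_le_one)
    have fin: "finite ?cells" by (rule finite_grid[OF bounded_proj_F d(1)])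
    have "words n \<subseteq> (\<Union>z\<in>?cells. ?V z)"
    proof
      fix w assume w: "w \<in> words n"
      let ?x = "\<beta> ^ n * fst p0 + xoff w"
      have "word_map S w p0 \<in> F" by (rule word_map_F[OF w p0])
      then have "?x \<in> proj_F" using words_length[OF w] by (force simp: word_map_eq image_iff)
      moreover have "0 \<le> \<beta> ^ n * fst p0" "\<beta> ^ n * fst p0 \<le> \<beta> ^ n"
        using F_in_unit_square[OF p0] d by (auto simp: mult_left_le)
      then have "xoff w \<le> real_of_int \<lfloor>?x / ?d\<rfloor> * ?d + ?d" "real_of_int \<lfloor>?x / ?d\<rfloor> * ?d \<le> xoff w + ?d"
        using floor_divide_lower[OF d(1), of ?x] floor_divide_upper[OF d(1), of ?x, unfolded distrib_right mult_1]
        by linarith+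
      then have "w \<in> ?V \<lfloor>?x / ?d\<rfloor>" using w by blast
      ultimately show "w \<in> (\<Union>z\<in>?cells. ?V z)" by blast
    qed
    then have "card (words n) \<le> card (\<Union>z\<in>?cells. ?V z)"
      by (rule card_mono[rotated]) (rule finite_subset[OF _ finite_words[of n]], blast)
    also have "\<dots> \<le> (\<Sum>z\<in>?cells. card (?V z))" by (rule card_UN_le[OF fin])
    finally have "real (card I) ^ n \<le> (\<Sum>z\<in>?cells. real (card (?V z)))"
      by (simp add: card_words flip: of_nat_sum of_nat_power)
    also have "\<dots> \<le> (\<Sum>z\<in>?cells. C1 * real (card I) ^ n * ?d powr \<tau>)"
      by (intro sum_mono C1(2)) auto
    also have "\<dots> = real (grid_count ?d proj_F) * (C1 * real (card I) ^ n * ?d powr \<tau>)"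
      by (simp add: grid_count_def)
    \<comment> \<open>The projection is presented as its part over an interval of length 1, the form
      in which the interval estimate applies.\<close>
    also have "proj_F = proj_F \<inter> {0..0 + 1}" using F_in_unit_square by auto
    also have "real (grid_count ?d (proj_F \<inter> {0..0 + 1})) * (C1 * real (card I) ^ n * ?d powr \<tau>) \<le>
        (C2 * (1 / ?d) powr u) * (C1 * real (card I) ^ n * ?d powr \<tau>)"
      using d C1(1) by (intro mult_right_mono C2(2)) auto
    also have "\<dots> = real (card I) ^ n * ((C1 * C2) * ?d powr (\<tau> - u))"
      using d by (simp add: powr_divide powr_diff field_simps)
    finally show ?thesis using card_I_pos by simp
  qed
  then have "\<tau> - u \<le> 0" using \<beta>_pos \<beta>_less_1 by (intro powr_lower_bound_imp_nonpos[of 1]) auto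
  then show ?thesis by simp
qed

text \<open>At least one word of length n meets the interval of a given word, while the count allows
  only a constant times (m \<beta>^\<tau>)^n. The logarithmic term of the upper bound is thus
  nonnegative, which its monotonicity arguments use.\<close>

lemma card_I_times_powr_ge_1:
  assumes "\<tau> \<in> interval_exponents proj_measure" "\<tau> \<ge> 0"
  shows "real (card I) * \<beta> powr \<tau> \<ge> 1"
proof (rule ccontr)
  assume less: "\<not> ?thesis"
  obtain C1 where C1: "C1 > 0" "\<And>n c l. \<beta> ^ n \<le> l \<Longrightarrow>
    real (card {w \<in> words n. xoff w \<le> c + l \<and> c \<le> xoff w + \<beta> ^ n}) \<le> C1 * real (card I) ^ n * l powr \<tau>"
    using card_words_meeting_interval[OF assms] by blast
  let ?Q = "real (card I) * \<beta> powr \<tau>"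
  have Q: "?Q > 0" using card_I_pos \<beta>_pos by simp
  have "1 \<le> C1 * (?Q ^ n) powr 1" for n
  proof -
    obtain w where w: "w \<in> words n" using words_nonempty by blast
    let ?V = "{v \<in> words n. xoff v \<le> xoff w + \<beta> ^ n \<and> xoff w \<le> xoff v + \<beta> ^ n}"
    have "w \<in> ?V" using w \<beta>_pos by simp
    then have "card ?V > 0" using card_gt_0_iff by fastforce
    then have "1 \<le> real (card ?V)" by simp
    also have "\<dots> \<le> C1 * real (card I) ^ n * (\<beta> ^ n) powr \<tau>" by (rule C1(2)) simp
    also have "(\<beta> ^ n) powr \<tau> = (\<beta> powr \<tau>) ^ n"
      using \<beta>_pos by (simp add: powr_powr mult.commute flip: powr_realpow)
    finally show ?thesis using Q by (simp add: power_mult_distrib mult.assoc)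
  qed
  then have "1 \<le> (0::real)" using less Q by (intro powr_lower_bound_imp_nonpos[of 1 C1 ?Q]) auto
  then show False by simp
qed

text \<open>At the scale \<alpha>^N of its height a cylinder is one-dimensional. Stretching by
  \<beta>^(-N) turns cells of side \<alpha>^N into cells of side (\<alpha>/\<beta>)^N and the strip
  into an interval over the projection. The points over one such cell fall into at most 2 * 2 plane
  cells.\<close>

lemma plane_grid_count_cylinder_le:
  assumes w: "w \<in> words N" and E: "E \<subseteq> word_map S w ` F" "\<And>p. p \<in> E \<Longrightarrow> fst p \<in> {c..c + l}"
  shows "finite (plane_cell (\<alpha> ^ N) ` E)"
    and "plane_grid_count (\<alpha> ^ N) E \<le>
      4 * grid_count ((\<alpha> / \<beta>) ^ N) (proj_F \<inter> {(c - xoff w) / \<beta> ^ N..(c - xoff w) / \<beta> ^ N + l / \<beta> ^ N})"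
proof -
  let ?h = "\<alpha> ^ N" and ?\<delta> = "(\<alpha> / \<beta>) ^ N"
  let ?K = "proj_F \<inter> {(c - xoff w) / \<beta> ^ N..(c - xoff w) / \<beta> ^ N + l / \<beta> ^ N}"
  have pos: "?h > 0" "\<beta> ^ N > 0" "?\<delta> > 0" using \<alpha>_pos \<beta>_pos by auto
  have h: "\<beta> ^ N * ?\<delta> = ?h" using \<beta>_pos by (simp add: power_divide)
  have bE: "bounded E"
    using E(1) word_map_F[OF w] by (intro bounded_subset[OF bounded_F]) blast
  then show "finite (plane_cell ?h ` E)" using pos by (intro finite_plane_grid)
  have "\<forall>p\<in>E. \<exists>q\<in>F. p = word_map S w q" using E(1) by blast
  then obtain q where q: "\<And>p. p \<in> E \<Longrightarrow> q p \<in> F \<and> p = word_map S w (q p)" by metis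
  have eq: "fst p = \<beta> ^ N * fst (q p) + xoff w" "snd p = \<alpha> ^ N * snd (q p) + yoff w" if "p \<in> E" for p
    using q[OF that] words_length[OF w] word_map_eq[of w "q p"] by (metis fst_conv, metis snd_conv)
  have qK: "fst (q p) \<in> ?K" if "p \<in> E" for p
  proof -
    have "c \<le> \<beta> ^ N * fst (q p) + xoff w" "\<beta> ^ N * fst (q p) + xoff w \<le> c + l"
      using E(2)[OF that] eq(1)[OF that] by auto
    then show ?thesis using q[OF that] pos
      by (auto simp: pos_divide_le_eq pos_le_divide_eq mult.commute simp flip: add_divide_distrib)
  qed
  let ?g = "\<lambda>p. \<lfloor>fst (q p) / ?\<delta>\<rfloor>"
  have bK: "bounded ?K" using bounded_proj_F by (simp add: bounded_Int)
  have sub: "?g ` E \<subseteq> (\<lambda>x. \<lfloor>x / ?\<delta>\<rfloor>) ` ?K" using qK by blast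
  have finK: "finite ((\<lambda>x. \<lfloor>x / ?\<delta>\<rfloor>) ` ?K)" using bK pos by (intro finite_grid)
  have "finite (plane_cell ?h ` E) \<and> card (plane_cell ?h ` E) \<le> 4 * card (?g ` E)"
  proof (rule card_image_le_fibres[OF finite_subset[OF sub finK]])
    fix z
    let ?E = "{p \<in> E. ?g p = z}"
    have "finite ((\<lambda>p. plane_cell ?h p) ` ?E) \<and> card ((\<lambda>p. plane_cell ?h p) ` ?E) \<le> (1 + 1) * (1 + 1)"
    proof (rule card_plane_cell_image_le)
      fix x y assume xy: "x \<in> ?E" "y \<in> ?E"
      have "fst (q x) - fst (q y) < ?\<delta>"
        using xy floor_eq_imp_close[of "fst (q x)" ?\<delta> "fst (q y)"] pos by auto
      then have "\<beta> ^ N * (fst (q x) - fst (q y)) < \<beta> ^ N * ?\<delta>" using pos by (intro mult_strict_left_mono)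
      then show "fst x - fst y \<le> real 1 * ?h" using h eq(1)[of x] eq(1)[of y] xy by (simp add: right_diff_distrib)
      have "snd (q x) - snd (q y) \<le> 1" using F_in_unit_square[of "q x"] F_in_unit_square[of "q y"] q xy by fastforce
      then have "\<alpha> ^ N * (snd (q x) - snd (q y)) \<le> \<alpha> ^ N * 1" using pos by (intro mult_left_mono) auto
      then show "snd x - snd y \<le> real 1 * ?h" using eq(2)[of x] eq(2)[of y] xy by (simp add: right_diff_distrib)
    qed (use pos in auto)
    then show "finite (plane_cell ?h ` ?E) \<and> card (plane_cell ?h ` ?E) \<le> 4" by simp
  qed
  then have "plane_grid_count ?h E \<le> 4 * card (?g ` E)" by (simp add: plane_grid_count_def)
  also have "\<dots> \<le> 4 * grid_count ?\<delta> ?K"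
    unfolding grid_count_def using card_mono[OF finK sub] by simp
  finally show "plane_grid_count ?h E \<le> 4 * grid_count ?\<delta> ?K" .
qed

text \<open>The points of the ball are sorted by pairs (i, j) of words of lengths k and n: packing
  bounds the number of i, the Hoelder bound the number of j for each i, and the cylinder estimate
  the contribution of each pair. The constant depends on L, but not on k, n, R or the
  centre.\<close>

lemma plane_grid_count_ball_le:
  assumes \<tau>: "\<tau> \<in> interval_exponents proj_measure" "\<tau> \<ge> 0"
    and u: "u \<in> assouad_exponents grid_count proj_F"
  obtains C where "C > 0" "\<And>k n R z. 0 < R \<Longrightarrow> R \<le> real L * \<alpha> ^ k \<Longrightarrow> \<alpha> ^ (k + n) \<le> R \<Longrightarrow>
    real (plane_grid_count (\<alpha> ^ (k + n)) (ball z R \<inter> F)) \<le>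
      C * (real (card I) * \<beta> powr \<tau>) ^ n * (R / \<alpha> ^ (k + n)) powr u"
proof -
  obtain C1 where C1: "C1 > 0" "\<And>n c l. \<beta> ^ n \<le> l \<Longrightarrow>
    real (card {w \<in> words n. xoff w \<le> c + l \<and> c \<le> xoff w + \<beta> ^ n}) \<le> C1 * real (card I) ^ n * l powr \<tau>"
    using card_words_meeting_interval[OF \<tau>] by blast
  obtain C2 where C2: "C2 > 0" "\<And>\<delta> c \<rho>. 0 < \<delta> \<Longrightarrow> \<delta> \<le> \<rho> \<Longrightarrow>
    real (grid_count \<delta> (proj_F \<inter> {c..c + \<rho>})) \<le> C2 * (\<rho> / \<delta>) powr u"
    using grid_count_interval_le[OF u] by blast
  have \<tau>u: "\<tau> \<le> u" by (rule interval_exponent_le_assouad_exponent[OF \<tau> u])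
  let ?M = "real ((4 * L + 3)\<^sup>2)"
  define C where "C = 4 * ?M * C1 * C2 * 2 powr u"
  have "real (plane_grid_count (\<alpha> ^ (k + n)) (ball z R \<inter> F)) \<le>
      C * (real (card I) * \<beta> powr \<tau>) ^ n * (R / \<alpha> ^ (k + n)) powr u"
    if R: "0 < R" "R \<le> real L * \<alpha> ^ k" "\<alpha> ^ (k + n) \<le> R" for k n R z
  proof -
    define N where "N = k + n"
    define h where "h = \<alpha> ^ N"
    define \<delta> where "\<delta> = (\<alpha> / \<beta>) ^ N"
    \<comment> \<open>\<open>lam\<close> is the width of the ball seen from a cylinder of level N,
      and \<open>\<rho>\<close> truncates it at 1, the size of the whole projection.
      \<open>l\<close> is the width seen from level k, raised to at least \<beta>^n so that the word
      count applies.\<close>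
    define lam where "lam = 2 * R / \<beta> ^ N"
    define l where "l = max (\<beta> ^ n) (2 * R / \<beta> ^ k)"
    define \<rho> where "\<rho> = min 1 lam"
    have pos: "h > 0" "\<delta> > 0" "\<beta> ^ N > 0" "\<beta> ^ n > 0" "\<beta> ^ k > 0" "lam > 0" "\<rho> > 0" "l > 0"
      using \<alpha>_pos \<beta>_pos R(1) by (auto simp: h_def \<delta>_def lam_def \<rho>_def l_def less_max_iff_disj)
    have \<delta>_eq: "\<delta> = h / \<beta> ^ N" by (simp add: \<delta>_def h_def power_divide)
    have \<delta>_le: "\<delta> \<le> \<rho>"
    proof -
      have "\<delta> \<le> 1" unfolding \<delta>_def using \<alpha>_pos \<alpha>_less_\<beta> by (intro power_le_one) auto
      moreover have "\<delta> \<le> lam" unfolding \<delta>_eq lam_def using R pos by (intro divide_right_mono) (auto simp: h_def N_def)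
      ultimately show ?thesis by (simp add: \<rho>_def)
    qed
    have l_eq: "l = \<beta> ^ n * max 1 lam"
      using \<beta>_pos pos by (simp add: l_def lam_def N_def power_add max_mult_distrib_left)
    define A where "A = {i \<in> words k. xoff i \<le> fst z + R \<and> fst z - R \<le> xoff i + \<beta> ^ k \<and>
      yoff i \<le> snd z + R \<and> snd z - R \<le> yoff i + \<alpha> ^ k}"
    define c where "c i = (fst z - R - xoff i) / \<beta> ^ k" for i
    define B where "B i = {j \<in> words n. xoff j \<le> c i + l \<and> c i \<le> xoff j + \<beta> ^ n}" for i
    define P where "P = Sigma A B"
    have finA: "finite A" and finB: "finite (B i)" for i
      using finite_words[of k] finite_words[of n] by (auto simp: A_def B_def)
    have finP: "finite P" unfolding P_def using finA finB by blast
    have "card A \<le> (4 * L + 3)\<^sup>2"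
      by (rule card_words_near_point[of A k "fst z" L "snd z"]) (use R in \<open>auto simp: A_def\<close>)
    then have "real (card A) \<le> ?M" by (rule of_nat_mono)
    have "real (card P) = (\<Sum>i\<in>A. real (card (B i)))"
      unfolding P_def using finA finB by (simp add: card_SigmaI)
    also have "\<dots> \<le> (\<Sum>i\<in>A. C1 * real (card I) ^ n * l powr \<tau>)"
      unfolding B_def by (intro sum_mono C1(2)) (simp add: l_def)
    also have "\<dots> = real (card A) * (C1 * real (card I) ^ n * l powr \<tau>)" by simp
    also have "\<dots> \<le> ?M * (C1 * real (card I) ^ n * l powr \<tau>)"
      using \<open>real (card A) \<le> ?M\<close> C1(1) by (intro mult_right_mono) auto
    finally have cardP: "real (card P) \<le> ?M * (C1 * real (card I) ^ n * l powr \<tau>)" .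
    let ?E = "ball z R \<inter> F"
    have E_near: "fst z - R \<le> fst p \<and> fst p \<le> fst z + R \<and> snd z - R \<le> snd p \<and> snd p \<le> snd z + R"
      if "p \<in> ?E" for p
      using that fst_diff_le_dist[of p z] fst_diff_le_dist[of z p] snd_diff_le_dist[of p z]
        snd_diff_le_dist[of z p] by (auto simp: dist_commute)
    have "\<exists>ij. ij \<in> P \<and> p \<in> word_map S (fst ij @ snd ij) ` F" if p: "p \<in> ?E" for p
    proof -
      obtain i q where i: "i \<in> words k" "q \<in> F" "p = word_map S i q" using F_covered p by blast
      obtain j q' where j: "j \<in> words n" "q' \<in> F" "q = word_map S j q'" using F_covered[OF i(2)] by blast
      have fp: "fst p = \<beta> ^ k * fst q + xoff i" "snd p = \<alpha> ^ k * snd q + yoff i"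
        using i words_length[of i k] by (simp_all add: word_map_eq)
      have fq: "fst q = \<beta> ^ n * fst q' + xoff j" using j words_length[of j n] by (simp add: word_map_eq)
      have "0 \<le> \<beta> ^ k * fst q" "\<beta> ^ k * fst q \<le> \<beta> ^ k * 1" "0 \<le> \<alpha> ^ k * snd q" "\<alpha> ^ k * snd q \<le> \<alpha> ^ k * 1"
        using F_in_unit_square[OF i(2)] \<alpha>_pos \<beta>_pos by (auto intro!: mult_left_mono)
      then have "i \<in> A" using E_near[OF p] fp i(1) by (auto simp: A_def)
      have "fst z - R \<le> \<beta> ^ k * fst q + xoff i" "\<beta> ^ k * fst q + xoff i \<le> fst z + R"
        using E_near[OF p] fp by auto
      then have "c i \<le> fst q" "fst q \<le> c i + 2 * R / \<beta> ^ k"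
        using pos by (auto simp: c_def pos_divide_le_eq pos_le_divide_eq algebra_simps simp flip: add_divide_distrib)
      moreover have "0 \<le> \<beta> ^ n * fst q'" "\<beta> ^ n * fst q' \<le> \<beta> ^ n * 1"
        using F_in_unit_square[OF j(2)] \<beta>_pos by (auto intro!: mult_left_mono)
      moreover have "2 * R / \<beta> ^ k \<le> l" by (simp add: l_def)
      ultimately have "j \<in> B i" using fq j(1) by (auto simp: B_def)
      then show ?thesis
        using \<open>i \<in> A\<close> i j by (intro exI[of _ "(i, j)"]) (auto simp: P_def word_map_append)
    qed
    then obtain g where g: "\<And>p. p \<in> ?E \<Longrightarrow> g p \<in> P \<and> p \<in> word_map S (fst (g p) @ snd (g p)) ` F"
      by metis
    define b where "b = 4 * (C2 * (\<rho> / \<delta>) powr u)"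
    have b0: "b \<ge> 0" using C2(1) by (simp add: b_def)
    have "finite (plane_cell h ` ?E) \<and> card (plane_cell h ` ?E) \<le> nat \<lfloor>b\<rfloor> * card (g ` ?E)"
    proof (rule card_image_le_fibres)
      show "finite (g ` ?E)" using g finP by (intro finite_subset[of "g ` ?E" P]) auto
      fix ij assume ij: "ij \<in> g ` ?E"
      then have ijP: "ij \<in> P" using g by blast
      let ?w = "fst ij @ snd ij"
      let ?fib = "{p \<in> ?E. g p = ij}"
      have w: "?w \<in> words N"
        unfolding N_def using ijP by (intro words_append) (auto simp: P_def A_def B_def)
      have sub: "?fib \<subseteq> word_map S ?w ` F" using g by blast
      have near: "fst p \<in> {fst z - R..fst z - R + 2 * R}" if "p \<in> ?fib" for p
        using E_near[of p] that by auto
      note cyl = plane_grid_count_cylinder_le[OF w sub near]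
      let ?c1 = "(fst z - R - xoff ?w) / \<beta> ^ N"
      \<comment> \<open>If \<open>lam\<close> exceeds 1, the interval [0,1] replaces the interval
        cut out by the ball, as it contains the whole projection.\<close>
      define c' where "c' = (if lam \<le> 1 then ?c1 else 0)"
      have "proj_F \<inter> {?c1..?c1 + 2 * R / \<beta> ^ N} \<subseteq> proj_F \<inter> {c'..c' + \<rho>}"
        using F_in_unit_square by (auto simp: c'_def \<rho>_def lam_def min_def)
      then have "grid_count \<delta> (proj_F \<inter> {?c1..?c1 + 2 * R / \<beta> ^ N}) \<le> grid_count \<delta> (proj_F \<inter> {c'..c' + \<rho>})"
        by (rule grid_count_mono) (use bounded_proj_F pos in \<open>auto simp: bounded_Int\<close>)
      then have "plane_grid_count h ?fib \<le> 4 * grid_count \<delta> (proj_F \<inter> {c'..c' + \<rho>})"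
        using cyl(2) unfolding h_def[symmetric] \<delta>_def[symmetric] by linarith
      then have "real (plane_grid_count h ?fib) \<le> 4 * real (grid_count \<delta> (proj_F \<inter> {c'..c' + \<rho>}))"
        by linarith
      also have "\<dots> \<le> b" unfolding b_def using C2(2)[OF pos(2) \<delta>_le, of c'] by simp
      finally have "plane_grid_count h ?fib \<le> nat \<lfloor>b\<rfloor>" by (rule le_nat_floor)
      then show "finite (plane_cell h ` ?fib) \<and> card (plane_cell h ` ?fib) \<le> nat \<lfloor>b\<rfloor>"
        using cyl(1) by (simp add: plane_grid_count_def h_def)
    qed
    then have "plane_grid_count h ?E \<le> nat \<lfloor>b\<rfloor> * card (g ` ?E)" by (simp add: plane_grid_count_def)
    also have "\<dots> \<le> nat \<lfloor>b\<rfloor> * card P"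
      using g finP by (intro mult_left_mono card_mono) auto
    finally have count: "real (plane_grid_count h ?E) \<le> real (nat \<lfloor>b\<rfloor>) * real (card P)"
      by (simp flip: of_nat_mult)
    \<comment> \<open>For \<open>lam\<close> \<le> 1 both sides agree. For \<open>lam\<close> > 1
      the additional words give a factor \<open>lam\<close> to the power \<tau>, which \<tau> \<le>
      u turns into the missing power u of \<open>lam\<close>.\<close>
    have "(\<rho> / \<delta>) powr u * l powr \<tau> \<le> (\<beta> ^ n) powr \<tau> * (lam / \<delta>) powr u"
    proof (cases "lam \<le> 1")
      case True
      then show ?thesis by (simp add: l_eq \<rho>_def)
    next
      case False
      then have "l powr \<tau> = (\<beta> ^ n) powr \<tau> * lam powr \<tau>" "\<rho> = 1"
        using pos by (simp_all add: l_eq \<rho>_def powr_mult)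
      then have "(\<rho> / \<delta>) powr u * l powr \<tau> = (\<beta> ^ n) powr \<tau> * (1 / \<delta>) powr u * lam powr \<tau>" by simp
      also have "\<dots> \<le> (\<beta> ^ n) powr \<tau> * (1 / \<delta>) powr u * lam powr u"
        using False \<tau>u by (intro mult_left_mono powr_mono) auto
      also have "\<dots> = (\<beta> ^ n) powr \<tau> * (1 / \<delta> * lam) powr u"
        using pos powr_mult[of "1 / \<delta>" lam u] by simp
      finally show ?thesis by simp
    qed
    also have "(\<beta> ^ n) powr \<tau> = (\<beta> powr \<tau>) ^ n"
      using \<beta>_pos by (simp add: powr_powr mult.commute flip: powr_realpow)
    also have "lam / \<delta> = 2 * (R / h)" using \<beta>_pos by (simp add: lam_def \<delta>_eq)
    also have "(2 * (R / h)) powr u = 2 powr u * (R / h) powr u" by (rule powr_mult)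
    finally have scale: "(\<rho> / \<delta>) powr u * l powr \<tau> \<le> (\<beta> powr \<tau>) ^ n * (2 powr u * (R / h) powr u)" .
    have "real (plane_grid_count h ?E) \<le> real (nat \<lfloor>b\<rfloor>) * real (card P)" by (rule count)
    also have "\<dots> \<le> b * (?M * (C1 * real (card I) ^ n * l powr \<tau>))"
      by (rule mult_mono[OF _ cardP]) (use b0 in auto)
    also have "\<dots> = 4 * ?M * C1 * C2 * real (card I) ^ n * ((\<rho> / \<delta>) powr u * l powr \<tau>)"
      by (simp add: b_def)
    also have "\<dots> \<le> 4 * ?M * C1 * C2 * real (card I) ^ n * ((\<beta> powr \<tau>) ^ n * (2 powr u * (R / h) powr u))"
      using C1(1) C2(1) by (intro mult_left_mono scale) auto
    finally show ?thesis
      unfolding h_def N_def C_def power_mult_distrib by (simp only: mult_ac)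
  qed
  moreover have "C > 0" using C1 C2 by (simp add: C_def)
  ultimately show thesis using that by blast
qed

lemma F_subset_ball: "x \<in> F \<Longrightarrow> F \<subseteq> ball x 3"
proof
  fix y assume xy: "x \<in> F" "y \<in> F"
  show "y \<in> ball x 3"
    using dist_plane_le[of x y] F_in_unit_square[OF xy(1)] F_in_unit_square[OF xy(2)] by auto
qed

text \<open>With \<alpha>^k comparable to R and \<alpha>^n to r / R, the scale \<alpha>^(k+n) is
  comparable to r, and the factor (m \<beta>^\<tau>)^n becomes a power of R / r with exponent
  q.\<close>

lemma assouad_exponent_upper:
  assumes \<tau>: "\<tau> \<in> interval_exponents proj_measure" "\<tau> \<ge> 0"
    and u: "u \<in> assouad_exponents grid_count proj_F"
  shows "u + ln (real (card I) * \<beta> powr \<tau>) / (- ln \<alpha>) \<in> assouad_exponents plane_grid_count F"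
proof -
  define Q where "Q = real (card I) * \<beta> powr \<tau>"
  define q where "q = ln Q / (- ln \<alpha>)"
  have Q: "Q \<ge> 1" unfolding Q_def by (rule card_I_times_powr_ge_1[OF \<tau>])
  have ln\<alpha>: "ln \<alpha> < 0" using \<alpha>_pos \<alpha>_less_1 by simp
  have q: "q \<ge> 0" using Q ln\<alpha> by (simp add: q_def divide_nonneg_neg)
  have Q_eq: "Q = (1 / \<alpha>) powr q"
    using Q ln\<alpha> \<alpha>_pos by (simp add: q_def powr_def ln_div)
  have u0: "u \<ge> 0"
    using assouad_exponents_nonneg[OF u] proj_F_nonempty grid_count_ge_1 by blast
  obtain C where C: "C > 0" "\<And>k n R z. 0 < R \<Longrightarrow> R \<le> real (nat \<lceil>3 / \<alpha>\<rceil>) * \<alpha> ^ k \<Longrightarrow> \<alpha> ^ (k + n) \<le> R \<Longrightarrow>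
    real (plane_grid_count (\<alpha> ^ (k + n)) (ball z R \<inter> F)) \<le> C * Q ^ n * (R / \<alpha> ^ (k + n)) powr u"
    using plane_grid_count_ball_le[OF \<tau> u] unfolding Q_def by blast
  \<comment> \<open>The factor 4 comes from rescaling cells, the two powers from rounding n,
    respectively k and n, to integers. The 3 is the radius of a ball about a point of F that
    contains F.\<close>
  define C' where "C' = 4 * C * (1 / \<alpha>) powr q * (3 / \<alpha>\<^sup>2) powr u"
  have "u + q \<in> assouad_exponents plane_grid_count F"
  proof (rule assouad_exponentsI[OF bounded_F F_nonempty F_subset_ball, where c = 4 and C = C'])
    show "plane_grid_count q E \<le> 4 * plane_grid_count r E" if "bounded E" "0 < r" "r \<le> q" for r q E
      using plane_grid_count_rescale[of E r q 1] that by (simp add: power2_eq_square)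
    show "C' > 0" using C(1) \<alpha>_pos by (simp add: C'_def)
    fix r R :: real and z assume r: "0 < r" "r < R" "R \<le> 3"
    obtain k where k: "\<alpha> ^ k \<le> R / 3" "R / 3 \<le> \<alpha> ^ k / \<alpha>"
      using power_scale_exists[of "R / 3" \<alpha>] r \<alpha>_pos \<alpha>_less_1 by auto
    obtain n where n: "\<alpha> ^ n \<le> r / R" "r / R \<le> \<alpha> ^ n / \<alpha>"
      using power_scale_exists[of "r / R" \<alpha>] r \<alpha>_pos \<alpha>_less_1 by auto
    let ?h = "\<alpha> ^ (k + n)"
    have h0: "?h > 0" "\<alpha> ^ k > 0" "\<alpha> ^ n > 0" using \<alpha>_pos by auto
    have "?h \<le> R / 3 * (r / R)" unfolding power_add using k n r h0 by (intro mult_mono) auto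
    then have h_le: "?h \<le> r / 3" using r by simp
    have "R / 3 * (r / R) \<le> (\<alpha> ^ k / \<alpha>) * (\<alpha> ^ n / \<alpha>)" using k n r h0 \<alpha>_pos by (intro mult_mono) auto
    then have "r / 3 \<le> ?h / \<alpha>\<^sup>2" using r by (simp add: power_add power2_eq_square)
    then have Rh: "R / ?h \<le> 3 / \<alpha>\<^sup>2 * (R / r)" using r h0 \<alpha>_pos by (simp add: field_simps)
    have "Q ^ n = (1 / \<alpha> ^ n) powr q"
      using \<alpha>_pos unfolding Q_eq by (simp add: powr_power powr_powr powr_divide power_one_over mult.commute flip: powr_realpow)
    also have "\<dots> \<le> (1 / \<alpha> * (R / r)) powr q"
      using n r h0 \<alpha>_pos q by (intro powr_mono2) (auto simp: field_simps)
    finally have Qn: "Q ^ n \<le> (1 / \<alpha>) powr q * (R / r) powr q" using r \<alpha>_pos by (simp flip: powr_mult)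
    have "R \<le> 3 / \<alpha> * \<alpha> ^ k" using k by (simp add: mult.commute)
    also have "\<dots> \<le> real (nat \<lceil>3 / \<alpha>\<rceil>) * \<alpha> ^ k" using h0 real_nat_ceiling_ge by (intro mult_right_mono) auto
    finally have RL: "R \<le> real (nat \<lceil>3 / \<alpha>\<rceil>) * \<alpha> ^ k" .
    have "plane_grid_count r (ball z R \<inter> F) \<le> (1 + 1)\<^sup>2 * plane_grid_count ?h (ball z R \<inter> F)"
      by (rule plane_grid_count_rescale) (use r h0 h_le in \<open>auto simp: bounded_Int\<close>)
    then have "real (plane_grid_count r (ball z R \<inter> F)) \<le> 4 * real (plane_grid_count ?h (ball z R \<inter> F))"
      by (simp add: power2_eq_square)
    also have "\<dots> \<le> 4 * (C * Q ^ n * (R / ?h) powr u)"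
      using C(2)[OF _ RL, of n z] r h_le by simp
    also have "\<dots> \<le> 4 * (C * ((1 / \<alpha>) powr q * (R / r) powr q) * (3 / \<alpha>\<^sup>2 * (R / r)) powr u)"
      using C(1) Qn Q Rh u0 r h0
      by (intro mult_left_mono mult_mono powr_mono2) auto
    also have "(3 / \<alpha>\<^sup>2 * (R / r)) powr u = (3 / \<alpha>\<^sup>2) powr u * (R / r) powr u"
      by (rule powr_mult)
    also have "4 * (C * ((1 / \<alpha>) powr q * (R / r) powr q) * ((3 / \<alpha>\<^sup>2) powr u * (R / r) powr u)) =
        C' * (R / r) powr (u + q)"
      by (simp add: C'_def powr_add mult_ac)
    finally show "real (plane_grid_count r (ball z R \<inter> F)) \<le> C' * (R / r) powr (u + q)" .
  qed (use plane_grid_count_ge_1 in auto)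
  then show ?thesis by (simp add: q_def Q_def)
qed

end

section \<open>The box dimension of the projection\<close>

text \<open>The hypotheses are asymmetric on purpose: supermultiplicative counts satisfy the upper
  bound with the limiting exponent itself, but the lower bound only for exponents that approach
  it.\<close>

lemma tendsto_ln_ratio:
  fixes N :: "real \<Rightarrow> real"
  assumes ge1: "\<And>r. 0 < r \<Longrightarrow> r < 1 \<Longrightarrow> N r \<ge> 1"
    and upper: "C > 0" "\<And>r. 0 < r \<Longrightarrow> r < 1 \<Longrightarrow> N r \<le> C * r powr (- D)"
    and lower: "\<And>a. a < D \<Longrightarrow> \<exists>d>a. \<exists>c>0. \<forall>r. 0 < r \<and> r < 1 \<longrightarrow> c * r powr (- d) \<le> N r"
  shows "((\<lambda>r. ln (N r) / (- ln r)) \<longlongrightarrow> D) (at_right 0)"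
proof -
  have lim: "((\<lambda>r. d + ln c / (- ln r)) \<longlongrightarrow> d) (at_right 0)" for c d :: real
  proof -
    have "filterlim (\<lambda>r::real. - ln r) at_top (at_right 0)"
      using ln_at_0 by (simp add: filterlim_uminus_at_top)
    then have "((\<lambda>r. ln c / (- ln r)) \<longlongrightarrow> 0) (at_right 0)"
      by (intro tendsto_divide_0[OF tendsto_const] filterlim_at_top_imp_at_infinity)
    then show ?thesis using tendsto_add[OF tendsto_const[of d]] by fastforce
  qed
  have eq: "ln (c * r powr (- d)) / (- ln r) = d + ln c / (- ln r)" if "0 < r" "r < 1" "c > 0" for c r d :: real
  proof -
    have "ln (c * r powr (- d)) = ln c - d * ln r" using that by (simp add: ln_mult ln_powr)
    then show ?thesis using that by (simp add: diff_divide_distrib)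
  qed
  have ev: "eventually (\<lambda>r::real. r \<in> {0<..<1}) (at_right 0)" by (rule eventually_at_right_real) simp
  show ?thesis
  proof (rule order_tendstoI)
    fix a assume "a < D"
    then obtain d c where d: "a < d" "c > 0" "\<And>r. 0 < r \<Longrightarrow> r < 1 \<Longrightarrow> c * r powr (- d) \<le> N r"
      using lower by blast
    have "eventually (\<lambda>r. a < d + ln c / (- ln r)) (at_right 0)" by (rule order_tendstoD(1)[OF lim d(1)])
    with ev show "eventually (\<lambda>r. a < ln (N r) / (- ln r)) (at_right 0)"
    proof eventually_elim
      case (elim r)
      then have r: "0 < r" "r < 1" by auto
      have "ln (c * r powr (- d)) \<le> ln (N r)" using d(2) d(3)[OF r] ge1[OF r] r by (subst ln_le_cancel_iff) auto
      then have "ln (c * r powr (- d)) / (- ln r) \<le> ln (N r) / (- ln r)"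
        using r by (intro divide_right_mono) auto
      then show ?case using elim eq[OF r d(2), of d] by linarith
    qed
  next
    fix a assume a: "D < a"
    have "eventually (\<lambda>r. D + ln C / (- ln r) < a) (at_right 0)" by (rule order_tendstoD(2)[OF lim a])
    with ev show "eventually (\<lambda>r. ln (N r) / (- ln r) < a) (at_right 0)"
    proof eventually_elim
      case (elim r)
      then have r: "0 < r" "r < 1" by auto
      have "ln (N r) \<le> ln (C * r powr (- D))"
        using upper(1) upper(2)[OF r] ge1[OF r] r by (subst ln_le_cancel_iff) auto
      then have "ln (N r) / (- ln r) \<le> ln (C * r powr (- D)) / (- ln r)"
        using r by (intro divide_right_mono) auto
      then show ?case using elim eq[OF r upper(1), of D] by linarith
    qed
  qed
qed

context self_affine_carpet
begin

text \<open>For each grid cell of side \<open>\<beta> ^ n\<close> choose a word of length \<open>n\<close> whose cylinder comes close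
  to it; the cylinders of different cells overlap boundedly often, and each is a copy of the
  whole projection.\<close>

lemma grid_count_supermultiplicative:
  "grid_count (\<beta> ^ n) proj_F * grid_count (\<beta> ^ k) proj_F \<le> 8 * grid_count (\<beta> ^ (n + k)) proj_F"
proof -
  have pos: "\<beta> ^ n > 0" "\<beta> ^ k > 0" "\<beta> ^ (n + k) > 0" using \<beta>_pos by auto
  let ?cells = "\<lambda>j. (\<lambda>x. \<lfloor>x / \<beta> ^ j\<rfloor>) ` proj_F"
  have fin: "finite (?cells j)" for j using \<beta>_pos by (intro finite_grid bounded_proj_F) simp
  have "\<exists>wx. fst wx \<in> words n \<and> z = \<lfloor>snd wx / \<beta> ^ n\<rfloor> \<and> xoff (fst wx) \<le> snd wx \<and>
      snd wx \<le> xoff (fst wx) + \<beta> ^ n" if z: "z \<in> ?cells n" for z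
  proof -
    obtain p where p: "p \<in> F" "z = \<lfloor>fst p / \<beta> ^ n\<rfloor>" using z by blast
    obtain w q where w: "w \<in> words n" "q \<in> F" "p = word_map S w q" using F_covered[OF p(1)] by blast
    have "fst p = \<beta> ^ n * fst q + xoff w" using w words_length[of w n] by (simp add: word_map_eq)
    moreover have "0 \<le> \<beta> ^ n * fst q" "\<beta> ^ n * fst q \<le> \<beta> ^ n"
      using F_in_unit_square[OF w(2)] pos by (auto simp: mult_left_le)
    ultimately show ?thesis using w(1) p(2) by (intro exI[of _ "(w, fst p)"]) auto
  qed
  then obtain c where c: "\<And>z. z \<in> ?cells n \<Longrightarrow> fst (c z) \<in> words n \<and> z = \<lfloor>snd (c z) / \<beta> ^ n\<rfloor> \<and>
      xoff (fst (c z)) \<le> snd (c z) \<and> snd (c z) \<le> xoff (fst (c z)) + \<beta> ^ n"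
    by metis
  let ?X = "?cells n \<times> proj_F"
  let ?y = "\<lambda>(z, x). \<beta> ^ n * x + xoff (fst (c z))"
  let ?f = "\<lambda>p. \<lfloor>?y p / \<beta> ^ (n + k)\<rfloor>"
  let ?g = "\<lambda>(z, x). (z, \<lfloor>x / \<beta> ^ k\<rfloor>)"
  have y_in: "?y p \<in> proj_F" if pX: "p \<in> ?X" for p
  proof -
    obtain z q where p: "p = (z, fst q)" "z \<in> ?cells n" "q \<in> F" using pX by (cases p) auto
    have "word_map S (fst (c z)) q \<in> F" using c[OF p(2)] word_map_F[OF _ p(3)] by blast
    then show ?thesis using p c[OF p(2)] words_length[of "fst (c z)" n] by (force simp: word_map_eq image_iff)
  qed
  have sub: "?f ` ?X \<subseteq> ?cells (n + k)" using y_in by blast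
  \<comment> \<open>8 = 4 * 2: a cell of side \<beta>^(n+k) is reached from at most 4 chosen words,
    because their cells have indices at most 3 apart, and within each word from at most 2 cells of
    side \<beta>^k.\<close>
  have "finite (?g ` ?X) \<and> card (?g ` ?X) \<le> 8 * card (?f ` ?X)"
  proof (rule card_image_le_fibres[OF finite_subset[OF sub fin]])
    fix v
    let ?Y = "{p \<in> ?X. ?f p = v}"
    have yy: "?y p - ?y q < \<beta> ^ (n + k)" if "p \<in> ?Y" "q \<in> ?Y" for p q
      using that pos by (intro floor_eq_imp_close) auto
    have "finite (fst ` ?Y) \<and> card (fst ` ?Y) \<le> 3 + 1"
    proof (rule card_int_set_le)
      fix a b assume "a \<in> fst ` ?Y" "b \<in> fst ` ?Y"
      then obtain p q where pq: "p \<in> ?Y" "q \<in> ?Y" "a = fst p" "b = fst q" by blast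
      then obtain x x' where x: "p = (a, x)" "q = (b, x')" "x \<in> proj_F" "x' \<in> proj_F"
          "a \<in> ?cells n" "b \<in> ?cells n"
        by (cases p, cases q) auto
      have "0 \<le> \<beta> ^ n * x" "0 \<le> \<beta> ^ n * x'" "\<beta> ^ n * x \<le> \<beta> ^ n" "\<beta> ^ n * x' \<le> \<beta> ^ n"
        using proj_F_in_unit[OF x(3)] proj_F_in_unit[OF x(4)] pos by (auto simp: mult_left_le)
      moreover have "\<beta> ^ (n + k) \<le> \<beta> ^ n" using \<beta>_pos \<beta>_less_1 by (intro power_decreasing) auto
      moreover have "\<beta> ^ n * x + xoff (fst (c a)) - (\<beta> ^ n * x' + xoff (fst (c b))) < \<beta> ^ (n + k)"
        using yy[OF pq(1,2)] x by simp
      ultimately have "snd (c a) - snd (c b) \<le> real 3 * \<beta> ^ n"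
        using c[OF x(5)] c[OF x(6)] by linarith
      then have "\<lfloor>snd (c a) / \<beta> ^ n\<rfloor> - \<lfloor>snd (c b) / \<beta> ^ n\<rfloor> \<le> int 3" using pos by (intro floor_diff_le)
      then show "a - b \<le> int 3" using c[OF x(5)] c[OF x(6)] by simp
    qed
    then have fst_Y: "finite (fst ` ?Y)" "card (fst ` ?Y) \<le> 4" by auto
    have "finite (?g ` ?Y) \<and> card (?g ` ?Y) \<le> 2 * card (fst ` ?Y)"
    proof (rule card_image_le_fibres[OF fst_Y(1)])
      fix z
      let ?Z = "{p \<in> ?Y. fst p = z}"
      have "finite ((\<lambda>p. \<lfloor>snd p / \<beta> ^ k\<rfloor>) ` ?Z) \<and> card ((\<lambda>p. \<lfloor>snd p / \<beta> ^ k\<rfloor>) ` ?Z) \<le> 1 + 1"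
      proof (rule card_floor_image_le)
        fix p q assume pq: "p \<in> ?Z" "q \<in> ?Z"
        then have "\<beta> ^ n * snd p - \<beta> ^ n * snd q < \<beta> ^ n * \<beta> ^ k"
          using yy[of p q] by (auto simp: case_prod_beta power_add)
        then have "\<beta> ^ n * (snd p - snd q) < \<beta> ^ n * \<beta> ^ k" by (simp add: right_diff_distrib)
        then show "snd p - snd q \<le> real 1 * \<beta> ^ k" using pos by simp
      qed (rule pos)
      moreover have "?g ` ?Z = Pair z ` (\<lambda>p. \<lfloor>snd p / \<beta> ^ k\<rfloor>) ` ?Z" by (force simp: image_iff)
      ultimately show "finite (?g ` ?Z) \<and> card (?g ` ?Z) \<le> 2"
        using card_image_le[of "(\<lambda>p. \<lfloor>snd p / \<beta> ^ k\<rfloor>) ` ?Z" "Pair z"] by auto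
    qed
    then show "finite (?g ` ?Y) \<and> card (?g ` ?Y) \<le> 8" using fst_Y by linarith
  qed
  moreover have "?g ` ?X = ?cells n \<times> ?cells k" by (force simp: image_iff)
  moreover have "card (?f ` ?X) \<le> card (?cells (n + k))" by (rule card_mono[OF fin sub])
  ultimately show ?thesis by (simp add: grid_count_def card_cartesian_product)
qed

section \<open>The box dimension as a supremum over single scales\<close>

definition lower_box_exponent :: "real \<Rightarrow> bool" where
  "lower_box_exponent d \<longleftrightarrow>
    (\<exists>c>0. \<forall>\<delta>. 0 < \<delta> \<and> \<delta> \<le> 1 \<longrightarrow> c * \<delta> powr (- d) \<le> real (grid_count \<delta> proj_F))"

lemma lower_box_exponent_0: "lower_box_exponent 0"
  unfolding lower_box_exponent_def
  using grid_count_ge_1[OF proj_F_nonempty bounded_proj_F] by (intro exI[of _ 1]) force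

text \<open>Supermultiplicativity is iterated with the constant 8 absorbed into the base. The
  remainder n mod p is joined by one last application, hence the 8 on the right.\<close>

lemma grid_count_power_ge:
  assumes "p > 0"
  shows "(real (grid_count (\<beta> ^ p) proj_F) / 8) ^ (n div p) \<le> 8 * real (grid_count (\<beta> ^ n) proj_F)"
proof -
  let ?M = "\<lambda>n. real (grid_count (\<beta> ^ n) proj_F)"
  have super: "?M n * ?M k \<le> 8 * ?M (n + k)" for n k
    using of_nat_mono[OF grid_count_supermultiplicative[of n k], where ?'a = real] by simp
  have ge1: "?M n \<ge> 1" for n
    using grid_count_ge_1[OF proj_F_nonempty bounded_proj_F, of "\<beta> ^ n"] \<beta>_pos by simp
  have "(?M p / 8) ^ j \<le> ?M (p * j)" for j
  proof (induction j)
    case 0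
    then show ?case using ge1[of 0] by simp
  next
    case (Suc j)
    have "(?M p / 8) ^ Suc j \<le> ?M p / 8 * ?M (p * j)" using Suc by (simp add: mult_left_mono)
    also have "\<dots> \<le> ?M (p + p * j)" using super[of p "p * j"] by simp
    finally show ?case by simp
  qed
  then have "(?M p / 8) ^ (n div p) \<le> ?M (p * (n div p)) * 1" by simp
  also have "\<dots> \<le> ?M (p * (n div p)) * ?M (n mod p)" using ge1 by (intro mult_left_mono) auto
  also have "\<dots> \<le> 8 * ?M (p * (n div p) + n mod p)" by (rule super)
  finally show ?thesis by simp
qed

text \<open>One scale \<beta>^p at which the count beats the exponent d by the factor 8 suffices:
  iteration carries the bound to all scales \<beta>^n, and rounding changes only the
  constant.\<close>

lemma lower_box_exponentI:
  assumes "p > 0" "d \<ge> 0" "(1 / \<beta> ^ p) powr d \<le> real (grid_count (\<beta> ^ p) proj_F) / 8"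
  shows "lower_box_exponent d"
proof -
  let ?M = "\<lambda>n. real (grid_count (\<beta> ^ n) proj_F)"
  define m where "m = nat \<lceil>1 / \<beta>\<rceil>"
  have "(\<beta> ^ p) powr d / (8 * real (m + 1)) * \<delta> powr (- d) \<le> real (grid_count \<delta> proj_F)"
    if \<delta>: "0 < \<delta>" "\<delta> \<le> 1" for \<delta>
  proof -
    obtain n where n: "\<beta> ^ n \<le> \<delta>" "\<delta> \<le> \<beta> ^ n / \<beta>" using power_scale_exists[OF \<delta> \<beta>_pos \<beta>_less_1] .
    have b: "\<beta> ^ n > 0" "\<beta> ^ p > 0" "\<beta> ^ (p * (n div p)) > 0" using \<beta>_pos by auto
    have "p * (n div p) + p \<ge> n" using assms(1) by (metis mult_div_mod_eq add_left_mono mod_less_divisor less_imp_le)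
    then have "\<beta> ^ (p * (n div p) + p) \<le> \<beta> ^ n" using \<beta>_pos \<beta>_less_1 by (intro power_decreasing) auto
    then have "\<beta> ^ (p * (n div p)) * \<beta> ^ p \<le> \<delta>" using n(1) by (simp add: power_add)
    then have "\<beta> ^ p / \<delta> \<le> 1 / \<beta> ^ (p * (n div p))" using b \<delta> by (simp add: field_simps)
    then have "(\<beta> ^ p / \<delta>) powr d \<le> (1 / \<beta> ^ (p * (n div p))) powr d"
      using b \<delta> assms(2) by (intro powr_mono2) auto
    also have "\<dots> = ((1 / \<beta> ^ p) powr d) ^ (n div p)"
      using b \<beta>_pos by (simp add: powr_power powr_powr powr_divide mult_ac power_mult flip: powr_realpow)
    also have "\<dots> \<le> (?M p / 8) ^ (n div p)" using assms(3) by (intro power_mono) auto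
    also have "\<dots> \<le> 8 * ?M n" by (rule grid_count_power_ge[OF assms(1)])
    also have "?M n \<le> real ((m + 1) * grid_count \<delta> proj_F)"
    proof (intro of_nat_mono grid_count_rescale[OF bounded_proj_F])
      have "\<delta> \<le> (1 / \<beta>) * \<beta> ^ n" using n(2) by simp
      also have "\<dots> \<le> real m * \<beta> ^ n" unfolding m_def using b real_nat_ceiling_ge by (intro mult_right_mono) auto
      finally show "\<delta> \<le> real m * \<beta> ^ n" .
    qed (use \<delta> b in auto)
    finally have "(\<beta> ^ p / \<delta>) powr d \<le> 8 * real (m + 1) * real (grid_count \<delta> proj_F)" by (simp add: algebra_simps)
    then have "(\<beta> ^ p / \<delta>) powr d / (8 * real (m + 1)) \<le> real (grid_count \<delta> proj_F)"
      by (subst pos_divide_le_eq) (simp_all add: mult_ac)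
    moreover have "(\<beta> ^ p) powr d / (8 * real (m + 1)) * \<delta> powr (- d) = (\<beta> ^ p / \<delta>) powr d / (8 * real (m + 1))"
      by (simp add: powr_divide powr_minus_divide)
    ultimately show ?thesis by simp
  qed
  moreover have "(\<beta> ^ p) powr d / (8 * real (m + 1)) > 0" using \<beta>_pos by simp
  ultimately show ?thesis unfolding lower_box_exponent_def by blast
qed

text \<open>As in Fekete's lemma, the limit is the supremum D of the single-scale exponents
  \<open>d p\<close>. The inequality \<open>d n\<close> \<le> D is the upper bound at scale
  \<beta>^n, and each nonnegative \<open>d p\<close> is a uniform lower exponent.\<close>

lemma box_dim_lower_exponents:
  assumes "a < box_dim proj_F"
  obtains d where "d \<ge> 0" "d > a" "lower_box_exponent d"
proof -
  let ?M = "\<lambda>n. real (grid_count (\<beta> ^ n) proj_F)"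
  define d where "d p = ln (?M p / 8) / (real p * (- ln \<beta>))" for p
  define D where "D = (SUP p\<in>{0<..}. d p)"
  have ln\<beta>: "- ln \<beta> > 0" using \<beta>_pos \<beta>_less_1 by simp
  have ge1: "?M n \<ge> 1" for n
    using grid_count_ge_1[OF proj_F_nonempty bounded_proj_F, of "\<beta> ^ n"] \<beta>_pos by simp
  have M_eq: "?M p = 8 * (1 / \<beta> ^ p) powr d p" if "p > 0" for p
    using ge1[of p] ln\<beta> \<beta>_pos that
    by (simp add: d_def powr_def ln_div ln_realpow exp_diff)
  have d_le: "d p \<le> 1" if p: "p > 0" for p
  proof -
    have b: "\<beta> ^ p > 0" "\<beta> ^ p \<le> 1" using \<beta>_pos \<beta>_less_1 by (auto simp: power_le_one)
    have "x - y \<le> real (nat \<lceil>1 / \<beta> ^ p\<rceil>) * \<beta> ^ p" if "x \<in> proj_F" "y \<in> proj_F" for x y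
    proof -
      have "x - y \<le> 1 / \<beta> ^ p * \<beta> ^ p" using proj_F_in_unit[OF that(1)] proj_F_in_unit[OF that(2)] \<beta>_pos by simp
      also have "\<dots> \<le> real (nat \<lceil>1 / \<beta> ^ p\<rceil>) * \<beta> ^ p"
        using b real_nat_ceiling_ge by (intro mult_right_mono) auto
      finally show ?thesis .
    qed
    then have "grid_count (\<beta> ^ p) proj_F \<le> nat \<lceil>1 / \<beta> ^ p\<rceil> + 1"
      unfolding grid_count_def using card_floor_image_le[of proj_F "\<lambda>x. x"] b by blast
    moreover have "1 / \<beta> ^ p > 0" using b by simp
    moreover have "1 \<le> 1 / \<beta> ^ p" using b by (subst le_divide_eq_1_pos) auto
    ultimately have "?M p \<le> 8 * (1 / \<beta> ^ p)" by linarith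
    then have "ln (?M p / 8) \<le> ln (1 / \<beta> ^ p)" using ge1[of p] b by (subst ln_le_cancel_iff) auto
    also have "\<dots> = real p * (- ln \<beta>)" using \<beta>_pos by (simp add: ln_div ln_realpow)
    finally have "ln (?M p / 8) \<le> 1 * (real p * (- ln \<beta>))" by simp
    moreover have "real p * (- ln \<beta>) > 0" using ln\<beta> p by (intro mult_pos_pos) auto
    ultimately show ?thesis unfolding d_def by (subst pos_divide_le_eq)
  qed
  have bdd: "bdd_above (d ` {0<..})" using d_le by (intro bdd_aboveI[of _ 1]) auto
  have d_D: "d p \<le> D" if "p > 0" for p unfolding D_def using bdd that by (intro cSUP_upper) auto
  \<comment> \<open>Counts are at least 1, so \<open>d p\<close> is at least - ln 8 / (p (- ln
    \<beta>)), which tends to 0.\<close>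
  have D0: "D \<ge> 0"
  proof (rule ccontr)
    assume "\<not> D \<ge> 0"
    then have D: "D < 0" by simp
    obtain p :: nat where p: "real p > ln 8 / (- ln \<beta> * (- D))" using reals_Archimedean2 by blast
    have "0 < ln 8 / (- ln \<beta> * (- D))" using D ln\<beta> by (intro divide_pos_pos mult_pos_pos) auto
    then have p0: "p > 0" using p by simp
    have pl: "real p * (- ln \<beta>) > 0" using ln\<beta> p0 by (intro mult_pos_pos) auto
    have "ln (1 / 8) \<le> ln (?M p / 8)" using ge1[of p] by (subst ln_le_cancel_iff) auto
    also have "ln (?M p / 8) = d p * (real p * (- ln \<beta>))" using ln\<beta> p0 by (simp add: d_def)
    also have "\<dots> \<le> D * (real p * (- ln \<beta>))" using d_D[OF p0] pl by (intro mult_right_mono) auto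
    finally have "- ln 8 \<le> D * (real p * (- ln \<beta>))" by (simp add: ln_div)
    moreover have "- ln \<beta> * (- D) > 0" using ln\<beta> D by (intro mult_pos_pos) auto
    then have "ln 8 < real p * (- ln \<beta> * (- D))" using p by (simp only: pos_divide_less_eq)
    ultimately show False by (simp add: algebra_simps)
  qed
  have ex: "\<exists>e\<ge>0. a < e \<and> lower_box_exponent e" if aD: "a < D" for a
  proof (cases "a < 0")
    case True
    then show ?thesis using lower_box_exponent_0 by blast
  next
    case False
    obtain p where p: "p > 0" "a < d p"
      using aD less_cSUP_iff[of "{0<..}" d a, OF _ bdd] unfolding D_def by auto
    have "lower_box_exponent (d p)"
      by (rule lower_box_exponentI[OF p(1)]) (use p M_eq False in auto)
    then show ?thesis using p False by (intro exI[of _ "d p"]) auto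
  qed
  have upper: "real (covering_number r proj_F) \<le> 48 * (1 / \<beta>) powr D * r powr (- D)"
    if r: "0 < r" "r < 1" for r
  proof -
    obtain n where n: "\<beta> ^ n \<le> r" "r \<le> \<beta> ^ n / \<beta>"
      using power_scale_exists[of r \<beta>] r \<beta>_pos \<beta>_less_1 by auto
    \<comment> \<open>The formula for the count in terms of \<open>d n\<close> fails at n = 0, where
      \<open>d 0\<close> is a division by 0. Here r < 1 excludes this case.\<close>
    have n0: "n > 0" using n r by (cases n) auto
    have b: "\<beta> ^ n > 0" using \<beta>_pos by simp
    have "covering_number r proj_F \<le> 3 * grid_count r proj_F"
      by (rule covering_number_grid_count(1)[OF bounded_proj_F r(1)])
    also have "\<dots> \<le> 3 * ((1 + 1) * grid_count (\<beta> ^ n) proj_F)"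
      using n b r by (intro mult_left_mono grid_count_rescale[OF bounded_proj_F]) auto
    finally have "real (covering_number r proj_F) \<le> 6 * ?M n" by simp
    also have "\<dots> = 48 * (1 / \<beta> ^ n) powr d n" by (simp add: M_eq[OF n0])
    also have "\<dots> \<le> 48 * (1 / \<beta> ^ n) powr D"
      using d_D[OF n0] b \<beta>_pos \<beta>_less_1 by (intro mult_left_mono powr_mono) (auto simp: power_le_one)
    also have "\<dots> \<le> 48 * ((1 / \<beta>) * (1 / r)) powr D"
      using n b r D0 \<beta>_pos by (intro mult_left_mono powr_mono2) (auto simp: field_simps)
    also have "\<dots> = 48 * (1 / \<beta>) powr D * r powr (- D)"
      using r \<beta>_pos by (simp add: powr_divide powr_minus powr_mult field_simps)
    finally show ?thesis .
  qed
  have "((\<lambda>r. ln (real (covering_number r proj_F)) / (- ln r)) \<longlongrightarrow> D) (at_right 0)"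
  proof (rule tendsto_ln_ratio[OF _ _ upper])
    fix r :: real assume r: "0 < r" "r < 1"
    have G: "grid_count r proj_F \<le> 2 * covering_number r proj_F"
      by (rule covering_number_grid_count(2)[OF bounded_proj_F r(1)])
    then show "1 \<le> real (covering_number r proj_F)"
      using grid_count_ge_1[OF proj_F_nonempty bounded_proj_F r(1)] by auto
  next
    fix a assume "a < D"
    then obtain e c where e: "a < e" "c > 0"
        "\<And>\<delta>. 0 < \<delta> \<Longrightarrow> \<delta> \<le> 1 \<Longrightarrow> c * \<delta> powr (- e) \<le> real (grid_count \<delta> proj_F)"
      using ex unfolding lower_box_exponent_def by blast
    have "c / 2 * r powr (- e) \<le> real (covering_number r proj_F)" if r: "0 < r" "r < 1" for r
      using covering_number_grid_count(2)[OF bounded_proj_F r(1)] e(3)[of r] r by simp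
    then show "\<exists>d>a. \<exists>c>0. \<forall>r. 0 < r \<and> r < 1 \<longrightarrow> c * r powr (- d) \<le> real (covering_number r proj_F)"
      using e by (intro exI[of _ e] conjI exI[of _ "c / 2"]) auto
  qed (use \<beta>_pos in auto)
  then have "box_dim proj_F = D" unfolding box_dim_def by (intro tendsto_Lim) auto
  then show thesis using ex assms that by blast
qed

end

section \<open>The lower bounds\<close>

context self_affine_carpet
begin

text \<open>Lower counterpart of the cylinder estimate. A plane cell meets at most 49 = (4 * 1 +
  3)^2 cylinders of level N, and within one cylinder it comes from at most 2 cells of the
  projection, so at most 98 pairs of word and cell share a plane cell.\<close>

lemma card_times_grid_count_le:
  assumes V: "V \<subseteq> words N" and K: "K \<subseteq> proj_F" and E: "bounded E"
    and sub: "\<And>w p. w \<in> V \<Longrightarrow> p \<in> F \<Longrightarrow> fst p \<in> K \<Longrightarrow> word_map S w p \<in> E"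
  shows "card V * grid_count ((\<alpha> / \<beta>) ^ N) K \<le> 98 * plane_grid_count (\<alpha> ^ N) E"
proof -
  let ?h = "\<alpha> ^ N" and ?\<delta> = "(\<alpha> / \<beta>) ^ N"
  have pos: "?h > 0" "\<beta> ^ N > 0" "?\<delta> > 0" using \<alpha>_pos \<beta>_pos by auto
  have h: "\<beta> ^ N * ?\<delta> = ?h" using \<beta>_pos by (simp add: power_divide)
  define X where "X = {x \<in> V \<times> F. fst (snd x) \<in> K}"
  let ?g = "\<lambda>x. (fst x, \<lfloor>fst (snd x) / ?\<delta>\<rfloor>)" and ?f = "\<lambda>x. plane_cell ?h (word_map S (fst x) (snd x))"
  have len: "length (fst x) = N" if "x \<in> X" for x using that V words_length by (auto simp: X_def)
  have finV: "finite V" using V finite_subset finite_words by blast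
  have sub_f: "?f ` X \<subseteq> plane_cell ?h ` E" using sub by (auto simp: X_def)
  have fin: "finite (plane_cell ?h ` E)" by (rule finite_plane_grid[OF E pos(1)])
  have "finite (?g ` X) \<and> card (?g ` X) \<le> 98 * card (?f ` X)"
  proof (rule card_image_le_fibres[OF finite_subset[OF sub_f fin]])
    fix z
    let ?Y = "{x \<in> X. ?f x = z}"
    have near: "\<bar>real_of_int (fst z) * ?h - (\<beta> ^ N * fst (snd x) + xoff (fst x))\<bar> < ?h \<and>
        \<bar>real_of_int (snd z) * ?h - (\<alpha> ^ N * snd (snd x) + yoff (fst x))\<bar> < ?h" if "x \<in> ?Y" for x
      using floor_cell_close[OF pos(1), of "\<beta> ^ N * fst (snd x) + xoff (fst x)"]
        floor_cell_close[OF pos(1), of "\<alpha> ^ N * snd (snd x) + yoff (fst x)"] that len[of x]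
      by (auto simp: plane_cell_def word_map_eq)
    have "card (fst ` ?Y) \<le> (4 * 1 + 3)\<^sup>2"
    proof (rule card_words_near_point)
      show "fst ` ?Y \<subseteq> words N" using V by (auto simp: X_def)
      fix w assume "w \<in> fst ` ?Y"
      then obtain x where x: "x \<in> ?Y" "w = fst x" by blast
      then have "snd x \<in> F" by (auto simp: X_def)
      then have "0 \<le> \<beta> ^ N * fst (snd x)" "\<beta> ^ N * fst (snd x) \<le> \<beta> ^ N"
          "0 \<le> \<alpha> ^ N * snd (snd x)" "\<alpha> ^ N * snd (snd x) \<le> \<alpha> ^ N"
        using F_in_unit_square[of "snd x"] pos by (auto simp: mult_left_le)
      then show "xoff w \<le> real_of_int (fst z) * ?h + real 1 * ?h \<and>
          real_of_int (fst z) * ?h - real 1 * ?h \<le> xoff w + \<beta> ^ N \<and>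
          yoff w \<le> real_of_int (snd z) * ?h + real 1 * ?h \<and>
          real_of_int (snd z) * ?h - real 1 * ?h \<le> yoff w + \<alpha> ^ N"
        using near[OF x(1)] x(2) by auto
    qed
    then have card_words: "card (fst ` ?Y) \<le> 49" by simp
    have "finite (fst ` ?Y)" using finV by (rule finite_subset[rotated]) (auto simp: X_def)
    then have "finite (?g ` ?Y) \<and> card (?g ` ?Y) \<le> 2 * card (fst ` ?Y)"
    proof (rule card_image_le_fibres)
      fix w
      let ?Z = "{x \<in> ?Y. fst x = w}"
      have "finite ((\<lambda>x. \<lfloor>fst (snd x) / ?\<delta>\<rfloor>) ` ?Z) \<and> card ((\<lambda>x. \<lfloor>fst (snd x) / ?\<delta>\<rfloor>) ` ?Z) \<le> 1 + 1"
      proof (rule card_floor_image_le)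
        fix x y assume xy: "x \<in> ?Z" "y \<in> ?Z"
        then have "plane_cell ?h (word_map S (fst x) (snd x)) = z" "plane_cell ?h (word_map S (fst y) (snd y)) = z"
          by blast+
        then have "\<lfloor>(\<beta> ^ N * fst (snd x) + xoff w) / ?h\<rfloor> = \<lfloor>(\<beta> ^ N * fst (snd y) + xoff w) / ?h\<rfloor>"
          using xy len[of x] len[of y] by (simp add: plane_cell_def word_map_eq prod_eq_iff)
        from floor_eq_imp_close[OF this pos(1)]
        have "\<beta> ^ N * (fst (snd x) - fst (snd y)) < \<beta> ^ N * ?\<delta>"
          unfolding h by (simp add: right_diff_distrib)
        then show "fst (snd x) - fst (snd y) \<le> real 1 * ?\<delta>" using pos by simp
      qed (rule pos)
      moreover have "?g ` ?Z = Pair w ` (\<lambda>x. \<lfloor>fst (snd x) / ?\<delta>\<rfloor>) ` ?Z" by (force simp: image_iff)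
      ultimately show "finite (?g ` ?Z) \<and> card (?g ` ?Z) \<le> 2"
        using card_image_le[of "(\<lambda>x. \<lfloor>fst (snd x) / ?\<delta>\<rfloor>) ` ?Z" "Pair w"] by auto
    qed
    then show "finite (?g ` ?Y) \<and> card (?g ` ?Y) \<le> 98" using card_words by linarith
  qed
  moreover have "?g ` X = V \<times> (\<lambda>x. \<lfloor>x / ?\<delta>\<rfloor>) ` K"
  proof
    show "?g ` X \<subseteq> V \<times> (\<lambda>x. \<lfloor>x / ?\<delta>\<rfloor>) ` K" by (auto simp: X_def)
    show "V \<times> (\<lambda>x. \<lfloor>x / ?\<delta>\<rfloor>) ` K \<subseteq> ?g ` X"
    proof
      fix v assume "v \<in> V \<times> (\<lambda>x. \<lfloor>x / ?\<delta>\<rfloor>) ` K"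
      then obtain w p where "w \<in> V" "p \<in> F" "fst p \<in> K" "v = (w, \<lfloor>fst p / ?\<delta>\<rfloor>)" using K by blast
      then show "v \<in> ?g ` X" by (intro image_eqI[of _ _ "(w, p)"]) (auto simp: X_def)
    qed
  qed
  moreover have "card (?f ` X) \<le> card (plane_cell ?h ` E)" by (rule card_mono[OF fin sub_f])
  ultimately show ?thesis by (simp add: grid_count_def plane_grid_count_def card_cartesian_product)
qed

lemma snd_word_map_close:
  assumes "i \<in> words k" "p \<in> F" "q \<in> F"
  shows "\<bar>snd (word_map S i p) - snd (word_map S i q)\<bar> \<le> \<alpha> ^ k"
proof -
  have "\<bar>snd p - snd q\<bar> \<le> 1" using F_in_unit_square[OF assms(2)] F_in_unit_square[OF assms(3)] by linarith
  then have "\<alpha> ^ k * \<bar>snd p - snd q\<bar> \<le> \<alpha> ^ k" using \<alpha>_pos by (simp add: mult_left_le)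
  moreover have "\<bar>snd (word_map S i p) - snd (word_map S i q)\<bar> = \<alpha> ^ k * \<bar>snd p - snd q\<bar>"
    using words_length[OF assms(1)] \<alpha>_pos by (simp add: word_map_eq abs_mult flip: right_diff_distrib)
  ultimately show ?thesis by simp
qed

lemma interval_diff_le_measure:
  assumes "is_interval J" "J \<subseteq> {0..1}" "x \<in> J" "y \<in> J"
  shows "\<bar>x - y\<bar> \<le> measure lborel (J :: real set)"
proof -
  have sub: "{min x y..max x y} \<subseteq> J"
  proof
    fix z assume "z \<in> {min x y..max x y}"
    then show "z \<in> J"
      using mem_is_interval_1_I[OF assms(1,3,4)] mem_is_interval_1_I[OF assms(1,4,3)]
      by (cases "x \<le> y") auto
  qed
  have unit: "{0..1::real} \<in> fmeasurable lborel" by (simp add: fmeasurable_def)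
  have "J \<in> fmeasurable lborel"
    by (rule fmeasurableI2[OF unit assms(2)]) (use real_interval_borel_measurable[OF assms(1)] in simp)
  then have "measure lborel {min x y..max x y} \<le> measure lborel J"
    by (intro measure_mono_fmeasurable sub) auto
  then show ?thesis by (simp add: min_def max_def abs_if split: if_splits)
qed

text \<open>Failure of T gives, for each constant C, one interval that is too heavy, without control
  of its scale. There is no sequence of scales along which constants could vanish, so C is fixed
  beforehand such that all constants cancel at the single n obtained.\<close>

lemma assouad_exponent_ge_interval_bound:
  assumes u: "u \<in> assouad_exponents plane_grid_count F"
    and d: "lower_box_exponent d" "d \<ge> 0"
    and T: "T \<notin> interval_exponents proj_measure" "T \<ge> 0"
  shows "d + (ln (real (card I)) + T * ln \<beta>) / (- ln \<alpha>) \<le> u"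
proof -
  obtain Cu where Cu: "Cu > 0" "\<And>r R x. 0 < r \<Longrightarrow> r < R \<Longrightarrow> x \<in> F \<Longrightarrow>
      real (plane_grid_count r (ball x R \<inter> F)) \<le> Cu * (R / r) powr u"
    using u unfolding assouad_exponents_def by blast
  obtain c where c: "c > 0" "\<And>\<delta>. 0 < \<delta> \<Longrightarrow> \<delta> \<le> 1 \<Longrightarrow> c * \<delta> powr (- d) \<le> real (grid_count \<delta> proj_F)"
    using d(1) unfolding lower_box_exponent_def by blast
  have u0: "u \<ge> 0" using assouad_exponents_nonneg[OF u] F_nonempty plane_grid_count_ge_1 by blast
  define B where "B = 98 * Cu * (5 / \<alpha>) powr u"
  \<comment> \<open>B collects the constants of the upper count and c is that of the lower box
    exponent. With C * c = B only pure n-th powers remain.\<close>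
  define C where "C = B / c"
  define Q where "Q = real (card I) * \<beta> powr T"
  have Q: "Q > 0" using card_I_pos \<beta>_pos by (simp add: Q_def)
  have C0: "C > 0" "C * c = B" using Cu c \<alpha>_pos by (auto simp: C_def B_def)
  obtain J where J: "is_interval J" "J \<subseteq> {0..1}" "0 < measure lborel J"
      "C * measure lborel J powr T < measure proj_measure J"
    using T(1) C0(1) unfolding interval_exponents_def by (auto simp: not_le)
  define l where "l = measure lborel J"
  have J_diff: "\<bar>x - y\<bar> \<le> l" if "x \<in> J" "y \<in> J" for x y
    unfolding l_def by (rule interval_diff_le_measure[OF J(1,2) that])
  have "measure lborel J \<le> measure lborel {0..1::real}"
    using real_interval_borel_measurable[OF J(1)] J(2) by (intro measure_mono_fmeasurable) (auto simp: fmeasurable_def)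
  then have l: "0 < l" "l \<le> 1" using J(3) by (auto simp: l_def)
  obtain n where n: "\<beta> ^ n \<le> l" "l \<le> \<beta> ^ n / \<beta>" using power_scale_exists[OF l \<beta>_pos \<beta>_less_1] .
  have b: "\<beta> ^ n > 0" "\<beta> ^ n \<le> 1" "\<beta> ^ n \<le> \<beta> ^ n / \<beta>"
    using \<beta>_pos \<beta>_less_1 by (auto simp: power_le_one pos_le_divide_eq mult_left_le)
  have ab: "0 < \<alpha> / \<beta>" "\<alpha> / \<beta> < 1" using \<alpha>_pos \<alpha>_less_\<beta> by auto
  \<comment> \<open>This choice makes \<alpha>^k comparable to \<beta>^(k+n), so the height of the
    common prefix cylinder matches the width of the image of J.\<close>
  obtain k where k: "(\<alpha> / \<beta>) ^ k \<le> \<beta> ^ n" "\<beta> ^ n \<le> (\<alpha> / \<beta>) ^ k / (\<alpha> / \<beta>)"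
    using power_scale_exists[OF b(1,2) ab] .
  define V where "V = {w \<in> words n. {xoff w..xoff w + \<beta> ^ n} \<inter> J \<noteq> {}}"
  have V: "V \<subseteq> words n" by (auto simp: V_def)
  have "C * (\<beta> ^ n) powr T \<le> C * l powr T" using C0 T n b by (intro mult_left_mono powr_mono2) auto
  also have "\<dots> < measure proj_measure J" using J(4) by (simp add: l_def)
  also have "\<dots> \<le> real (card V) / real (card I) ^ n"
    by (rule proj_measure_le[OF real_interval_borel_measurable[OF J(1)] V]) (auto simp: V_def)
  finally have "C * (\<beta> ^ n) powr T * real (card I) ^ n < real (card V)"
    using card_I_pos by (simp add: pos_less_divide_eq)
  moreover have "(\<beta> ^ n) powr T = (\<beta> powr T) ^ n"
    using \<beta>_pos by (simp add: powr_powr mult.commute flip: powr_realpow)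
  ultimately have cardV: "C * Q ^ n < real (card V)" by (simp add: Q_def power_mult_distrib mult_ac)
  have "C * Q ^ n > 0" using C0 Q by simp
  with cardV have "V \<noteq> {}" by (intro notI) simp
  then obtain v0 where v0: "v0 \<in> V" by blast
  obtain p0 where p0: "p0 \<in> F" using F_nonempty by blast
  obtain i where i: "i \<in> words k" using words_nonempty by blast
  let ?N = "k + n"
  define z where "z = word_map S (i @ v0) p0"
  have zF: "z \<in> F"
    unfolding z_def by (rule word_map_F[OF words_append[OF i] p0]) (use v0 V in auto)
  \<comment> \<open>Horizontally the points differ by at most 3 units of \<beta>^(k+n) / \<beta>:
    one for J and one for each end. Vertically one more unit suffices, and the fifth gives
    strictness.\<close>
  define R where "R = 5 * \<beta> ^ ?N / \<beta>"
  let ?h = "\<alpha> ^ ?N" and ?\<delta> = "(\<alpha> / \<beta>) ^ ?N"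
  have bN: "\<beta> ^ ?N > 0" "\<beta> ^ k > 0" "?h > 0" "\<alpha> ^ k > 0" "\<alpha> ^ n > 0" "?\<delta> > 0" using \<alpha>_pos \<beta>_pos by auto
  have \<alpha>k: "\<alpha> ^ k \<le> \<beta> ^ ?N"
    using k(1) bN \<beta>_pos by (simp add: power_divide pos_divide_le_eq power_add mult.commute)
  have \<beta>N: "\<beta> ^ ?N / \<beta> \<le> \<alpha> ^ k / \<alpha>"
  proof -
    have "\<beta> ^ k * \<beta> ^ n \<le> \<beta> ^ k * ((\<alpha> / \<beta>) ^ k / (\<alpha> / \<beta>))" using k(2) bN by (intro mult_left_mono) auto
    also have "\<dots> = \<alpha> ^ k * \<beta> / \<alpha>" using \<beta>_pos by (simp add: power_divide)
    finally show ?thesis using \<beta>_pos by (simp add: power_add pos_divide_le_eq)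
  qed
  have in_ball: "word_map S w p \<in> ball z R \<inter> F" if w: "w \<in> (@) i ` V" and p: "p \<in> F" for w p
  proof -
    obtain v where v: "v \<in> V" "w = i @ v" using w by blast
    have vF: "word_map S v p \<in> F" "word_map S v0 p0 \<in> F" using v v0 V word_map_F p p0 by blast+
    have fst_eq: "fst (word_map S v q) = \<beta> ^ n * fst q + xoff v" if "v \<in> V" for v q
      using words_length[of v n] V that by (auto simp: word_map_eq)
    have x_near: "\<exists>y\<in>J. \<bar>fst (word_map S v q) - y\<bar> \<le> \<beta> ^ n" if "v \<in> V" "q \<in> F" for v q
    proof -
      obtain y where "y \<in> J" "xoff v \<le> y" "y \<le> xoff v + \<beta> ^ n" using \<open>v \<in> V\<close> by (auto simp: V_def)
      moreover have "0 \<le> \<beta> ^ n * fst q" "\<beta> ^ n * fst q \<le> \<beta> ^ n"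
        using F_in_unit_square[OF \<open>q \<in> F\<close>] b by (auto simp: mult_left_le)
      ultimately show ?thesis unfolding fst_eq[OF that(1)] by (intro bexI[of _ y]) auto
    qed
    obtain y y' where y: "y \<in> J" "\<bar>fst (word_map S v p) - y\<bar> \<le> \<beta> ^ n"
        "y' \<in> J" "\<bar>fst (word_map S v0 p0) - y'\<bar> \<le> \<beta> ^ n"
      using x_near[OF v(1) p] x_near[OF v0 p0] by blast
    have "\<bar>fst (word_map S v p) - fst (word_map S v0 p0)\<bar> \<le> 3 * (\<beta> ^ n / \<beta>)"
      using y(2,4) J_diff[OF y(1,3)] n(2) b(3) by linarith
    then have "\<beta> ^ k * \<bar>fst (word_map S v p) - fst (word_map S v0 p0)\<bar> \<le> \<beta> ^ k * (3 * (\<beta> ^ n / \<beta>))"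
      using bN by (intro mult_left_mono) auto
    moreover have "\<bar>fst (word_map S w p) - fst z\<bar> = \<beta> ^ k * \<bar>fst (word_map S v p) - fst (word_map S v0 p0)\<bar>"
      using words_length[OF i] bN unfolding v z_def word_map_append comp_def
      by (subst (1 3) word_map_eq) (simp add: abs_mult flip: right_diff_distrib)
    moreover have "\<bar>snd (word_map S w p) - snd z\<bar> \<le> \<alpha> ^ k"
      using snd_word_map_close[OF i vF] by (simp add: v z_def word_map_append)
    moreover have "\<beta> ^ ?N \<le> \<beta> ^ ?N / \<beta>" "\<beta> ^ ?N / \<beta> > 0"
      using bN \<beta>_pos \<beta>_less_1 by (auto simp: pos_le_divide_eq mult_left_le)
    ultimately have "dist (word_map S w p) z < R"
      using dist_plane_le[of "word_map S w p" z] \<alpha>k by (simp add: R_def power_add)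
    moreover have "word_map S w p \<in> F" unfolding v using i v(1) V by (intro word_map_F[OF words_append p]) auto
    ultimately show ?thesis by (simp add: dist_commute)
  qed
  have "card ((@) i ` V) * grid_count ?\<delta> proj_F \<le> 98 * plane_grid_count ?h (ball z R \<inter> F)"
    by (rule card_times_grid_count_le) (use in_ball i V words_append in \<open>auto simp: bounded_Int\<close>)
  moreover have "card ((@) i ` V) = card V" by (rule card_image) (simp add: inj_on_def)
  ultimately have count: "real (card V) * real (grid_count ?\<delta> proj_F) \<le> 98 * real (plane_grid_count ?h (ball z R \<inter> F))"
    by (simp flip: of_nat_mult)
  have Rh: "?h < R" "R / ?h \<le> 5 / \<alpha> * (1 / \<alpha> ^ n)"
  proof -
    have "?h \<le> \<beta> ^ ?N" by (rule \<alpha>_power_le_\<beta>_power)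
    also have "\<dots> < R" unfolding R_def using bN \<beta>_pos \<beta>_less_1 by (simp add: pos_less_divide_eq)
    finally show "?h < R" .
    have "R / ?h \<le> 5 * (\<alpha> ^ k / \<alpha>) / ?h" unfolding R_def using \<beta>N bN by (intro divide_right_mono) auto
    also have "\<dots> = 5 / \<alpha> * (1 / \<alpha> ^ n)" using \<alpha>_pos by (simp add: power_add)
    finally show "R / ?h \<le> 5 / \<alpha> * (1 / \<alpha> ^ n)" .
  qed
  have "real (plane_grid_count ?h (ball z R \<inter> F)) \<le> Cu * (R / ?h) powr u"
    using Cu(2)[OF bN(3) Rh(1) zF] .
  also have "\<dots> \<le> Cu * (5 / \<alpha> * (1 / \<alpha> ^ n)) powr u"
    using Rh bN Cu(1) u0 by (intro mult_left_mono powr_mono2) auto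
  also have "\<dots> = Cu * ((5 / \<alpha>) powr u * (1 / \<alpha> ^ n) powr u)" by (simp only: powr_mult)
  finally have up: "98 * real (plane_grid_count ?h (ball z R \<inter> F)) \<le> B * (1 / \<alpha> ^ n) powr u"
    by (simp add: B_def)
  \<comment> \<open>The choice of k makes \<delta> at most \<alpha>^n, so k disappears and the count
    of the projection is bounded below by a power of \<alpha>^(-n), as is the ratio R / h from
    above.\<close>
  have "?\<delta> \<le> \<alpha> ^ n"
  proof -
    have "(\<alpha> / \<beta>) ^ k * (\<alpha> / \<beta>) ^ n \<le> \<beta> ^ n * (\<alpha> / \<beta>) ^ n" using k(1) ab by (intro mult_right_mono) auto
    then show ?thesis using \<beta>_pos by (simp add: power_add power_divide)
  qed
  then have "1 / \<alpha> ^ n \<le> 1 / ?\<delta>" using bN by (intro divide_left_mono) auto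
  then have "c * (1 / \<alpha> ^ n) powr d \<le> c * (1 / ?\<delta>) powr d"
    using c(1) d(2) bN by (intro mult_left_mono powr_mono2) auto
  also have "(1 / ?\<delta>) powr d = ?\<delta> powr (- d)" by (simp add: powr_divide powr_minus_divide)
  also have "c * ?\<delta> powr (- d) \<le> real (grid_count ?\<delta> proj_F)"
    using bN ab by (intro c(2)) (auto simp: power_le_one)
  finally have low: "c * (1 / \<alpha> ^ n) powr d \<le> real (grid_count ?\<delta> proj_F)" .
  have "C * Q ^ n * (c * (1 / \<alpha> ^ n) powr d) < real (card V) * (c * (1 / \<alpha> ^ n) powr d)"
    using cardV c(1) \<alpha>_pos by (intro mult_strict_right_mono) auto
  also have "\<dots> \<le> real (card V) * real (grid_count ?\<delta> proj_F)" using low by (intro mult_left_mono) auto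
  also have "\<dots> \<le> B * (1 / \<alpha> ^ n) powr u" using count up by linarith
  finally have "(C * c) * (Q ^ n * (1 / \<alpha> ^ n) powr d) < B * (1 / \<alpha> ^ n) powr u" by (simp add: mult_ac)
  then have "B * (Q ^ n * (1 / \<alpha> ^ n) powr d) < B * (1 / \<alpha> ^ n) powr u" by (simp only: C0(2))
  moreover have "B > 0" using Cu(1) \<alpha>_pos by (simp add: B_def)
  ultimately have "Q ^ n * (1 / \<alpha> ^ n) powr d < (1 / \<alpha> ^ n) powr u" by simp
  moreover have "(1 / \<alpha> ^ n) powr x = ((1 / \<alpha>) powr x) ^ n" for x
    using \<alpha>_pos by (simp add: powr_power powr_powr powr_divide power_divide mult.commute flip: powr_realpow)
  ultimately have "(Q * (1 / \<alpha>) powr d) ^ n < ((1 / \<alpha>) powr u) ^ n" by (simp add: power_mult_distrib)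
  \<comment> \<open>Strict inequality of n-th powers of nonnegative numbers passes to the bases, for
    whatever n the interval produced.\<close>
  then have "Q * (1 / \<alpha>) powr d < (1 / \<alpha>) powr u" using power_less_imp_less_base by fastforce
  then have "ln (Q * (1 / \<alpha>) powr d) < ln ((1 / \<alpha>) powr u)"
    using Q \<alpha>_pos by (subst ln_less_cancel_iff) auto
  then have "ln Q + d * (- ln \<alpha>) < u * (- ln \<alpha>)" using Q \<alpha>_pos by (simp add: ln_mult ln_powr ln_div)
  moreover have "ln Q = ln (real (card I)) + T * ln \<beta>"
    using card_I_pos \<beta>_pos by (simp add: Q_def ln_mult ln_powr)
  moreover have "- ln \<alpha> > 0" using \<alpha>_pos \<alpha>_less_1 by simp
  ultimately show ?thesis by (simp add: field_simps)
qed

text \<open>A class of coinciding projections gives words of one length p only. Since all pieces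
  have fixed length, concatenation is injective and its offset depends only on the offsets of the
  pieces, so the coincidence persists while the number of words is raised to the power l.\<close>

lemma iterated_words:
  assumes "A \<subseteq> words p" "\<And>v w. v \<in> A \<Longrightarrow> w \<in> A \<Longrightarrow> xoff v = xoff w"
  obtains V where "V \<subseteq> words (p * l)" "card V = card A ^ l" "\<And>v w. v \<in> V \<Longrightarrow> w \<in> V \<Longrightarrow> xoff v = xoff w"
proof -
  have "\<exists>V. V \<subseteq> words (p * l) \<and> card V = card A ^ l \<and> (\<forall>v\<in>V. \<forall>w\<in>V. xoff v = xoff w)"
  proof (induction l)
    case 0
    show ?case by (intro exI[of _ "{[]}"]) (simp add: words_def)
  next
    case (Suc l)
    then obtain V where V: "V \<subseteq> words (p * l)" "card V = card A ^ l"
        "\<And>v w. v \<in> V \<Longrightarrow> w \<in> V \<Longrightarrow> xoff v = xoff w" by blast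
    let ?f = "\<lambda>x. fst x @ snd x"
    have len: "length a = p" "length v = p * l" if "a \<in> A" "v \<in> V" for a v
      using that assms(1) V(1) words_length by blast+
    have "inj_on ?f (A \<times> V)"
      using len by (intro inj_onI) (auto simp: prod_eq_iff)
    then have "card (?f ` (A \<times> V)) = card A ^ Suc l"
      by (simp add: card_image card_cartesian_product V(2))
    moreover have "?f ` (A \<times> V) \<subseteq> words (p * Suc l)"
      unfolding mult_Suc_right using assms(1) V(1) by (auto intro!: words_append)
    moreover have "xoff x = xoff y" if xy: "x \<in> ?f ` (A \<times> V)" "y \<in> ?f ` (A \<times> V)" for x y
    proof -
      obtain a v b w where "x = a @ v" "y = b @ w" "a \<in> A" "b \<in> A" "v \<in> V" "w \<in> V" using xy by auto
      then show ?thesis using assms(2)[of a b] V(3)[of v w] len[of a v] len[of b w] by (simp add: off_append)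
    qed
    ultimately show ?case by blast
  qed
  then show thesis using that by blast
qed

lemma proj_F_subset_ball: "x \<in> proj_F \<Longrightarrow> proj_F \<subseteq> ball x 3"
proof
  fix y assume "x \<in> proj_F" "y \<in> proj_F"
  then show "y \<in> ball x 3" using proj_F_in_unit[of x] proj_F_in_unit[of y] unfolding mem_ball dist_real_def by linarith
qed

text \<open>A ball of the projection is reproduced in F by every word of an iterated class. All
  copies lie over the same interval and, behind a common prefix, at nearly the same height, so one
  ball of F contains them all. Dividing by their number lowers the exponent.\<close>

lemma assouad_exponent_minus_entropy:
  assumes u: "u \<in> assouad_exponents plane_grid_count F"
    and p: "p > 0" and A: "A \<subseteq> words p" "A \<noteq> {}" "\<And>v w. v \<in> A \<Longrightarrow> w \<in> A \<Longrightarrow> xoff v = xoff w"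
  shows "u - ln (real (card A)) / (real p * (- ln \<alpha>)) \<in> assouad_exponents grid_count proj_F"
proof -
  obtain Cu where Cu: "Cu > 0" "\<And>r R x. 0 < r \<Longrightarrow> r < R \<Longrightarrow> x \<in> F \<Longrightarrow>
      real (plane_grid_count r (ball x R \<inter> F)) \<le> Cu * (R / r) powr u"
    using u unfolding assouad_exponents_def by blast
  have u0: "u \<ge> 0" using assouad_exponents_nonneg[OF u] F_nonempty plane_grid_count_ge_1 by blast
  define \<theta> where "\<theta> = ln (real (card A)) / (real p * (- ln \<alpha>))"
  have "card A > 0" using A finite_subset[OF A(1) finite_words] by (simp add: card_gt_0_iff)
  then have cardA: "real (card A) \<ge> 1" by simp
  have ln\<alpha>: "- ln \<alpha> > 0" using \<alpha>_pos \<alpha>_less_1 by simp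
  have pl: "real p * (- ln \<alpha>) > 0" using p ln\<alpha> by (intro mult_pos_pos) auto
  have \<theta>: "\<theta> \<ge> 0" unfolding \<theta>_def using pl cardA by (intro divide_nonneg_pos) auto
  have cardA_eq: "real (card A) = (1 / \<alpha> ^ p) powr \<theta>"
    using cardA ln\<alpha> p \<alpha>_pos by (simp add: \<theta>_def powr_def ln_div ln_realpow)
  \<comment> \<open>9 = 3 * 3 comes from the radius R' and from the comparison of \<delta> with R
    \<alpha>^n. The quotient \<beta>/\<alpha> is due to the rounding of k, and \<alpha>^p to that of
    l.\<close>
  define B where "B = 9 * \<beta> / (\<alpha> * \<alpha> ^ p)"
  have B: "B > 0" using \<alpha>_pos \<beta>_pos by (simp add: B_def)
  have ab: "0 < \<alpha> / \<beta>" "\<alpha> / \<beta> < 1" using \<alpha>_pos \<alpha>_less_\<beta> by auto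
  define C where "C = 196 * Cu * B powr u"
  have "u - \<theta> \<in> assouad_exponents grid_count proj_F"
  proof (rule assouad_exponentsI[OF bounded_proj_F proj_F_nonempty proj_F_subset_ball, where c = 2 and C = C])
    show "grid_count q E \<le> 2 * grid_count r E" if "bounded E" "0 < r" "r \<le> q" for r q E
      using grid_count_rescale[of E r q 1] that by simp
    show "C > 0" using Cu(1) B by (simp add: C_def)
    fix r R :: real and x assume r: "0 < r" "r < R" "R \<le> 3" and x: "x \<in> proj_F"
    have "0 < \<alpha> ^ p" "\<alpha> ^ p < 1" using \<alpha>_pos \<alpha>_less_1 p by (auto simp: power_less_one_iff)
    \<comment> \<open>The class can be iterated only as a whole, so the ratio r / R is matched by
      powers of \<alpha>^p.\<close>
    then obtain l where l: "(\<alpha> ^ p) ^ l \<le> r / R" "r / R \<le> (\<alpha> ^ p) ^ l / \<alpha> ^ p"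
      using power_scale_exists[of "r / R" "\<alpha> ^ p"] r by auto
    define n where "n = p * l"
    have n: "\<alpha> ^ n \<le> r / R" "r / R \<le> \<alpha> ^ n / \<alpha> ^ p" using l by (simp_all add: n_def power_mult)
    have bn: "\<beta> ^ n > 0" "\<beta> ^ n \<le> 1" using \<beta>_pos \<beta>_less_1 by (auto simp: power_le_one)
    have "R * \<beta> ^ n \<le> 3 * 1" using r bn by (intro mult_mono) auto
    then have Rb: "0 < R * \<beta> ^ n / 3" "R * \<beta> ^ n / 3 \<le> 1" using r bn by auto
    \<comment> \<open>Now \<alpha>^k is at most a third of R \<beta>^(k+n), so the prefix makes
      height negligible against width, and \<delta> is comparable to R \<alpha>^n, hence to
      r.\<close>
    obtain k where k: "(\<alpha> / \<beta>) ^ k \<le> R * \<beta> ^ n / 3" "R * \<beta> ^ n / 3 \<le> (\<alpha> / \<beta>) ^ k / (\<alpha> / \<beta>)"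
      using power_scale_exists[OF Rb ab] .
    obtain V where V: "V \<subseteq> words n" "card V = card A ^ l" "\<And>v w. v \<in> V \<Longrightarrow> w \<in> V \<Longrightarrow> xoff v = xoff w"
      unfolding n_def using iterated_words[OF A(1) A(3)] by metis
    have "V \<noteq> {}" using V(2) \<open>card A > 0\<close> by (metis card.empty zero_less_power less_irrefl)
    then obtain v0 where v0: "v0 \<in> V" by blast
    obtain p0 where p0: "p0 \<in> F" "x = fst p0" using x by blast
    obtain i where i: "i \<in> words k" using words_nonempty by blast
    let ?N = "k + n"
    define z where "z = word_map S (i @ v0) p0"
    have zF: "z \<in> F"
      unfolding z_def by (rule word_map_F[OF words_append[OF i] p0(1)]) (use v0 V in auto)
    let ?h = "\<alpha> ^ ?N" and ?\<delta> = "(\<alpha> / \<beta>) ^ ?N" and ?K = "ball x R \<inter> proj_F"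
    \<comment> \<open>Horizontal distances are at most R \<beta>^(k+n) and vertical ones at most a
      third of that.\<close>
    define R' where "R' = 3 * R * \<beta> ^ ?N"
    have pos: "\<beta> ^ ?N > 0" "\<beta> ^ k > 0" "?h > 0" "\<alpha> ^ k > 0" "\<alpha> ^ n > 0" "?\<delta> > 0" using \<alpha>_pos \<beta>_pos by auto
    have h: "?h = ?\<delta> * \<beta> ^ ?N" using \<beta>_pos by (simp add: power_divide)
    have \<alpha>k: "3 * \<alpha> ^ k \<le> R * \<beta> ^ ?N"
      using k(1) pos by (simp add: power_divide pos_divide_le_eq power_add mult_ac)
    have \<delta>_le: "3 * ?\<delta> \<le> R * \<alpha> ^ n"
    proof -
      have "(\<alpha> / \<beta>) ^ k * (\<alpha> / \<beta>) ^ n \<le> R * \<beta> ^ n / 3 * (\<alpha> / \<beta>) ^ n" using k(1) ab by (intro mult_right_mono) auto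
      then show ?thesis using \<beta>_pos by (simp add: power_add power_divide mult_ac)
    qed
    have \<delta>_ge: "R * \<alpha> ^ n * (\<alpha> / \<beta>) \<le> 3 * ?\<delta>"
    proof -
      have "R * \<beta> ^ n / 3 * (\<alpha> / \<beta>) \<le> (\<alpha> / \<beta>) ^ k" using k(2) ab by (simp only: pos_le_divide_eq)
      then have "R * \<beta> ^ n / 3 * (\<alpha> / \<beta>) * (\<alpha> / \<beta>) ^ n \<le> (\<alpha> / \<beta>) ^ k * (\<alpha> / \<beta>) ^ n"
        using ab by (intro mult_right_mono) auto
      moreover have "R * \<beta> ^ n / 3 * (\<alpha> / \<beta>) * (\<alpha> / \<beta>) ^ n = R * \<alpha> ^ n * (\<alpha> / \<beta>) / 3"
        using \<beta>_pos by (simp add: power_divide mult_ac)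
      ultimately have "R * \<alpha> ^ n * (\<alpha> / \<beta>) / 3 \<le> (\<alpha> / \<beta>) ^ k * (\<alpha> / \<beta>) ^ n" by (simp only:)
      moreover have "X \<le> 3 * Y" if "X / 3 \<le> Y" for X Y :: real using that by simp
      ultimately show ?thesis unfolding power_add by blast
    qed
    have "R * \<alpha> ^ n \<le> r" using n(1) r by (simp add: pos_le_divide_eq mult.commute)
    with \<delta>_le have \<delta>_r: "?\<delta> \<le> r" using pos by linarith
    have in_ball: "word_map S w q \<in> ball z R' \<inter> F" if w: "w \<in> (@) i ` V" and q: "q \<in> F" "fst q \<in> ?K" for w q
    proof -
      obtain v where v: "v \<in> V" "w = i @ v" using w by blast
      have vF: "word_map S v q \<in> F" "word_map S v0 p0 \<in> F" using v v0 V word_map_F p0 q by blast+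
      have w_len: "length w = ?N" "length (i @ v0) = ?N" using v v0 V(1) words_length[OF i] words_length[of _ n] by auto
      have "xoff w = xoff (i @ v0)" using V(3)[OF v(1) v0] by (simp add: v off_append)
      then have "\<bar>fst (word_map S w q) - fst z\<bar> = \<beta> ^ ?N * \<bar>fst q - x\<bar>"
        unfolding z_def word_map_eq w_len p0(2) using pos by (simp add: abs_mult flip: right_diff_distrib)
      also have "\<dots> \<le> \<beta> ^ ?N * R" using q(2) pos by (intro mult_left_mono) (auto simp: dist_real_def)
      finally have "\<bar>fst (word_map S w q) - fst z\<bar> \<le> R * \<beta> ^ ?N" by (simp add: mult.commute)
      moreover have "\<bar>snd (word_map S w q) - snd z\<bar> \<le> \<alpha> ^ k"
        using snd_word_map_close[OF i vF] by (simp add: v z_def word_map_append)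
      moreover have "R * \<beta> ^ ?N > 0" using r pos by simp
      ultimately have "dist (word_map S w q) z < R'"
        using dist_plane_le[of "word_map S w q" z] \<alpha>k pos(4) by (simp add: R'_def)
      moreover have "word_map S w q \<in> F" unfolding v using i v(1) V by (intro word_map_F[OF words_append q(1)]) auto
      ultimately show ?thesis by (simp add: dist_commute)
    qed
    have "card ((@) i ` V) * grid_count ?\<delta> ?K \<le> 98 * plane_grid_count ?h (ball z R' \<inter> F)"
      by (rule card_times_grid_count_le) (use in_ball i V words_append in \<open>auto simp: bounded_Int\<close>)
    moreover have "card ((@) i ` V) = card A ^ l" using V(2) by (subst card_image) (auto simp: inj_on_def)
    ultimately have count: "real (card A) ^ l * real (grid_count ?\<delta> ?K) \<le> 98 * real (plane_grid_count ?h (ball z R' \<inter> F))"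
      by (simp flip: of_nat_mult of_nat_power)
    have hR: "?h < R'"
    proof -
      have "?h \<le> r * \<beta> ^ ?N" unfolding h using \<delta>_r pos by (intro mult_right_mono) auto
      also have "\<dots> < 3 * R * \<beta> ^ ?N" using r pos by (intro mult_strict_right_mono) auto
      finally show ?thesis by (simp add: R'_def)
    qed
    have "R' / ?h = 3 * R / ?\<delta>" unfolding h R'_def using pos by simp
    also have "\<dots> \<le> 9 * \<beta> / \<alpha> * (1 / \<alpha> ^ n)"
      using \<delta>_ge pos \<alpha>_pos \<beta>_pos by (simp add: pos_divide_le_eq field_simps)
    also have "\<dots> \<le> 9 * \<beta> / \<alpha> * (1 / \<alpha> ^ p * (R / r))"
      using n(2) pos r \<alpha>_pos \<beta>_pos by (intro mult_left_mono) (simp_all add: field_simps)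
    finally have R'h: "R' / ?h \<le> B * (R / r)" by (simp add: B_def mult_ac)
    have "real (plane_grid_count ?h (ball z R' \<inter> F)) \<le> Cu * (R' / ?h) powr u"
      using Cu(2)[OF pos(3) hR zF] .
    also have "\<dots> \<le> Cu * (B * (R / r)) powr u"
      using R'h hR pos Cu(1) u0 by (intro mult_left_mono powr_mono2) auto
    also have "\<dots> = Cu * (B powr u * (R / r) powr u)" by (simp only: powr_mult)
    finally have up: "real (plane_grid_count ?h (ball z R' \<inter> F)) \<le> Cu * (B powr u * (R / r) powr u)" .
    have "(R / r) powr \<theta> \<le> (1 / \<alpha> ^ n) powr \<theta>"
      using n(1) r pos \<theta> by (intro powr_mono2) (auto simp: field_simps)
    also have "\<dots> = ((1 / \<alpha> ^ p) powr \<theta>) ^ l"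
      using \<alpha>_pos by (simp add: n_def powr_power powr_powr powr_divide power_divide power_mult mult_ac flip: powr_realpow)
    finally have low: "(R / r) powr \<theta> \<le> real (card A) ^ l" by (simp add: cardA_eq)
    have "(R / r) powr \<theta> * real (grid_count r ?K) \<le> real (card A) ^ l * (2 * real (grid_count ?\<delta> ?K))"
    proof (rule mult_mono[OF low])
      have "grid_count r ?K \<le> (1 + 1) * grid_count ?\<delta> ?K"
        by (rule grid_count_rescale) (use \<delta>_r pos r in \<open>auto simp: bounded_Int\<close>)
      then show "real (grid_count r ?K) \<le> 2 * real (grid_count ?\<delta> ?K)" by (simp flip: of_nat_mult)
    qed auto
    also have "\<dots> \<le> C * (R / r) powr u" using count up unfolding C_def by linarith
    finally have "real (grid_count r ?K) \<le> C * (R / r) powr u / (R / r) powr \<theta>"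
      using r by (subst pos_le_divide_eq) (simp_all add: mult.commute)
    then show "real (grid_count r ?K) \<le> C * (R / r) powr (u - \<theta>)"
      by (simp add: powr_diff)
  qed (use grid_count_ge_1 in auto)
  then show ?thesis by (simp add: \<theta>_def)
qed

section \<open>Combining the bounds\<close>

text \<open>Makes the infimum for the projection one over a nonempty set and, by the comparison of
  exponents, bounds the Hoelder exponents by 1.\<close>

lemma one_assouad_exponent: "1 \<in> assouad_exponents grid_count proj_F"
proof -
  have "real (grid_count r (ball x R \<inter> proj_F)) \<le> 4 * (R / r) powr 1" if r: "0 < r" "r < R" for r R x
  proof -
    let ?c = "nat \<lceil>2 * (R / r)\<rceil>"
    have "a - b \<le> real ?c * r" if "a \<in> ball x R \<inter> proj_F" "b \<in> ball x R \<inter> proj_F" for a b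
    proof -
      have "a - b \<le> 2 * R" using that by (auto simp: dist_real_def)
      also have "\<dots> = 2 * (R / r) * r" using r by simp
      also have "\<dots> \<le> real ?c * r" using r real_nat_ceiling_ge by (intro mult_right_mono) auto
      finally show ?thesis .
    qed
    then have "grid_count r (ball x R \<inter> proj_F) \<le> ?c + 1"
      unfolding grid_count_def using card_floor_image_le[of _ "\<lambda>x. x"] r(1) by blast
    moreover have R: "1 \<le> R / r" using r by simp
    moreover have "real ?c \<le> 2 * (R / r) + 1" using R by linarith
    ultimately have "real (grid_count r (ball x R \<inter> proj_F)) \<le> 4 * (R / r)" by linarith
    then show ?thesis using r by simp
  qed
  then show ?thesis unfolding assouad_exponents_def by (intro CollectI exI[of _ 4]) auto
qed

lemma zero_interval_exponent: "0 \<in> interval_exponents proj_measure"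
proof -
  have "measure proj_measure J \<le> 1" if "is_interval J" for J
    unfolding measure_proj_measure(1)[OF real_interval_borel_measurable[OF that]] uniform_bernoulli_def
    by (rule bernoulli.P.prob_le_1)
  then show ?thesis unfolding interval_exponents_def by (intro CollectI exI[of _ 1]) auto
qed

lemma assouad_dim_proj_F_le:
  assumes "u \<in> assouad_exponents grid_count proj_F"
  shows "assouad_dim proj_F \<le> u"
  unfolding assouad_dim_eq(1)
  using assouad_exponents_nonneg[of _ grid_count proj_F] proj_F_nonempty grid_count_ge_1
  by (intro cInf_lower[OF assms] bdd_belowI[of _ 0]) blast

lemma assouad_dim_F_le:
  assumes "u \<in> assouad_exponents plane_grid_count F"
  shows "assouad_dim F \<le> u"
  unfolding assouad_dim_eq(2)
  using assouad_exponents_nonneg[of _ plane_grid_count F] F_nonempty plane_grid_count_ge_1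
  by (intro cInf_lower[OF assms] bdd_belowI[of _ 0]) blast

lemma le_assouad_dim_proj_F:
  assumes "\<And>u. u \<in> assouad_exponents grid_count proj_F \<Longrightarrow> c \<le> u"
  shows "c \<le> assouad_dim proj_F"
  unfolding assouad_dim_eq(1) using one_assouad_exponent assms by (intro cInf_greatest) auto

text \<open>Nonemptiness of the exponent set of F comes from the upper bound itself, taken with
  \<tau> = 0 and u = 1.\<close>

lemma le_assouad_dim_F:
  assumes "\<And>u. u \<in> assouad_exponents plane_grid_count F \<Longrightarrow> c \<le> u"
  shows "c \<le> assouad_dim F"
  unfolding assouad_dim_eq(2)
  using assouad_exponent_upper[OF zero_interval_exponent _ one_assouad_exponent] assms
  by (intro cInf_greatest) auto

section \<open>Passing from exponents to dimensions\<close>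

definition s :: real where "s = interval_exponent proj_measure"

lemma s_eq: "s = Sup (interval_exponents proj_measure)"
  by (simp add: s_def interval_exponent_def interval_exponents_def)

lemma le_s:
  assumes "\<tau> \<in> interval_exponents proj_measure"
  shows "\<tau> \<le> s"
proof -
  have "\<tau> \<le> 1" if "\<tau> \<in> interval_exponents proj_measure" for \<tau>
    using interval_exponent_le_assouad_exponent[OF that _ one_assouad_exponent] by (cases "\<tau> \<ge> 0") auto
  then show ?thesis unfolding s_eq by (intro cSup_upper[OF assms] bdd_aboveI)
qed

lemma ln_card_I_times_powr: "ln (real (card I) * \<beta> powr \<tau>) = ln (real (card I)) + \<tau> * ln \<beta>"
  using card_I_pos \<beta>_pos by (simp add: ln_mult ln_powr)

text \<open>The inequality for a single pair (\<tau>, u) is solved for \<tau>, so that the supremum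
  over \<tau> can be taken with u fixed, and then for u, so that the infimum can be taken.\<close>

lemma assouad_dim_upper_bound:
  "assouad_dim F \<le> assouad_dim proj_F + ln (real (card I) * \<beta> powr s) / (- ln \<alpha>)"
proof -
  let ?a = "- ln \<alpha>" and ?b = "- ln \<beta>" and ?m = "ln (real (card I))"
  have ln: "?a > 0" "?b > 0" using \<alpha>_pos \<alpha>_less_1 \<beta>_pos \<beta>_less_1 by auto
  have "assouad_dim F - ln (real (card I) * \<beta> powr s) / ?a \<le> u"
    if u: "u \<in> assouad_exponents grid_count proj_F" for u
  proof -
    have le: "\<tau> * ?b \<le> (u - assouad_dim F) * ?a + ?m"
      if \<tau>: "\<tau> \<in> interval_exponents proj_measure" "\<tau> \<ge> 0" for \<tau>
    proof -
      have "assouad_dim F \<le> u + (?m + \<tau> * ln \<beta>) / ?a"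
        using assouad_dim_F_le[OF assouad_exponent_upper[OF \<tau> u]] by (simp add: ln_card_I_times_powr)
      then have "assouad_dim F - u \<le> (?m + \<tau> * ln \<beta>) / ?a" by simp
      then have "(assouad_dim F - u) * ?a \<le> ?m + \<tau> * ln \<beta>" using ln(1) by (simp only: pos_le_divide_eq)
      then show ?thesis by (simp add: algebra_simps)
    qed
    have "s \<le> ((u - assouad_dim F) * ?a + ?m) / ?b"
      unfolding s_eq
    proof (rule cSup_least)
      show "interval_exponents proj_measure \<noteq> {}" using zero_interval_exponent by blast
      fix \<tau> assume \<tau>: "\<tau> \<in> interval_exponents proj_measure"
      \<comment> \<open>The estimates require \<tau> \<ge> 0, while the supremum also runs over
        negative exponents; \<open>max\<close> replaces those by 0.\<close>
      have "max \<tau> 0 \<in> interval_exponents proj_measure" using \<tau> zero_interval_exponent by (simp add: max_def)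
      from le[OF this] have "max \<tau> 0 \<le> ((u - assouad_dim F) * ?a + ?m) / ?b"
        using ln(2) by (simp only: pos_le_divide_eq)
      then show "\<tau> \<le> ((u - assouad_dim F) * ?a + ?m) / ?b" by simp
    qed
    then have "s * ?b \<le> (u - assouad_dim F) * ?a + ?m" using ln(2) by (simp only: pos_le_divide_eq)
    then have "assouad_dim F * ?a - u * ?a \<le> ?m + s * ln \<beta>" by (simp add: algebra_simps)
    then have "assouad_dim F - u \<le> (?m + s * ln \<beta>) / ?a"
      using ln(1) by (simp only: pos_le_divide_eq left_diff_distrib)
    then show ?thesis by (simp add: ln_card_I_times_powr)
  qed
  then have "assouad_dim F - ln (real (card I) * \<beta> powr s) / ?a \<le> assouad_dim proj_F"
    by (rule le_assouad_dim_proj_F)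
  then show ?thesis by simp
qed

lemma assouad_dim_box_bound:
  "box_dim proj_F + ln (real (card I) * \<beta> powr s) / (- ln \<alpha>) \<le> assouad_dim F"
proof (rule le_assouad_dim_F)
  fix u assume u: "u \<in> assouad_exponents plane_grid_count F"
  let ?a = "- ln \<alpha>" and ?b = "- ln \<beta>" and ?m = "ln (real (card I))"
  have ln: "?a > 0" "?b > 0" using \<alpha>_pos \<alpha>_less_1 \<beta>_pos \<beta>_less_1 by auto
  show "box_dim proj_F + ln (real (card I) * \<beta> powr s) / ?a \<le> u"
  proof (rule field_le_epsilon)
    fix e :: real assume e: "e > 0"
    obtain d where d: "d \<ge> 0" "d > box_dim proj_F - e / 2" "lower_box_exponent d"
      using box_dim_lower_exponents[of "box_dim proj_F - e / 2"] e by auto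
    \<comment> \<open>T exceeds s by the amount that lowers the logarithmic term by exactly e / 2.
      The other half of e was spent on the box dimension.\<close>
    define T where "T = s + e / 2 * ?a / ?b"
    have "e / 2 * ?a / ?b > 0" using e ln by (intro divide_pos_pos mult_pos_pos) auto
    then have "T > s" by (simp add: T_def)
    then have T: "T \<notin> interval_exponents proj_measure" "T \<ge> 0"
      using le_s[of T] le_s[OF zero_interval_exponent] by auto
    have "d + (?m + T * ln \<beta>) / ?a \<le> u"
      by (rule assouad_exponent_ge_interval_bound[OF u d(3,1) T])
    moreover have "(?m + T * ln \<beta>) / ?a = ln (real (card I) * \<beta> powr s) / ?a - e / 2"
      using ln unfolding T_def ln_card_I_times_powr by (simp add: field_simps)
    ultimately have "d + (ln (real (card I) * \<beta> powr s) / ?a - e / 2) \<le> u" by (simp only:)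
    with d(2) show "box_dim proj_F + ln (real (card I) * \<beta> powr s) / ?a \<le> u + e" by argo
  qed
qed

lemma proj_word_map_unit_square:
  "fst ` word_map S w ` unit_square = {xoff w..xoff w + \<beta> ^ length w}"
proof
  have b: "\<beta> ^ length w > 0" using \<beta>_pos by simp
  show "fst ` word_map S w ` unit_square \<subseteq> {xoff w..xoff w + \<beta> ^ length w}"
    using b by (auto simp: word_map_eq unit_square_def mult_left_le)
  show "{xoff w..xoff w + \<beta> ^ length w} \<subseteq> fst ` word_map S w ` unit_square"
  proof
    fix x assume "x \<in> {xoff w..xoff w + \<beta> ^ length w}"
    then have "((x - xoff w) / \<beta> ^ length w, 0) \<in> unit_square"
      using b by (auto simp: unit_square_def pos_divide_le_eq)
    moreover have "x = fst (word_map S w ((x - xoff w) / \<beta> ^ length w, 0))"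
      using \<beta>_pos by (simp add: word_map_eq)
    ultimately show "x \<in> fst ` word_map S w ` unit_square" by blast
  qed
qed

text \<open>Equal projected intervals have equal length \<beta>^n, which forces equal word lengths.
  Each class is therefore a finite set of words of one length, as the iteration needs.\<close>

lemma same_projection_class:
  assumes w: "w \<in> nonempty_words I"
  shows "same_projection I S `` {w} \<subseteq> words (length w)"
    and "w \<in> same_projection I S `` {w}"
    and "\<And>v. v \<in> same_projection I S `` {w} \<Longrightarrow> xoff v = xoff w"
proof -
  have eq: "length v = length w \<and> xoff v = xoff w" if "(w, v) \<in> same_projection I S" for v
  proof -
    have "{xoff w..xoff w + \<beta> ^ length w} = {xoff v..xoff v + \<beta> ^ length v}"
      using that by (simp add: same_projection_def proj_word_map_unit_square)
    moreover have "\<beta> ^ length w > 0" "\<beta> ^ length v > 0" using \<beta>_pos by auto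
    ultimately have "xoff v = xoff w" "\<beta> ^ length v = \<beta> ^ length w"
      by (auto simp: Icc_eq_Icc)
    then show ?thesis
      using power_strict_decreasing[of _ _ \<beta>] \<beta>_pos \<beta>_less_1 by (metis linorder_neqE_nat less_irrefl)
  qed
  show "same_projection I S `` {w} \<subseteq> words (length w)"
    using eq by (auto simp: words_def same_projection_def nonempty_words_def in_lists_conv_set)
  show "w \<in> same_projection I S `` {w}" using w by (simp add: same_projection_def)
  show "xoff v = xoff w" if "v \<in> same_projection I S `` {w}" for v using eq that by blast
qed

text \<open>Each class, with p the length of its words, yields the bound with its own quotient in
  place of the entropy. As the bound is the same number for all classes, it passes to the
  supremum.\<close>

lemma assouad_dim_entropy_bound:
  "assouad_dim proj_F + overlap_entropy I S / (- ln \<alpha>) \<le> assouad_dim F"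
proof -
  let ?a = "- ln \<alpha>"
  have ln: "?a > 0" using \<alpha>_pos \<alpha>_less_1 by auto
  have "overlap_entropy I S \<le> (assouad_dim F - assouad_dim proj_F) * ?a"
    unfolding overlap_entropy_def
  proof (rule cSUP_least)
    obtain i where "i \<in> I" using I_nonempty by blast
    then have "[i] \<in> nonempty_words I" by (simp add: nonempty_words_def)
    then show "nonempty_words I \<noteq> {}" by blast
    fix w assume w: "w \<in> nonempty_words I"
    let ?A = "same_projection I S `` {w}"
    let ?c = "ln (real (card ?A)) / real (length w)"
    note cl = same_projection_class[OF w]
    have len: "length w > 0" using w by (simp add: nonempty_words_def)
    have A: "?A \<noteq> {}" "\<And>v v'. v \<in> ?A \<Longrightarrow> v' \<in> ?A \<Longrightarrow> xoff v = xoff v'"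
      using cl(2) cl(3) by (blast, metis)
    have "assouad_dim proj_F + ?c / ?a \<le> assouad_dim F"
    proof (rule le_assouad_dim_F)
      fix u assume u: "u \<in> assouad_exponents plane_grid_count F"
      show "assouad_dim proj_F + ?c / ?a \<le> u"
        using assouad_dim_proj_F_le[OF assouad_exponent_minus_entropy[OF u len cl(1) A]] by simp
    qed
    then have "?c / ?a \<le> assouad_dim F - assouad_dim proj_F" by simp
    then show "?c \<le> (assouad_dim F - assouad_dim proj_F) * ?a" using ln by (simp only: pos_divide_le_eq)
  qed
  then have "overlap_entropy I S / ?a \<le> assouad_dim F - assouad_dim proj_F" using ln by (simp only: pos_divide_le_eq)
  then show ?thesis by simp
qed

end

theorem theorem2p2:
  fixes I :: "'i set" and t :: "'i \<Rightarrow> real \<times> real" and \<alpha> \<beta> :: real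
    and S :: "'i \<Rightarrow> real \<times> real \<Rightarrow> real \<times> real" and F :: "(real \<times> real) set"
    and m s H :: real
  assumes "finite I"
    and "0 < \<alpha>" and "\<alpha> < \<beta>" and "\<beta> < 1"
    and "\<And>i. i \<in> I \<Longrightarrow> t i \<in> {0..1 - \<beta>} \<times> {0..1 - \<alpha>}"
    and "S = ifs_map \<alpha> \<beta> t"
    and "disjoint_family_on (\<lambda>i. interior (S i ` unit_square)) I"
    and "is_attractor I S F"
    and "m = real (card I)"
    and "s = interval_exponent (distr (ifs_measure I S) borel fst)"
    and "H = overlap_entropy I S"
  shows "max (box_dim (fst ` F) + ln (m * \<beta> powr s) / (- ln \<alpha>))
             (assouad_dim (fst ` F) + H / (- ln \<alpha>)) \<le> assouad_dim F
       \<and> assouad_dim F \<le> assouad_dim (fst ` F) + ln (m * \<beta> powr s) / (- ln \<alpha>)"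
proof -
  interpret carpet: self_affine_carpet I t \<alpha> \<beta> F
    using assms by unfold_locales auto
  have "s = carpet.s" by (simp add: assms carpet.s_def carpet.proj_measure_def)
  then show ?thesis
    using carpet.assouad_dim_box_bound carpet.assouad_dim_entropy_bound carpet.assouad_dim_upper_bound assms
    by simp
qed

end
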